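(* There exist a complete first-order theory, sets $A\subseteq B$ in its monster model, and an NIP type $p\in S(B)$ which does not fork over $A$, such that $p\restriction A$ has IP and $p$ is neither distal nor co-distal.
   Context: NIP types: a partial type $\pi(x)$ has IP if there are a formula $\varphi(x,y)$ without parameters and realizations $(a_i)_{i<\omega}$ of $\pi$ such that for every $s\subseteq\omega$ the set $\{\varphi(a_i,y): i\in s\}\cup\{\neg\varphi(a_i,y): i\notin s\}$ is consistent; otherwise it is NIP. Distal: a partial type $\Sigma(x)$ is distal if for every tuple $d$ and every indiscernible sequence $I_1+a+I_2$ of realizations of $\Sigma$, where $I_1,I_2$ are infinite without endpoints, $I_1+I_2$ is $d$-indiscernible iff $I_1+a+I_2$ is $d$-indiscernible. Co-distal: a partial type $\Sigma(x)$ over $A$ is co-distal over $A$ if for every $d\models\Sigma$ and every $A$-indiscernible sequence $I_1+a+I_2$ (with $I_1,I_2$ infinite without endpoints), if $I_1+I_2$ is indiscernible over $Ad$ then $I_1+a+I_2$ is indiscernible over $Ad$. When $A$ is not specified it is the domain of the type (so here $B$ for $p\in S(B)$). *)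

theory Defs
  imports Main
begin

unbundle cardinal_syntax

section \<open>First-order languages, formulas and structures\<close>

record ('f, 'r) language =
  Funs :: "'f set"
  Rels :: "'r set"
  farity :: "'f \<Rightarrow> nat"
  rarity :: "'r \<Rightarrow> nat"

datatype 'f trm = Var nat | Fn 'f "'f trm list"

datatype ('f, 'r) fm =
    Bot
  | Eq "'f trm" "'f trm"
  | Rel 'r "'f trm list"
  | Imp "('f, 'r) fm" "('f, 'r) fm"
  | All nat "('f, 'r) fm"

abbreviation Neg :: "('f, 'r) fm \<Rightarrow> ('f, 'r) fm" where
  "Neg \<phi> \<equiv> Imp \<phi> Bot"

fun wf_trm :: "('f, 'r) language \<Rightarrow> 'f trm \<Rightarrow> bool" where
  "wf_trm L (Var v) \<longleftrightarrow> True"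
| "wf_trm L (Fn f ts) \<longleftrightarrow> f \<in> Funs L \<and> length ts = farity L f \<and> (\<forall>t\<in>set ts. wf_trm L t)"

fun wf_fm :: "('f, 'r) language \<Rightarrow> ('f, 'r) fm \<Rightarrow> bool" where
  "wf_fm L Bot \<longleftrightarrow> True"
| "wf_fm L (Eq s t) \<longleftrightarrow> wf_trm L s \<and> wf_trm L t"
| "wf_fm L (Rel R ts) \<longleftrightarrow> R \<in> Rels L \<and> length ts = rarity L R \<and> (\<forall>t\<in>set ts. wf_trm L t)"
| "wf_fm L (Imp \<phi> \<psi>) \<longleftrightarrow> wf_fm L \<phi> \<and> wf_fm L \<psi>"
| "wf_fm L (All v \<phi>) \<longleftrightarrow> wf_fm L \<phi>"

fun fv_trm :: "'f trm \<Rightarrow> nat set" where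
  "fv_trm (Var v) = {v}"
| "fv_trm (Fn f ts) = (\<Union>t\<in>set ts. fv_trm t)"

fun fv :: "('f, 'r) fm \<Rightarrow> nat set" where
  "fv Bot = {}"
| "fv (Eq s t) = fv_trm s \<union> fv_trm t"
| "fv (Rel R ts) = (\<Union>t\<in>set ts. fv_trm t)"
| "fv (Imp \<phi> \<psi>) = fv \<phi> \<union> fv \<psi>"
| "fv (All v \<phi>) = fv \<phi> - {v}"

definition sentences :: "('f, 'r) language \<Rightarrow> ('f, 'r) fm set" where
  "sentences L = {\<sigma>. wf_fm L \<sigma> \<and> fv \<sigma> = {}}"

record ('f, 'r, 'u) struct =
  carrier :: "'u set"
  finterp :: "'f \<Rightarrow> 'u list \<Rightarrow> 'u"
  rinterp :: "'r \<Rightarrow> 'u list \<Rightarrow> bool"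

definition tuples :: "('f, 'r, 'u) struct \<Rightarrow> nat \<Rightarrow> 'u list set" where
  "tuples M n = {a. length a = n \<and> set a \<subseteq> carrier M}"

definition is_struct :: "('f, 'r) language \<Rightarrow> ('f, 'r, 'u) struct \<Rightarrow> bool" where
  "is_struct L M \<longleftrightarrow> carrier M \<noteq> {} \<and>
     (\<forall>f\<in>Funs L. \<forall>a\<in>tuples M (farity L f). finterp M f a \<in> carrier M)"

fun val :: "('f, 'r, 'u) struct \<Rightarrow> (nat \<Rightarrow> 'u) \<Rightarrow> 'f trm \<Rightarrow> 'u" where
  "val M e (Var v) = e v"
| "val M e (Fn f ts) = finterp M f (map (val M e) ts)"

fun sat :: "('f, 'r, 'u) struct \<Rightarrow> (nat \<Rightarrow> 'u) \<Rightarrow> ('f, 'r) fm \<Rightarrow> bool" where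
  "sat M e Bot \<longleftrightarrow> False"
| "sat M e (Eq s t) \<longleftrightarrow> val M e s = val M e t"
| "sat M e (Rel R ts) \<longleftrightarrow> rinterp M R (map (val M e) ts)"
| "sat M e (Imp \<phi> \<psi>) \<longleftrightarrow> (sat M e \<phi> \<longrightarrow> sat M e \<psi>)"
| "sat M e (All v \<phi>) \<longleftrightarrow> (\<forall>a\<in>carrier M. sat M (e(v := a)) \<phi>)"

text \<open>The environment only matters for the free variables; variables beyond the
  length of the tuple receive the (unspecified) value of \<open>nth\<close> there.\<close>

definition holds :: "('f, 'r, 'u) struct \<Rightarrow> ('f, 'r) fm \<Rightarrow> 'u list \<Rightarrow> bool" where
  "holds M \<phi> a \<longleftrightarrow> sat M ((!) a) \<phi>"

definition models :: "('f, 'r) language \<Rightarrow> ('f, 'r, 'u) struct \<Rightarrow> ('f, 'r) fm set \<Rightarrow> bool" where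
  "models L M T \<longleftrightarrow> is_struct L M \<and> (\<forall>\<sigma>\<in>T. holds M \<sigma> [])"

text \<open>Models are taken with universe inside the type \<open>'u\<close>. For a countable
  language and infinite \<open>'u\<close> this is ordinary satisfiability and ordinary
  entailment, by downward Loewenheim-Skolem.\<close>

definition complete_theory ::
    "'u itself \<Rightarrow> ('f, 'r) language \<Rightarrow> ('f, 'r) fm set \<Rightarrow> bool" where
  "complete_theory U L T \<longleftrightarrow> T \<subseteq> sentences L \<and>
     (\<exists>M :: ('f, 'r, 'u) struct. models L M T) \<and>
     (\<forall>\<sigma>\<in>sentences L.
        (\<forall>M :: ('f, 'r, 'u) struct. models L M T \<longrightarrow> holds M \<sigma> []) \<or>
        (\<forall>M :: ('f, 'r, 'u) struct. models L M T \<longrightarrow> holds M (Neg \<sigma>) []))"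

section \<open>Types\<close>

text \<open>A formula \<open>\<phi>(x,b)\<close> with parameters is a pair \<open>(\<phi>, b)\<close>: if \<open>x\<close> has length \<open>n\<close>, then
  the variables \<open>0, \<dots>, n - 1\<close> of \<open>\<phi>\<close> stand for \<open>x\<close> and the next \<open>length b\<close> variables
  for \<open>b\<close>.\<close>

type_synonym ('f, 'r, 'u) pfm = "('f, 'r) fm \<times> 'u list"

definition forms_over ::
    "('f, 'r) language \<Rightarrow> nat \<Rightarrow> 'u set \<Rightarrow> ('f, 'r, 'u) pfm set" where
  "forms_over L n A =
     {(\<phi>, b). wf_fm L \<phi> \<and> fv \<phi> \<subseteq> {..<n + length b} \<and> set b \<subseteq> A}"

definition pholds :: "('f, 'r, 'u) struct \<Rightarrow> 'u list \<Rightarrow> ('f, 'r, 'u) pfm \<Rightarrow> bool" where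
  "pholds M a \<psi> \<longleftrightarrow> holds M (fst \<psi>) (a @ snd \<psi>)"

definition realizes ::
    "('f, 'r, 'u) struct \<Rightarrow> nat \<Rightarrow> ('f, 'r, 'u) pfm set \<Rightarrow> 'u list \<Rightarrow> bool" where
  "realizes M n \<Sigma> a \<longleftrightarrow> a \<in> tuples M n \<and> (\<forall>\<psi>\<in>\<Sigma>. pholds M a \<psi>)"

text \<open>Consistency with the elementary diagram of \<open>M\<close>, i.e. finite satisfiability in \<open>M\<close>.\<close>

definition consistent :: "('f, 'r, 'u) struct \<Rightarrow> nat \<Rightarrow> ('f, 'r, 'u) pfm set \<Rightarrow> bool" where
  "consistent M n \<Sigma> \<longleftrightarrow> (\<forall>\<Delta>\<subseteq>\<Sigma>. finite \<Delta> \<longrightarrow> (\<exists>a. realizes M n \<Delta> a))"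

definition partial_type ::
    "('f, 'r) language \<Rightarrow> ('f, 'r, 'u) struct \<Rightarrow> nat \<Rightarrow> 'u set \<Rightarrow> ('f, 'r, 'u) pfm set \<Rightarrow> bool" where
  "partial_type L M n A \<Sigma> \<longleftrightarrow> \<Sigma> \<subseteq> forms_over L n A \<and> consistent M n \<Sigma>"

definition type_space ::
    "('f, 'r) language \<Rightarrow> ('f, 'r, 'u) struct \<Rightarrow> nat \<Rightarrow> 'u set \<Rightarrow> ('f, 'r, 'u) pfm set set" where
  "type_space L M n A =
     {p. partial_type L M n A p \<and>
         (\<forall>(\<phi>, b)\<in>forms_over L n A. (\<phi>, b) \<in> p \<or> (Neg \<phi>, b) \<in> p)}"

definition restrict_type ::
    "('f, 'r) language \<Rightarrow> nat \<Rightarrow> 'u set \<Rightarrow> ('f, 'r, 'u) pfm set \<Rightarrow> ('f, 'r, 'u) pfm set" where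
  "restrict_type L n A p = p \<inter> forms_over L n A"

definition same_type ::
    "('f, 'r) language \<Rightarrow> ('f, 'r, 'u) struct \<Rightarrow> 'u set \<Rightarrow> 'u list \<Rightarrow> 'u list \<Rightarrow> bool" where
  "same_type L M A a b \<longleftrightarrow> length a = length b \<and>
     (\<forall>\<psi>\<in>forms_over L (length a) A. pholds M a \<psi> \<longleftrightarrow> pholds M b \<psi>)"

section \<open>Monster models\<close>

definition small :: "'k rel \<Rightarrow> 'u set \<Rightarrow> bool" where
  "small \<kappa> A \<longleftrightarrow> |A| <o \<kappa>"

definition saturated ::
    "'k rel \<Rightarrow> ('f, 'r) language \<Rightarrow> ('f, 'r, 'u) struct \<Rightarrow> bool" where
  "saturated \<kappa> L M \<longleftrightarrow>
     (\<forall>A \<Sigma>. A \<subseteq> carrier M \<and> small \<kappa> A \<and> partial_type L M 1 A \<Sigma> \<longrightarrow> (\<exists>a. realizes M 1 \<Sigma> a))"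

definition automorphism ::
    "('f, 'r) language \<Rightarrow> ('f, 'r, 'u) struct \<Rightarrow> ('u \<Rightarrow> 'u) \<Rightarrow> bool" where
  "automorphism L M g \<longleftrightarrow> bij_betw g (carrier M) (carrier M) \<and>
     (\<forall>f\<in>Funs L. \<forall>a\<in>tuples M (farity L f). g (finterp M f a) = finterp M f (map g a)) \<and>
     (\<forall>R\<in>Rels L. \<forall>a\<in>tuples M (rarity L R). rinterp M R a \<longleftrightarrow> rinterp M R (map g a))"

definition partial_elementary ::
    "('f, 'r) language \<Rightarrow> ('f, 'r, 'u) struct \<Rightarrow> 'u set \<Rightarrow> ('u \<Rightarrow> 'u) \<Rightarrow> bool" where
  "partial_elementary L M A h \<longleftrightarrow> A \<subseteq> carrier M \<and> h ` A \<subseteq> carrier M \<and>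
     (\<forall>a. set a \<subseteq> A \<longrightarrow> same_type L M {} a (map h a))"

definition strongly_homogeneous ::
    "'k rel \<Rightarrow> ('f, 'r) language \<Rightarrow> ('f, 'r, 'u) struct \<Rightarrow> bool" where
  "strongly_homogeneous \<kappa> L M \<longleftrightarrow>
     (\<forall>A h. small \<kappa> A \<and> partial_elementary L M A h \<longrightarrow>
        (\<exists>g. automorphism L M g \<and> (\<forall>a\<in>A. g a = h a)))"

text \<open>A monster model is \<open>\<kappa>\<close>-saturated and strongly \<open>\<kappa>\<close>-homogeneous for a cardinal
  \<open>\<kappa>\<close> greater than the number of formulas of \<open>L\<close> (so \<open>\<kappa>\<close> is uncountable).\<close>

definition monster_model ::
    "'k rel \<Rightarrow> ('f, 'r) language \<Rightarrow> ('f, 'r) fm set \<Rightarrow> ('f, 'r, 'u) struct \<Rightarrow> bool" where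
  "monster_model \<kappa> L T M \<longleftrightarrow> models L M T \<and>
     Card_order \<kappa> \<and> |{\<phi>. wf_fm L \<phi>}| <o \<kappa> \<and>
     saturated \<kappa> L M \<and> strongly_homogeneous \<kappa> L M"

section \<open>Forking\<close>

definition divides ::
    "('f, 'r) language \<Rightarrow> ('f, 'r, 'u) struct \<Rightarrow> nat \<Rightarrow> 'u set \<Rightarrow> ('f, 'r, 'u) pfm \<Rightarrow> bool" where
  "divides L M n A \<psi> \<longleftrightarrow>
     (\<exists>(b :: nat \<Rightarrow> 'u list) k.
        (\<forall>i. set (b i) \<subseteq> carrier M \<and> same_type L M A (b i) (snd \<psi>)) \<and>
        (\<forall>S. finite S \<and> card S = k \<longrightarrow> \<not> (\<exists>a\<in>tuples M n. \<forall>i\<in>S. pholds M a (fst \<psi>, b i))))"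

text \<open>Implication between types is inclusion of the sets of realizations in the monster
  model.\<close>

definition forks ::
    "('f, 'r) language \<Rightarrow> ('f, 'r, 'u) struct \<Rightarrow> nat \<Rightarrow> 'u set \<Rightarrow> ('f, 'r, 'u) pfm set \<Rightarrow> bool" where
  "forks L M n A p \<longleftrightarrow>
     (\<exists>\<Psi>. finite \<Psi> \<and> \<Psi> \<subseteq> forms_over L n (carrier M) \<and>
        (\<forall>\<psi>\<in>\<Psi>. divides L M n A \<psi>) \<and>
        (\<forall>a. realizes M n p a \<longrightarrow> (\<exists>\<psi>\<in>\<Psi>. pholds M a \<psi>)))"

section \<open>NIP, distal and co-distal types\<close>

text \<open>Here \<open>\<phi>(x,y)\<close> has \<open>y\<close> as the variables \<open>0, \<dots>, m - 1\<close> and \<open>x\<close> as the variables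
  \<open>m, \<dots>, m + n - 1\<close>, so that \<open>\<phi>(a, y)\<close> is the formula \<open>(\<phi>, a)\<close> in the free tuple \<open>y\<close>.\<close>

definition IP ::
    "('f, 'r) language \<Rightarrow> ('f, 'r, 'u) struct \<Rightarrow> nat \<Rightarrow> ('f, 'r, 'u) pfm set \<Rightarrow> bool" where
  "IP L M n \<Sigma> \<longleftrightarrow>
     (\<exists>\<phi> m (a :: nat \<Rightarrow> 'u list).
        wf_fm L \<phi> \<and> fv \<phi> \<subseteq> {..<m + n} \<and>
        (\<forall>i. realizes M n \<Sigma> (a i)) \<and>
        (\<forall>s. consistent M m ({(\<phi>, a i) | i. i \<in> s} \<union> {(Neg \<phi>, a i) | i. i \<notin> s})))"

abbreviation NIP ::
    "('f, 'r) language \<Rightarrow> ('f, 'r, 'u) struct \<Rightarrow> nat \<Rightarrow> ('f, 'r, 'u) pfm set \<Rightarrow> bool" where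
  "NIP L M n \<Sigma> \<equiv> \<not> IP L M n \<Sigma>"

text \<open>Sequences of tuples are indexed by a set \<open>J\<close> with a strict linear order \<open>r\<close>.
  Indiscernibility is over the parameter set \<open>C\<close>.\<close>

definition indiscernible ::
    "('f, 'r) language \<Rightarrow> ('f, 'r, 'u) struct \<Rightarrow> 'u set \<Rightarrow> 'i set \<Rightarrow> 'i rel \<Rightarrow> ('i \<Rightarrow> 'u list) \<Rightarrow> bool"
  where
  "indiscernible L M C J r s \<longleftrightarrow>
     (\<forall>is js. set is \<subseteq> J \<and> set js \<subseteq> J \<and> length is = length js \<and>
        sorted_wrt (\<lambda>i j. (i, j) \<in> r) is \<and> sorted_wrt (\<lambda>i j. (i, j) \<in> r) js \<longrightarrow>
        same_type L M C (concat (map s is)) (concat (map s js)))"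

definition infinite_no_endpoints :: "'i set \<Rightarrow> 'i rel \<Rightarrow> bool" where
  "infinite_no_endpoints J r \<longleftrightarrow> infinite J \<and>
     (\<forall>j\<in>J. (\<exists>i\<in>J. (i, j) \<in> r) \<and> (\<exists>i\<in>J. (j, i) \<in> r))"

text \<open>A sequence \<open>I\<^sub>1 + a + I\<^sub>2\<close> of \<open>k\<close>-tuples is a sequence over \<open>(J, r)\<close> with a distinguished index
  \<open>c\<close>: \<open>I\<^sub>1\<close>, \<open>a\<close>, \<open>I\<^sub>2\<close> are the parts below, at and above \<open>c\<close>, and \<open>I\<^sub>1 + I\<^sub>2\<close> is the
  sequence over \<open>J - {c}\<close>.\<close>

definition cut_sequence ::
    "('f, 'r, 'u) struct \<Rightarrow> nat \<Rightarrow> 'i set \<Rightarrow> 'i rel \<Rightarrow> 'i \<Rightarrow> ('i \<Rightarrow> 'u list) \<Rightarrow> bool" where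
  "cut_sequence M k J r c s \<longleftrightarrow>
     strict_linear_order_on J r \<and> c \<in> J \<and>
     infinite_no_endpoints {j\<in>J. (j, c) \<in> r} r \<and>
     infinite_no_endpoints {j\<in>J. (c, j) \<in> r} r \<and>
     (\<forall>j\<in>J. s j \<in> tuples M k)"

text \<open>Indices of sequences are taken from \<open>'u\<close>: a non-constant indiscernible sequence is
  injective, so (for infinite \<open>'u\<close>) this covers all index orders up to isomorphism.\<close>

definition distal ::
    "('f, 'r) language \<Rightarrow> ('f, 'r, 'u) struct \<Rightarrow> nat \<Rightarrow> ('f, 'r, 'u) pfm set \<Rightarrow> bool" where
  "distal L M n \<Sigma> \<longleftrightarrow>
     (\<forall>d (J :: 'u set) r c s.
        set d \<subseteq> carrier M \<and> cut_sequence M n J r c s \<and>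
        (\<forall>j\<in>J. realizes M n \<Sigma> (s j)) \<and> indiscernible L M {} J r s \<longrightarrow>
        (indiscernible L M (set d) (J - {c}) r s \<longleftrightarrow> indiscernible L M (set d) J r s))"

definition codistal ::
    "('f, 'r) language \<Rightarrow> ('f, 'r, 'u) struct \<Rightarrow> nat \<Rightarrow> 'u set \<Rightarrow> ('f, 'r, 'u) pfm set \<Rightarrow> bool" where
  "codistal L M n A \<Sigma> \<longleftrightarrow>
     (\<forall>d k (J :: 'u set) r c s.
        realizes M n \<Sigma> d \<and> cut_sequence M k J r c s \<and> indiscernible L M A J r s \<and>
        indiscernible L M (A \<union> set d) (J - {c}) r s \<longrightarrow>
        indiscernible L M (A \<union> set d) J r s)"

end

theory Submission
  imports Defs "HOL-Library.Countable_Set_Type" "HOL-Library.Diagonal_Subsequence"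
begin

text \<open>
  The example is a tree in which branching is governed by a random graph. A point \<open>x\<close>
  has a level \<open>lev x\<close> in a dense linear order, a labelling \<open>lab x\<close> of the
  levels below \<open>lev x\<close> by vertices of the graph, and a tag that merely makes infinitely
  many points share the same level and labels, that is, the same node. For points \<open>x\<close>
  and \<open>y\<close>, \<open>delta x y\<close> is the level at which their branches part. The
  language has two relations: the comparison \<open>delta x y \<le> delta u v\<close>, and
  \<open>rel x y\<close>, which says that the branches of \<open>x\<close> and \<open>y\<close> part
  below both points and that the two labels at the parting level are adjacent. The type
  \<open>p\<close> is the type over \<open>B = {b}\<close> of a point strictly below
  \<open>b\<close>, and \<open>A\<close> is empty.

  Why this works. The points below \<open>b\<close> lie on one branch. For such a point
  \<open>x\<close> and any \<open>y\<close>, \<open>rel x y\<close> can only hold if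
  \<open>y\<close> leaves the branch of \<open>b\<close> below \<open>x\<close>, and then it agrees
  with \<open>rel b y\<close>; so a finite tuple \<open>y\<close> sees of \<open>x\<close> only the
  position of \<open>lev x\<close> among finitely many levels, apart from equality with entries of
  \<open>y\<close>. Hence truth values along points below \<open>b\<close> alternate boundedly often
  and \<open>p\<close> is NIP (\<open>elt_iso_below_interval\<close>, \<open>NIP_low_type\<close>).
  Over the empty set, however, all points have the same type, and points that branch off from one
  node with distinct labels are shattered by \<open>rel\<close>
  (\<open>IP_low_type_restrict\<close>). The type \<open>p\<close> does not fork over the empty set,
  because any countable set of parameters has a point below all of it, whose type over the
  parameters is determined by the type of the parameters: a formula true at such a point is true,
  for any countable family of conjugates of its parameters, at one common point
  (\<open>elt_iso_insert_under\<close>, \<open>low_type_not_forks\<close>). Finally, a sequence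
  inside a single node is indiscernible over everything outside it but not over one of its own
  members, which refutes distality and co-distality at once.

  All these arguments compare finite tuples by partial isomorphisms. This suffices because in the
  model every partial isomorphism between countable sets extends to an automorphism
  (\<open>elt_homogeneous\<close>), so that formulas never have to be analysed syntactically
  (\<open>holds_iso\<close>); this also yields strong homogeneity. For saturation, finitely
  satisfied countable types are approximated by sequences, and sequences have limit points
  (\<open>elt_compact\<close>). The theory is the complete theory of the model.

  The remaining task is to build an aleph-one-saturated, strongly aleph-one-homogeneous model inside
  the type of sets of sets of natural numbers, without assuming anything about the continuum. Three
  layers are built explicitly, each with its own canonical extension of countable partial
  isomorphisms. The levels are the surreal numbers of countable length; an isomorphism of countable
  subsets extends by Conway's recursion, sending \<open>x\<close> to the simplest number in the cut
  that the images of its prefixes and of the given points determine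
  (\<open>gam_homogeneous\<close>). The graph consists of well-founded trees, a vertex being a
  countable set of earlier neighbours with an index; an isomorphism of countable subgraphs is first
  closed under taking neighbour sets and then extends by recursion
  (\<open>graph_homogeneous\<close>). In the tree, an isomorphism extends by first moving levels,
  then permuting labels node by node, and last permuting tags.
\<close>

section \<open>Countable partial maps\<close>

lemma uncountable_nat_sets: "uncountable (UNIV :: nat set set)"
proof
  assume "countable (UNIV :: nat set set)"
  then obtain f :: "nat \<Rightarrow> nat set" where f: "range f = UNIV"
    by (metis UNIV_not_empty uncountable_def)
  obtain n where "f n = {k. k \<notin> f k}"
    using f by (metis rangeE UNIV_I)
  then show False by blast
qed

text \<open>A countably infinite set \<open>Z\<close> outside both \<open>K\<close> and
  \<open>K'\<close> absorbs the countable differences between the two complements.\<close>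

lemma cocountable_bij_betw:
  fixes K K' :: "'w set"
  assumes "uncountable (UNIV :: 'w set)" "countable K" "countable K'"
  shows "\<exists>f. bij_betw f (- K) (- K')"
proof -
  have "infinite (UNIV - (K \<union> K'))"
    using assms by (intro uncountable_infinite uncountable_minus_countable) auto
  then obtain Z where Z: "Z \<subseteq> - (K \<union> K')" "countable Z" "infinite Z"
    by (metis Compl_eq_Diff_UNIV infinite_countable_subset')
  define W where "W = - (K \<union> K' \<union> Z)"
  have "countable (Z \<union> (K' - K))" "countable (Z \<union> (K - K'))"
    "infinite (Z \<union> (K' - K))" "infinite (Z \<union> (K - K'))"
    using assms Z by auto
  then obtain f where f: "bij_betw f (Z \<union> (K' - K)) (Z \<union> (K - K'))"
    by (meson bij_betw_trans to_nat_on_infinite bij_betw_from_nat_into)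
  have "bij_betw (\<lambda>x. if x \<in> Z \<union> (K' - K) then f x else id x)
     ((Z \<union> (K' - K)) \<union> W) ((Z \<union> (K - K')) \<union> W)"
    by (rule bij_betw_disjoint_Un[OF f bij_betw_id]) (auto simp: W_def)
  moreover have "(Z \<union> (K' - K)) \<union> W = - K" "(Z \<union> (K - K')) \<union> W = - K'"
    using Z by (auto simp: W_def)
  ultimately show ?thesis by auto
qed

lemma countable_partial_bijection_extends:
  fixes h :: "('w \<times> 'w) set"
  assumes unc: "uncountable (UNIV :: 'w set)" and "countable h"
    and inj: "\<And>x y x' y'. (x, y) \<in> h \<Longrightarrow> (x', y') \<in> h \<Longrightarrow> x = x' \<longleftrightarrow> y = y'"
  shows "\<exists>f. bij f \<and> (\<forall>(x, y)\<in>h. f x = y)"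
proof -
  have "Domain h = fst ` h" "Range h = snd ` h" by force+
  then have cnt: "countable (Domain h)" "countable (Range h)"
    using \<open>countable h\<close> by auto
  obtain g where g: "bij_betw g (- Domain h) (- Range h)"
    using cocountable_bij_betw[OF unc cnt] by blast
  define k where "k x = (THE y. (x, y) \<in> h)" for x
  have k: "k x = y" if "(x, y) \<in> h" for x y
    unfolding k_def using that inj by (intro the_equality) auto
  have "bij_betw k (Domain h) (Range h)"
    by (rule bij_betwI'; use k inj in blast)
  then have "bij_betw (\<lambda>x. if x \<in> Domain h then k x else g x)
      (Domain h \<union> - Domain h) (Range h \<union> - Range h)"
    by (rule bij_betw_disjoint_Un[OF _ g]) auto
  then show ?thesis
    using k by (intro exI[of _ "\<lambda>x. if x \<in> Domain h then k x else g x"])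
      (auto simp: Compl_partition Domain_iff)
qed

text \<open>Iterated one-point extension, for conditions that only involve two pairs at a time and
  therefore pass to unions of chains.\<close>

lemma pairwise_extension:
  fixes Q :: "'a \<times> 'b \<Rightarrow> 'a \<times> 'b \<Rightarrow> bool"
  defines "ok \<equiv> \<lambda>h. \<forall>p\<in>h. \<forall>q\<in>h. Q p q"
  assumes ext: "\<And>h x. countable h \<Longrightarrow> ok h \<Longrightarrow> x \<in> X \<Longrightarrow> \<exists>y. ok (insert (x, y) h)"
    and h: "countable h" "ok h" and D: "countable D" "D \<subseteq> X"
  shows "\<exists>h'. h \<subseteq> h' \<and> countable h' \<and> ok h' \<and> D \<subseteq> Domain h'"
proof (cases "D = {}")
  case True then show ?thesis using h by blast
next
  case False
  define d where "d = from_nat_into D"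
  have "range d = D"
    unfolding d_def using range_from_nat_into[OF False D(1)] .
  moreover have "d n \<in> X" for n
    unfolding d_def using from_nat_into[OF False] D(2) by blast
  ultimately have d: "range d = D" "\<And>n. d n \<in> X" by blast+
  define y where "y n H = (SOME y. ok (insert (d n, y) H))" for n H
  define H where "H = rec_nat h (\<lambda>n H. insert (d n, y n H) H)"
  have H0: "H 0 = h" and HS: "\<And>n. H (Suc n) = insert (d n, y n (H n)) (H n)"
    by (simp_all add: H_def)
  have Hok: "countable (H n) \<and> ok (H n)" for n
  proof (induction n)
    case 0 show ?case using h by (simp add: H0)
  next
    case (Suc n)
    then have "\<exists>y. ok (insert (d n, y) (H n))" using ext d(2) by blast
    then have "ok (insert (d n, y n (H n)) (H n))" unfolding y_def by (rule someI_ex)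
    then show ?case using Suc by (simp add: HS)
  qed
  have mono: "mono H" by (rule mono_iff_le_Suc[THEN iffD2]) (auto simp: HS)
  have "ok (\<Union>n. H n)"
  proof -
    have "Q p q" if "p \<in> H m" "q \<in> H n" for p q m n
    proof -
      have "p \<in> H (max m n)" "q \<in> H (max m n)"
        using that monoD[OF mono, of m "max m n"] monoD[OF mono, of n "max m n"] by auto
      then show ?thesis using Hok[of "max m n"] unfolding ok_def by blast
    qed
    then show ?thesis unfolding ok_def by blast
  qed
  moreover have "D \<subseteq> Domain (\<Union>n. H n)"
    using d(1) HS by fastforce
  moreover have "h \<subseteq> (\<Union>n. H n)" using H0 by blast
  ultimately show ?thesis using Hok by (intro exI[of _ "\<Union>n. H n"]) auto
qed

section \<open>The first uncountable ordinal\<close>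

text \<open>A well-order in which exactly the countable sets are bounded; it indexes the positions
  in sign sequences.\<close>

typedef omega1 = "Field (cardSuc natLeq)"
  using Field_cardSuc_not_empty[OF natLeq_Card_order] by blast

instantiation omega1 :: wellorder
begin
definition "a \<le> b \<longleftrightarrow> (Rep_omega1 a, Rep_omega1 b) \<in> cardSuc natLeq"
definition "a < b \<longleftrightarrow> a \<le> b \<and> a \<noteq> (b :: omega1)"
instance
proof -
  let ?r = "cardSuc natLeq"
  have W: "Well_order ?r" by (simp add: cardSuc_Well_order natLeq_Card_order)
  then have refl: "Refl ?r" and trans: "trans ?r" and anti: "antisym ?r" and tot: "Total ?r"
    and wf: "wf (?r - Id)"
    by (auto simp: well_order_on_def linear_order_on_def partial_order_on_def preorder_on_def)
  have le_refl: "a \<le> a" for a :: omega1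
    using refl Rep_omega1[of a] by (simp add: less_eq_omega1_def refl_on_def)
  have anti': "a \<le> b \<Longrightarrow> b \<le> a \<Longrightarrow> a = b" for a b :: omega1
    using anti by (simp add: less_eq_omega1_def antisym_def) (metis Rep_omega1_inject)
  show "OFCLASS(omega1, wellorder_class)"
  proof (intro_classes)
    fix a b c :: omega1
    show "(a < b) = (a \<le> b \<and> \<not> b \<le> a)"
      using anti' le_refl by (auto simp: less_omega1_def)
    show "a \<le> a" by (rule le_refl)
    show "a \<le> b \<Longrightarrow> b \<le> c \<Longrightarrow> a \<le> c"
      using trans by (auto simp: less_eq_omega1_def elim: transE)
    show "a \<le> b \<Longrightarrow> b \<le> a \<Longrightarrow> a = b" by (rule anti')
    show "a \<le> b \<or> b \<le> a"
      using tot le_refl Rep_omega1[of a] Rep_omega1[of b]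
      by (cases "a = b") (auto simp: less_eq_omega1_def total_on_def Rep_omega1_inject)
  next
    fix P :: "omega1 \<Rightarrow> bool" and a :: omega1
    assume step: "\<And>x. (\<And>y. y < x \<Longrightarrow> P y) \<Longrightarrow> P x"
    have "wf (inv_image (?r - Id) Rep_omega1)" using wf by simp
    then show "P a"
    proof (induction a rule: wf_induct_rule)
      case (less x)
      show ?case
        by (rule step, rule less)
          (auto simp: less_omega1_def less_eq_omega1_def Rep_omega1_inject)
    qed
  qed
qed
end

lemma countable_below_omega1: "countable {..<a :: omega1}"
proof -
  have C: "Card_order (cardSuc natLeq)" by (simp add: cardSuc_Card_order natLeq_Card_order)
  have "|underS (cardSuc natLeq) (Rep_omega1 a)| <o cardSuc natLeq"
    by (rule card_of_underS[OF C Rep_omega1])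
  then have "|underS (cardSuc natLeq) (Rep_omega1 a)| \<le>o natLeq"
    by (simp add: cardSuc_ordLeq_ordLess[OF natLeq_Card_order card_of_Card_order])
  then have "countable (underS (cardSuc natLeq) (Rep_omega1 a))"
    by (simp add: countable_card_le_natLeq)
  moreover have "Rep_omega1 ` {..<a} \<subseteq> underS (cardSuc natLeq) (Rep_omega1 a)"
    by (auto simp: underS_def less_omega1_def less_eq_omega1_def Rep_omega1_inject)
  ultimately have "countable (Rep_omega1 ` {..<a})" by (rule countable_subset[rotated])
  then show ?thesis
    using countable_image_inj_on inj_on_def Rep_omega1_inject by metis
qed

lemma uncountable_omega1: "uncountable (UNIV :: omega1 set)"
proof
  assume "countable (UNIV :: omega1 set)"
  then have "countable (Field (cardSuc natLeq))"
    by (metis countable_image type_definition.Rep_range type_definition_omega1)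
  then have "|Field (cardSuc natLeq)| \<le>o natLeq" by (simp add: countable_card_le_natLeq)
  then have "cardSuc natLeq \<le>o natLeq"
    using card_of_Field_ordIso[OF cardSuc_Card_order[OF natLeq_Card_order]]
      ordIso_ordLeq_trans ordIso_symmetric by blast
  then show False
    using cardSuc_greater[OF natLeq_Card_order] not_ordLess_ordLeq by blast
qed

lemma countable_bounded_omega1:
  fixes X :: "omega1 set"
  assumes "countable X"
  shows "\<exists>a. \<forall>x\<in>X. x < a"
proof (rule ccontr)
  assume "\<not> ?thesis"
  then have "UNIV \<subseteq> (\<Union>x\<in>X. insert x {..<x})"
    by (auto simp: not_less) (metis order_le_less)
  moreover have "countable (\<Union>x\<in>X. insert x {..<x})"
    using assms countable_below_omega1 by auto
  ultimately show False
    using uncountable_omega1 countable_subset by blast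
qed

section \<open>A homogeneous linear order: surreal numbers of countable length\<close>

text \<open>A surreal number as a sign sequence: its length and the set of positions that carry a
  plus. Reading signs as \<open>1\<close> and \<open>-1\<close>, and positions beyond the length as
  \<open>0\<close>, turns the usual order of the surreal numbers into the lexicographic one.\<close>

typedef gam = "{p :: omega1 \<times> omega1 set. snd p \<subseteq> {..<fst p}}"
  by (rule exI[of _ "(undefined, {})"]) simp

definition len :: "gam \<Rightarrow> omega1" where "len x = fst (Rep_gam x)"

definition dig :: "gam \<Rightarrow> omega1 \<Rightarrow> int" where
  "dig x \<beta> = (if \<beta> < len x then if \<beta> \<in> snd (Rep_gam x) then 1 else - 1 else 0)"

definition mk_gam :: "omega1 \<Rightarrow> omega1 set \<Rightarrow> gam" where
  "mk_gam \<alpha> P = Abs_gam (\<alpha>, P \<inter> {..<\<alpha>})"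

lemma len_mk_gam [simp]: "len (mk_gam \<alpha> P) = \<alpha>"
  by (simp add: mk_gam_def len_def Abs_gam_inverse)

lemma dig_mk_gam [simp]: "dig (mk_gam \<alpha> P) \<beta> = (if \<beta> < \<alpha> then if \<beta> \<in> P then 1 else - 1 else 0)"
  by (simp add: dig_def) (simp add: mk_gam_def len_def Abs_gam_inverse)

lemma dig_eq_0_iff [simp]: "dig x \<beta> = 0 \<longleftrightarrow> len x \<le> \<beta>"
  by (auto simp: dig_def)

lemma dig_beyond [simp]: "len x \<le> \<beta> \<Longrightarrow> dig x \<beta> = 0"
  by simp

lemma dig_bounds: "- 1 \<le> dig x \<beta>" "dig x \<beta> \<le> 1"
  by (auto simp: dig_def)

lemma dig_cases: "\<gamma> < len x \<Longrightarrow> dig x \<gamma> = 1 \<or> dig x \<gamma> = - 1"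
  by (simp add: dig_def)

lemma gam_eqI:
  assumes "\<And>\<beta>. dig x \<beta> = dig y \<beta>"
  shows "x = y"
proof -
  have len: "len x = len y"
    using assms dig_eq_0_iff by (metis order_antisym order_refl)
  have "snd (Rep_gam x) = {\<beta>. dig x \<beta> = 1}" for x
    using Rep_gam[of x] by (auto simp: dig_def len_def)
  then have "snd (Rep_gam x) = snd (Rep_gam y)" using assms by simp
  moreover have "fst (Rep_gam x) = fst (Rep_gam y)" using len by (simp add: len_def)
  ultimately show ?thesis by (simp add: prod_eq_iff flip: Rep_gam_inject)
qed

lemma first_difference:
  assumes "x \<noteq> y"
  obtains \<beta> where "dig x \<beta> \<noteq> dig y \<beta>" "\<And>\<alpha>. \<alpha> < \<beta> \<Longrightarrow> dig x \<alpha> = dig y \<alpha>"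
proof -
  have "\<exists>\<beta>. dig x \<beta> \<noteq> dig y \<beta>" using assms gam_eqI by blast
  then have "dig x (LEAST \<beta>. dig x \<beta> \<noteq> dig y \<beta>) \<noteq> dig y (LEAST \<beta>. dig x \<beta> \<noteq> dig y \<beta>)"
    by (rule LeastI_ex)
  then show ?thesis
    using that not_less_Least[of _ "\<lambda>\<beta>. dig x \<beta> \<noteq> dig y \<beta>"] by blast
qed

instantiation gam :: linorder
begin
definition
  "x < (y :: gam) \<longleftrightarrow> (\<exists>\<beta>. (\<forall>\<alpha><\<beta>. dig x \<alpha> = dig y \<alpha>) \<and> dig x \<beta> < dig y \<beta>)"
definition
  "x \<le> (y :: gam) \<longleftrightarrow> x < y \<or> x = y"
instance
proof
  have irrefl: "\<not> x < x" for x :: gam by (simp add: less_gam_def)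
  have trans: "x < z" if xy: "x < y" and yz: "y < z" for x y z :: gam
  proof -
    obtain \<beta> \<gamma> where b: "\<forall>\<alpha><\<beta>. dig x \<alpha> = dig y \<alpha>" "dig x \<beta> < dig y \<beta>"
      and c: "\<forall>\<alpha><\<gamma>. dig y \<alpha> = dig z \<alpha>" "dig y \<gamma> < dig z \<gamma>"
      using xy yz by (auto simp: less_gam_def)
    show ?thesis
      unfolding less_gam_def
    proof (intro exI[of _ "min \<beta> \<gamma>"] conjI allI impI)
      show "dig x (min \<beta> \<gamma>) < dig z (min \<beta> \<gamma>)"
        using b c by (cases \<beta> \<gamma> rule: linorder_cases) auto
    qed (use b c in auto)
  qed
  fix x y z :: gam
  show "(x < y) = (x \<le> y \<and> \<not> y \<le> x)"
    using irrefl trans by (auto simp: less_eq_gam_def)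
  show "x \<le> x" by (simp add: less_eq_gam_def)
  show "x \<le> y \<Longrightarrow> y \<le> z \<Longrightarrow> x \<le> z"
    using trans by (auto simp: less_eq_gam_def)
  show "x \<le> y \<Longrightarrow> y \<le> x \<Longrightarrow> x = y"
    using trans irrefl unfolding less_eq_gam_def by metis
  show "x \<le> y \<or> y \<le> x"
  proof (cases "x = y")
    case False
    then obtain \<beta> where "dig x \<beta> \<noteq> dig y \<beta>" "\<And>\<alpha>. \<alpha> < \<beta> \<Longrightarrow> dig x \<alpha> = dig y \<alpha>"
      using first_difference by blast
    then show ?thesis
      unfolding less_eq_gam_def less_gam_def by (metis linorder_neqE)
  qed (simp add: less_eq_gam_def)
qed
end

definition trunc :: "gam \<Rightarrow> omega1 \<Rightarrow> gam" where
  "trunc x \<beta> = mk_gam (min \<beta> (len x)) {\<gamma>. dig x \<gamma> = 1}"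

lemma dig_trunc [simp]: "dig (trunc x \<beta>) \<gamma> = (if \<gamma> < \<beta> then dig x \<gamma> else 0)"
  using dig_cases[of \<gamma> x] by (auto simp: trunc_def)

text \<open>Proper initial segments, the surreal numbers simpler than \<open>x\<close> along its
  branch.\<close>

definition prefixes :: "gam \<Rightarrow> gam set" where
  "prefixes x = trunc x ` {..<len x}"

lemma countable_prefixes: "countable (prefixes x)"
  by (simp add: prefixes_def countable_below_omega1)

lemma prefixes_iff: "z \<in> prefixes x \<longleftrightarrow> len z < len x \<and> (\<forall>\<gamma><len z. dig z \<gamma> = dig x \<gamma>)"
proof
  assume "z \<in> prefixes x"
  then show "len z < len x \<and> (\<forall>\<gamma><len z. dig z \<gamma> = dig x \<gamma>)"
    by (auto simp: prefixes_def) (auto simp: trunc_def)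
next
  assume R: "len z < len x \<and> (\<forall>\<gamma><len z. dig z \<gamma> = dig x \<gamma>)"
  have "z = trunc x (len z)"
    by (rule gam_eqI) (use R in \<open>auto simp: not_less\<close>)
  then show "z \<in> prefixes x" using R unfolding prefixes_def by blast
qed

lemma prefixes_len: "z \<in> prefixes x \<Longrightarrow> len z < len x"
  by (simp add: prefixes_iff)

lemma prefixes_chain: "u \<in> prefixes x \<Longrightarrow> v \<in> prefixes x \<Longrightarrow> u = v \<or> u \<in> prefixes v \<or> v \<in> prefixes u"
proof (cases "len u" "len v" rule: linorder_cases)
  case equal
  assume "u \<in> prefixes x" "v \<in> prefixes x"
  have "dig u \<gamma> = dig v \<gamma>" for \<gamma>
  proof (cases "\<gamma> < len u")
    case True
    then show ?thesis using equal \<open>u \<in> prefixes x\<close> \<open>v \<in> prefixes x\<close> by (simp add: prefixes_iff)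
  next
    case False
    then have "dig u \<gamma> = 0" "dig v \<gamma> = 0" using equal by auto
    then show ?thesis by simp
  qed
  then show ?thesis by (simp add: gam_eqI)
qed (auto simp: prefixes_iff)

text \<open>At the first difference of two numbers either one sequence has ended, or the signs are
  minus and plus and the common part lies strictly between.\<close>

lemma comparable_or_between:
  assumes "x < y"
  shows "x \<in> prefixes y \<or> y \<in> prefixes x \<or> (\<exists>z. z \<in> prefixes x \<and> z \<in> prefixes y \<and> x < z \<and> z < y)"
proof -
  obtain \<beta> where b: "\<And>\<alpha>. \<alpha> < \<beta> \<Longrightarrow> dig x \<alpha> = dig y \<alpha>" "dig x \<beta> < dig y \<beta>"
    using assms by (auto simp: less_gam_def)
  consider "len x \<le> \<beta>" | "len y \<le> \<beta>" | "\<beta> < len x" "\<beta> < len y"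
    using not_le by blast
  then show ?thesis
  proof cases
    case 1
    then have "dig x \<beta> = 0" by simp
    then have "dig y \<beta> \<noteq> 0" using b(2) by linarith
    then have "\<beta> < len y" by simp
    then have "x \<in> prefixes y" using 1 b by (auto simp: prefixes_iff)
    then show ?thesis ..
  next
    case 2
    then have "dig y \<beta> = 0" by simp
    then have "dig x \<beta> \<noteq> 0" using b(2) by linarith
    then have "\<beta> < len x" by simp
    then have "y \<in> prefixes x" using 2 b by (auto simp: prefixes_iff)
    then show ?thesis by blast
  next
    case 3
    define z where "z = trunc x \<beta>"
    have z: "dig z \<gamma> = (if \<gamma> < \<beta> then dig x \<gamma> else 0)" for \<gamma> by (simp add: z_def)
    have len: "len z = \<beta>" using 3 by (simp add: z_def trunc_def)
    have "dig x \<beta> \<noteq> 0" "dig y \<beta> \<noteq> 0" using 3 by auto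
    then have "dig x \<beta> = - 1" "dig y \<beta> = 1"
      using b(2) dig_bounds[of x \<beta>] dig_bounds[of y \<beta>] by linarith+
    then have "x < z" "z < y"
      unfolding less_gam_def by (auto intro!: exI[of _ \<beta>] simp: z b)
    moreover have "z \<in> prefixes x" "z \<in> prefixes y" using 3 len b by (auto simp: prefixes_iff z)
    ultimately show ?thesis by blast
  qed
qed

definition cut_fillers :: "gam set \<Rightarrow> gam set \<Rightarrow> gam set" where
  "cut_fillers L R = {z. (\<forall>l\<in>L. l < z) \<and> (\<forall>r\<in>R. z < r)}"

text \<open>The order is dense in the strong, countably saturated sense.\<close>

lemma cut_filler_exists:
  assumes cL: "countable L" and cR: "countable R" and LR: "\<And>l r. l \<in> L \<Longrightarrow> r \<in> R \<Longrightarrow> l < r"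
  shows "cut_fillers L R \<noteq> {}"
proof -
  \<comment> \<open>Walk along a branch, with a plus at stage \<beta> iff the sequence so far does not exceed all
    of \<open>L\<close>. Once longer than all members of \<open>L\<close> and \<open>R\<close>, the
    sequence \<open>t\<close> lies in the cut: at its first difference with a member on the wrong
    side it would have turned the other way.\<close>
  define d where "d = wfrec {(a, b). a < b} (\<lambda>d \<beta>. \<exists>l\<in>L. mk_gam \<beta> {\<gamma>. \<gamma> < \<beta> \<and> d \<gamma>} \<le> l)"
  have "wf {(a, b :: omega1). a < b}" by (rule wf)
  then have d0: "d \<beta> \<longleftrightarrow> (\<exists>l\<in>L. mk_gam \<beta> {\<gamma>. \<gamma> < \<beta> \<and> d \<gamma>} \<le> l)" for \<beta>
    unfolding d_def
    by (subst wfrec, assumption) (simp add: cut_def cong: conj_cong)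
  define t where "t \<beta> = mk_gam \<beta> {\<gamma>. d \<gamma>}" for \<beta>
  have mk_t: "mk_gam \<beta> {\<gamma>. \<gamma> < \<beta> \<and> d \<gamma>} = t \<beta>" for \<beta>
    unfolding t_def by (rule gam_eqI) simp
  have d: "d \<beta> \<longleftrightarrow> (\<exists>l\<in>L. t \<beta> \<le> l)" for \<beta>
    using d0[of \<beta>] unfolding mk_t .
  have dig_t: "dig (t \<alpha>) \<gamma> = (if \<gamma> < \<alpha> then if d \<gamma> then 1 else - 1 else 0)" for \<alpha> \<gamma>
    by (simp add: t_def)
  obtain \<alpha> where \<alpha>: "\<And>x. x \<in> L \<union> R \<Longrightarrow> len x < \<alpha>"
    using countable_bounded_omega1[of "len ` (L \<union> R)"] cL cR by auto
  have ne: "dig (t \<alpha>) \<noteq> dig x" if "x \<in> L \<union> R" for x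
  proof
    assume "dig (t \<alpha>) = dig x"
    then have "dig (t \<alpha>) (len x) = 0" by simp
    then show False using \<alpha>[OF that] by (simp add: dig_t split: if_splits)
  qed
  have shorter: "x < t \<alpha> \<or> t \<alpha> < x" if "x \<in> L \<union> R" for x
    using ne[OF that] linorder_less_linear[of x "t \<alpha>"] by auto
  have *: "\<beta> < \<alpha>" if "\<And>\<gamma>. \<gamma> < \<beta> \<Longrightarrow> dig (t \<alpha>) \<gamma> = dig x \<gamma>" "x \<in> L \<union> R" for x \<beta>
  proof (rule ccontr)
    assume "\<not> \<beta> < \<alpha>"
    then have "dig (t \<alpha>) (len x) = 0" using that \<alpha> by fastforce
    then show False using \<alpha>[OF that(2)] by (simp add: dig_t split: if_splits)
  qed
  have notL: "\<not> t \<alpha> < l" if l: "l \<in> L" for l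
  proof
    assume "t \<alpha> < l"
    then obtain \<beta> where b: "\<And>\<gamma>. \<gamma> < \<beta> \<Longrightarrow> dig (t \<alpha>) \<gamma> = dig l \<gamma>" "dig (t \<alpha>) \<beta> < dig l \<beta>"
      by (auto simp: less_gam_def)
    have "\<beta> < \<alpha>" using * b l by blast
    then have nd: "\<not> d \<beta>" and pos: "0 \<le> dig l \<beta>"
      using b(2) dig_bounds[of l \<beta>] by (auto simp: dig_t split: if_splits)
    have below: "dig (t \<beta>) \<gamma> = dig l \<gamma>" if "\<gamma> < \<beta>" for \<gamma>
      using b(1)[OF that] less_trans[OF that \<open>\<beta> < \<alpha>\<close>] that by (simp add: dig_t)
    have "t \<beta> \<le> l"
    proof (cases "dig l \<beta> = 0")
      case True
      then have "dig (t \<beta>) \<gamma> = dig l \<gamma>" for \<gamma>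
        using below[of \<gamma>] by (cases "\<gamma> < \<beta>") (auto simp: dig_t)
      then have "t \<beta> = l" by (rule gam_eqI)
      then show ?thesis by simp
    next
      case False
      then have pos0: "0 < dig l \<beta>" using pos by linarith
      have "t \<beta> < l"
        unfolding less_gam_def using below
        by (intro exI[of _ \<beta>]) (auto simp: dig_t[of \<beta> \<beta>] pos0)
      then show ?thesis by simp
    qed
    then show False using nd d l by blast
  qed
  have notR: "\<not> r < t \<alpha>" if r: "r \<in> R" for r
  proof
    assume "r < t \<alpha>"
    then obtain \<beta> where "\<forall>\<gamma><\<beta>. dig r \<gamma> = dig (t \<alpha>) \<gamma>" and "dig r \<beta> < dig (t \<alpha>) \<beta>"
      by (auto simp: less_gam_def)
    then have b: "\<And>\<gamma>. \<gamma> < \<beta> \<Longrightarrow> dig (t \<alpha>) \<gamma> = dig r \<gamma>" "dig r \<beta> < dig (t \<alpha>) \<beta>"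
      by auto
    have "\<beta> < \<alpha>" using * b r by blast
    then have nd: "d \<beta>" and neg: "dig r \<beta> \<le> 0"
      using b(2) dig_bounds[of r \<beta>] by (auto simp: dig_t split: if_splits)
    have below: "dig (t \<beta>) \<gamma> = dig r \<gamma>" if "\<gamma> < \<beta>" for \<gamma>
      using b(1)[OF that] less_trans[OF that \<open>\<beta> < \<alpha>\<close>] that by (simp add: dig_t)
    have "r \<le> t \<beta>"
    proof (cases "dig r \<beta> = 0")
      case True
      then have "dig (t \<beta>) \<gamma> = dig r \<gamma>" for \<gamma>
        using below[of \<gamma>] by (cases "\<gamma> < \<beta>") (auto simp: dig_t)
      then have "t \<beta> = r" by (rule gam_eqI)
      then show ?thesis by simp
    next
      case False
      then have neg0: "dig r \<beta> < 0" using neg by linarith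
      have "r < t \<beta>"
        unfolding less_gam_def using below
        by (intro exI[of _ \<beta>]) (auto simp: dig_t[of \<beta> \<beta>] neg0)
      then show ?thesis by simp
    qed
    then show False using nd d r LR by (meson leD order_trans)
  qed
  have "t \<alpha> \<in> cut_fillers L R"
    using shorter notL notR by (auto simp: cut_fillers_def)
  then show ?thesis by blast
qed

definition simplest :: "gam set \<Rightarrow> gam set \<Rightarrow> gam" where
  "simplest L R = (ARG_MIN len z. z \<in> cut_fillers L R)"

text \<open>If a filler \<open>z\<close> did not extend the shortest filler, then by
  \<open>comparable_or_between\<close> something shorter would lie between them, hence in the
  cut.\<close>

lemma simplest:
  assumes "countable L" "countable R" "\<And>l r. l \<in> L \<Longrightarrow> r \<in> R \<Longrightarrow> l < r"
  shows simplest_fills: "simplest L R \<in> cut_fillers L R"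
    and simplest_is_prefix: "z \<in> cut_fillers L R \<Longrightarrow> z = simplest L R \<or> simplest L R \<in> prefixes z"
proof -
  let ?s = "simplest L R"
  obtain z0 where "z0 \<in> cut_fillers L R" using cut_filler_exists[OF assms] by blast
  then have "\<exists>\<alpha>. \<exists>z\<in>cut_fillers L R. len z = \<alpha>" by blast
  then have "\<exists>z\<in>cut_fillers L R. len z = (LEAST \<alpha>. \<exists>z\<in>cut_fillers L R. len z = \<alpha>)"
    by (rule LeastI_ex)
  then obtain x where x: "x \<in> cut_fillers L R" "\<And>z. z \<in> cut_fillers L R \<Longrightarrow> len x \<le> len z"
    by (metis (mono_tags, lifting) Least_le)
  have s: "?s \<in> cut_fillers L R \<and> (\<forall>z. z \<in> cut_fillers L R \<longrightarrow> \<not> len z < len ?s)"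
    unfolding simplest_def arg_min_def
    by (rule someI2[where a = x]) (use x in \<open>auto simp: is_arg_min_def not_less\<close>)
  then show "?s \<in> cut_fillers L R" ..
  show "z = ?s \<or> ?s \<in> prefixes z" if z: "z \<in> cut_fillers L R"
  proof (rule ccontr)
    assume no: "\<not> ?thesis"
    have "z \<notin> prefixes ?s" using z s prefixes_len by blast
    then obtain w where w: "w \<in> prefixes ?s" "z < w \<and> w < ?s \<or> ?s < w \<and> w < z"
      using no comparable_or_between[of z ?s] comparable_or_between[of ?s z]
      by (metis linorder_less_linear)
    have "w \<in> cut_fillers L R"
      using w(2) z s unfolding cut_fillers_def by (blast intro: less_trans)
    then show False using w(1) s prefixes_len by blast
  qed
qed

text \<open>A filler on another branch would be separated from \<open>x\<close> by one of the
  prefixes of \<open>x\<close>.\<close>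

lemma fills_own_cut:
  assumes "z \<in> cut_fillers {u \<in> prefixes x. u < x} {u \<in> prefixes x. x < u}"
  shows "z = x \<or> x \<in> prefixes z"
proof (rule ccontr)
  assume no: "\<not> ?thesis"
  have fills: "\<And>u. u \<in> prefixes x \<Longrightarrow> u < x \<Longrightarrow> u < z" "\<And>u. u \<in> prefixes x \<Longrightarrow> x < u \<Longrightarrow> z < u"
    using assms by (auto simp: cut_fillers_def)
  from no consider "z < x" | "x < z" by fastforce
  then show False
  proof cases
    case 1
    then show False
      using comparable_or_between[OF 1] fills no by (meson order_less_asym)
  next
    case 2
    then show False
      using comparable_or_between[OF 2] fills no by (meson order_less_asym)
  qed
qed

text \<open>The extension \<open>g\<close> sends \<open>x\<close> to the simplest number above the
  images of the smaller prefixes of \<open>x\<close> and of the smaller points of \<open>h\<close>,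
  and below the images of the larger ones. Since only countably many conditions occur, the cut can
  always be filled.\<close>

theorem gam_homogeneous:
  fixes h :: "(gam \<times> gam) set"
  assumes cnt: "countable h"
    and h: "\<And>x y x' y'. (x, y) \<in> h \<Longrightarrow> (x', y') \<in> h \<Longrightarrow> x < x' \<longleftrightarrow> y < y'"
  shows "\<exists>\<sigma>. bij \<sigma> \<and> (\<forall>x y. x < y \<longleftrightarrow> \<sigma> x < \<sigma> y) \<and> (\<forall>(x, y)\<in>h. \<sigma> x = y)"
proof -
  define L where "L g x = g ` {z \<in> prefixes x. z < x} \<union> {b. \<exists>a. (a, b) \<in> h \<and> a < x}"
    for g :: "gam \<Rightarrow> gam" and x
  define R where "R g x = g ` {z \<in> prefixes x. x < z} \<union> {b. \<exists>a. (a, b) \<in> h \<and> x < a}"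
    for g :: "gam \<Rightarrow> gam" and x
  define F where "F g x = (if x \<in> Domain h then THE y. (x, y) \<in> h else simplest (L g x) (R g x))"
    for g x
  define r where "r = {(z, x). z \<in> prefixes x}"
  have "wf r"
    by (rule wf_subset[OF wf_inv_image[OF wf, of len]]) (auto simp: r_def inv_image_def prefixes_len)
  define g where "g = wfrec r F"
  have "F (cut g r x) x = F g x" for x
  proof -
    have "L (cut g r x) x = L g x" "R (cut g r x) x = R g x"
      unfolding L_def R_def by (auto simp: cut_def r_def image_iff)
    then show ?thesis by (simp add: F_def)
  qed
  then have gF: "g x = F g x" for x
    unfolding g_def by (subst wfrec[OF \<open>wf r\<close>]) simp
  have h_eq: "y = y'" if "(x, y) \<in> h" "(x, y') \<in> h" for x y y'
    using h[OF that] h[OF that(2,1)] by simp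
  have gh: "g x = y" if "(x, y) \<in> h" for x y
    unfolding gF[of x] F_def using that h_eq by (auto intro!: the_equality)
  have gx: "g x = simplest (L g x) (R g x)" if "x \<notin> Domain h" for x
    unfolding gF[of x] F_def using that by simp
  have "countable (Domain h)" "countable (Range h)"
    using cnt countable_image[OF cnt, of fst] countable_image[OF cnt, of snd]
    by (simp_all add: Domain_fst Range_snd)
  moreover have "{b. \<exists>a. (a, b) \<in> h \<and> a < x} \<subseteq> Range h" "{b. \<exists>a. (a, b) \<in> h \<and> x < a} \<subseteq> Range h" for x
    by auto
  moreover have "countable {z \<in> prefixes x. z < x}" "countable {z \<in> prefixes x. x < z}" for x
    by (rule countable_subset[OF _ countable_prefixes[of x]], blast)+
  ultimately have cLR: "countable (L g x)" "countable (R g x)" for x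
    unfolding L_def R_def by (auto intro: countable_subset)

  define P where "P x \<longleftrightarrow>
      (\<forall>u\<in>prefixes x. (u < x \<longrightarrow> g u < g x) \<and> (x < u \<longrightarrow> g x < g u)) \<and>
      (\<forall>(a, b)\<in>h. (a < x \<longrightarrow> b < g x) \<and> (x < a \<longrightarrow> g x < b))" for x
  have PD: "\<And>u. u \<in> prefixes x \<Longrightarrow> u < x \<Longrightarrow> g u < g x" "\<And>u. u \<in> prefixes x \<Longrightarrow> x < u \<Longrightarrow> g x < g u"
    "\<And>a b. (a, b) \<in> h \<Longrightarrow> a < x \<Longrightarrow> b < g x" "\<And>a b. (a, b) \<in> h \<Longrightarrow> x < a \<Longrightarrow> g x < b"
    if "P x" for x
    using that unfolding P_def by blast+
  \<comment> \<open>The two sides of the cut are separated: prefixes of \<open>x\<close> are pairwise comparable by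
    simplicity, so the induction hypothesis relates their images.\<close>
  have LR: "l < r" if IH: "\<And>u. u \<in> prefixes x \<Longrightarrow> P u" and lr: "l \<in> L g x" "r \<in> R g x" for x l r
  proof -
    have 1: "g u < g v" if "u \<in> prefixes x" "v \<in> prefixes x" "u < v" for u v
      using prefixes_chain[OF that(1,2)] PD[OF IH] that by blast
    have 2: "b < g v" if "v \<in> prefixes x" "(a, b) \<in> h" "a < v" for a b v
      using PD(3)[OF IH] that by blast
    have 3: "g v < b" if "v \<in> prefixes x" "(a, b) \<in> h" "v < a" for a b v
      using PD(4)[OF IH] that by blast
    from lr consider
        (pp) u v where "l = g u" "r = g v" "u \<in> prefixes x" "v \<in> prefixes x" "u < x" "x < v"
      | (hp) a v where "(a, l) \<in> h" "r = g v" "a < x" "v \<in> prefixes x" "x < v"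
      | (ph) u a where "l = g u" "(a, r) \<in> h" "u \<in> prefixes x" "u < x" "x < a"
      | (hh) a a' where "(a, l) \<in> h" "(a', r) \<in> h" "a < x" "x < a'"
      unfolding L_def R_def by blast
    then show ?thesis
    proof cases
      case pp then show ?thesis using 1[of u v] by (simp add: less_trans[of u x v])
    next
      case hp then show ?thesis using 2[of v a l] by (simp add: less_trans[of a x v])
    next
      case ph then show ?thesis using 3[of u a r] by (simp add: less_trans[of u x a])
    next
      case hh then show ?thesis using h[of a l a' r] by (simp add: less_trans[of a x a'])
    qed
  qed
  have P: "P x" for x
  proof (induction x rule: wf_induct_rule[OF \<open>wf r\<close>])
    case (1 x)
    then have IH: "P u" if "u \<in> prefixes x" for u using that by (simp add: r_def)
    show ?case
    proof (cases "x \<in> Domain h")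
      case True
      then obtain y where y: "(x, y) \<in> h" by blast
      show ?thesis
        unfolding P_def gh[OF y] using PD(3,4)[OF IH] y h by blast
    next
      case False
      have "g x \<in> cut_fillers (L g x) (R g x)"
        unfolding gx[OF False] using LR[OF IH] by (intro simplest_fills cLR) blast+
      then show ?thesis
        unfolding P_def cut_fillers_def L_def R_def by auto
    qed
  qed
  have mono: "g x < g y" if "x < y" for x y
    using comparable_or_between[OF that] PD[OF P] that by (blast intro: less_trans)
  have strict: "x < y \<longleftrightarrow> g x < g y" for x y
    by (metis mono linorder_less_linear order_less_asym order_less_irrefl)
  have inj: "inj g"
    by (rule injI) (metis strict linorder_less_linear order_less_irrefl)
  have surj: "y \<in> range g" for y
  proof (induction y rule: wf_induct_rule[OF \<open>wf r\<close>])
    case (1 y)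
    then have IH: "u \<in> range g" if "u \<in> prefixes y" for u using that by (simp add: r_def)
    show ?case
    proof (rule ccontr)
      assume y: "y \<notin> range g"
      \<comment> \<open>For a shortest \<open>y\<close> outside the range, pull its cut back to \<open>x\<close>. Then
        \<open>y\<close> is a proper prefix of \<open>g x\<close>, so it misses the cut defining
        \<open>g x\<close>; the condition it violates comes from a prefix of \<open>x\<close> that
        fills the pulled-back cut, against the simplicity of \<open>x\<close>.\<close>
      define S where "S = g -` prefixes y \<union> Domain h"
      define L0 where "L0 = {u \<in> S. g u < y}"
      define R0 where "R0 = {u \<in> S. y < g u}"
      have "g ` (g -` prefixes y) \<subseteq> prefixes y" by blast
      then have "countable (g -` prefixes y)"
        using countable_prefixes countable_subset countable_image_inj_on inj inj_on_subset subset_UNIV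
        by metis
      then have "countable S" unfolding S_def using \<open>countable (Domain h)\<close> by simp
      then have c0: "countable L0" "countable R0" by (auto simp: L0_def R0_def)
      have lr0: "l < r" if "l \<in> L0" "r \<in> R0" for l r
        using that strict[of l r] unfolding L0_def R0_def by (auto intro: less_trans)
      define x where "x = simplest L0 R0"
      have x: "x \<in> cut_fillers L0 R0"
        unfolding x_def by (rule simplest_fills[OF c0 lr0])
      have gu: "g u < y \<or> y < g u" for u
        using y by (metis linorder_less_linear rangeI)
      have xD: "x \<notin> Domain h"
      proof
        assume "x \<in> Domain h"
        then have "x \<in> L0 \<union> R0" using gu[of x] by (auto simp: L0_def R0_def S_def)
        then show False using x by (auto simp: cut_fillers_def)
      qed
      have "g x \<in> cut_fillers {u \<in> prefixes y. u < y} {u \<in> prefixes y. y < u}"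
      proof -
        have "w < g x" if w: "w \<in> prefixes y" "w < y" for w
        proof -
          obtain u where u: "w = g u" using IH[OF w(1)] by blast
          then have "u \<in> L0" using w by (auto simp: L0_def S_def)
          then show ?thesis using x u strict by (auto simp: cut_fillers_def)
        qed
        moreover have "g x < w" if w: "w \<in> prefixes y" "y < w" for w
        proof -
          obtain u where u: "w = g u" using IH[OF w(1)] by blast
          then have "u \<in> R0" using w by (auto simp: R0_def S_def)
          then show ?thesis using x u strict by (auto simp: cut_fillers_def)
        qed
        ultimately show ?thesis by (auto simp: cut_fillers_def)
      qed
      then have ypre: "y \<in> prefixes (g x)" using fills_own_cut y by blast
      have notin: "\<not> z \<in> prefixes x" if "z \<in> cut_fillers L0 R0" for z
      proof -
        have "z = x \<or> x \<in> prefixes z"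
          unfolding x_def by (rule simplest_is_prefix[OF c0]) (use lr0 that in auto)
        then show ?thesis using prefixes_len[of z x] prefixes_len[of x z] by auto
      qed
      have yf: "y \<in> cut_fillers (L g x) (R g x)"
      proof -
        have "l < y" if "l \<in> L g x" for l
        proof (rule ccontr)
          assume ly: "\<not> l < y"
          from that consider z where "l = g z" "z \<in> prefixes x" "z < x" | a where "(a, l) \<in> h" "a < x"
            unfolding L_def by blast
          then show False
          proof cases
            case 1
            then have "y < g z" using ly gu[of z] by simp
            then have "u < z" if "u \<in> L0" for u
              using that strict[of u z] unfolding L0_def by (auto intro: less_trans)
            moreover have "z < v" if "v \<in> R0" for v
              using x that 1(3) unfolding cut_fillers_def by (auto intro: less_trans)
            ultimately have "z \<in> cut_fillers L0 R0" by (simp add: cut_fillers_def)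
            then show False using notin 1 by blast
          next
            case 2
            then have "a \<in> R0" using ly gu[of a] gh[of a l] by (auto simp: R0_def S_def)
            then show False using x 2 by (auto simp: cut_fillers_def)
          qed
        qed
        moreover have "y < l" if "l \<in> R g x" for l
        proof (rule ccontr)
          assume ly: "\<not> y < l"
          from that consider z where "l = g z" "z \<in> prefixes x" "x < z" | a where "(a, l) \<in> h" "x < a"
            unfolding R_def by blast
          then show False
          proof cases
            case 1
            then have "g z < y" using ly gu[of z] by simp
            then have "z < u" if "u \<in> R0" for u
              using that strict[of z u] unfolding R0_def by (auto intro: less_trans)
            moreover have "v < z" if "v \<in> L0" for v
              using x that 1(3) unfolding cut_fillers_def by (auto intro: less_trans)
            ultimately have "z \<in> cut_fillers L0 R0" by (simp add: cut_fillers_def)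
            then show False using notin 1 by blast
          next
            case 2
            then have "a \<in> L0" using ly gu[of a] gh[of a l] by (auto simp: L0_def S_def)
            then show False using x 2 by (auto simp: cut_fillers_def)
          qed
        qed
        ultimately show ?thesis by (auto simp: cut_fillers_def)
      qed
      have "l < r" if "l \<in> L g x" "r \<in> R g x" for l r
        using LR[OF P that] by simp
      then have "y = g x \<or> g x \<in> prefixes y"
        unfolding gx[OF xD] using simplest_is_prefix[OF cLR _ yf] by blast
      then show False using ypre y prefixes_len[of "g x" y] prefixes_len[of y "g x"] by auto
    qed
  qed
  show ?thesis
    using inj surj strict gh by (intro exI[of _ g]) (auto simp: bij_def)
qed

text \<open>Countable saturation for many variables at once: a linear preorder on countably many
  keys, some of them already interpreted by levels, is realized by levels.\<close>

lemma gam_realizes_order: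
  fixes t :: "'k \<Rightarrow> 'k \<Rightarrow> bool" and e :: "'k \<Rightarrow> gam"
  assumes refl: "\<And>k. t k k" and trans: "\<And>k l m. t k l \<Longrightarrow> t l m \<Longrightarrow> t k m"
    and total: "\<And>k l. t k l \<or> t l k"
    and C: "countable C" "\<And>k l. k \<in> C \<Longrightarrow> l \<in> C \<Longrightarrow> e k \<le> e l \<longleftrightarrow> t k l"
    and D: "countable D" "C \<subseteq> D"
  shows "\<exists>e'. (\<forall>k\<in>C. e' k = e k) \<and> (\<forall>k\<in>D. \<forall>l\<in>D. e' k \<le> e' l \<longleftrightarrow> t k l)"
proof -
  define Q :: "'k \<times> gam \<Rightarrow> 'k \<times> gam \<Rightarrow> bool" where "Q p q \<longleftrightarrow> (snd p \<le> snd q \<longleftrightarrow> t (fst p) (fst q))" for p q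
  define h where "h = (\<lambda>k. (k, e k)) ` C"
  have "\<exists>h'. h \<subseteq> h' \<and> countable h' \<and> (\<forall>p\<in>h'. \<forall>q\<in>h'. Q p q) \<and> D \<subseteq> Domain h'"
  proof (rule pairwise_extension[where X = UNIV])
    fix H :: "('k \<times> gam) set" and k :: 'k
    assume cH: "countable H" and Hp: "\<forall>p\<in>H. \<forall>q\<in>H. Q p q"
    then have H: "x \<le> y \<longleftrightarrow> t l m" if "(l, x) \<in> H" "(m, y) \<in> H" for l m x y
      using that by (force simp: Q_def)
    show "\<exists>y. \<forall>p\<in>insert (k, y) H. \<forall>q\<in>insert (k, y) H. Q p q"
    proof (cases "\<exists>l x. (l, x) \<in> H \<and> t k l \<and> t l k")
      case True
      then obtain l x where l: "(l, x) \<in> H" "t k l" "t l k" by blast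
      have "x \<le> z \<longleftrightarrow> t k m" "z \<le> x \<longleftrightarrow> t m k" if "(m, z) \<in> H" for m z
        using H[OF l(1) that] H[OF that l(1)] l trans by blast+
      then show ?thesis
        using Hp refl by (intro exI[of _ x]) (auto simp: Q_def)
    next
      case False
      define L where "L = {x. \<exists>l. (l, x) \<in> H \<and> t l k}"
      define R where "R = {x. \<exists>l. (l, x) \<in> H \<and> t k l}"
      have "L \<subseteq> snd ` H" "R \<subseteq> snd ` H" unfolding L_def R_def by force+
      then have cLR: "countable L" "countable R"
        using countable_subset[OF _ countable_image[OF cH, of snd]] by simp_all
      have "l < r" if "l \<in> L" "r \<in> R" for l r
      proof -
        obtain m n where mn: "(m, l) \<in> H" "t m k" "(n, r) \<in> H" "t k n"
          using \<open>l \<in> L\<close> \<open>r \<in> R\<close> unfolding L_def R_def by blast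
        have "\<not> t n m" using mn False trans by blast
        then show ?thesis using H[OF mn(3,1)] by simp
      qed
      then obtain y where y: "y \<in> cut_fillers L R"
        using cut_filler_exists[OF cLR] by blast
      have "y \<le> x \<longleftrightarrow> t k l" "x \<le> y \<longleftrightarrow> t l k" if "(l, x) \<in> H" for l x
      proof -
        have "t l k \<Longrightarrow> x < y" "t k l \<Longrightarrow> y < x"
          using y that by (auto simp: cut_fillers_def L_def R_def)
        then show "y \<le> x \<longleftrightarrow> t k l" "x \<le> y \<longleftrightarrow> t l k" using total[of k l] by auto
      qed
      then show ?thesis
        using Hp refl by (intro exI[of _ y]) (auto simp: Q_def)
    qed
  qed (use C D in \<open>auto simp: h_def Q_def\<close>)
  then obtain h' where h': "h \<subseteq> h'" "\<forall>p\<in>h'. \<forall>q\<in>h'. Q p q" "D \<subseteq> Domain h'" by blast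
  define e' where "e' k = (if k \<in> C then e k else SOME x. (k, x) \<in> h')" for k
  have e': "(k, e' k) \<in> h'" if "k \<in> D" for k
  proof (cases "k \<in> C")
    case True
    then show ?thesis using h'(1) by (auto simp: e'_def h_def)
  next
    case False
    have "\<exists>x. (k, x) \<in> h'" using that h'(3) by blast
    then have "(k, SOME x. (k, x) \<in> h') \<in> h'" by (rule someI_ex)
    then show ?thesis using False by (simp add: e'_def)
  qed
  show ?thesis
  proof (intro exI[of _ e'] conjI ballI)
    show "e' k \<le> e' l \<longleftrightarrow> t k l" if "k \<in> D" "l \<in> D" for k l
      using h'(2) e'[OF that(1)] e'[OF that(2)] by (force simp: Q_def)
  qed (simp add: e'_def)
qed

section \<open>A homogeneous graph with the countable extension property\<close>

text \<open>A vertex carries the countable set of those neighbours that precede it in the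
  well-founded construction; the index provides uncountably many vertices with the same set.\<close>

datatype vtx = Vtx (nb: "vtx cset") (ix: "nat set")

abbreviation nbs :: "vtx \<Rightarrow> vtx set" where "nbs v \<equiv> rcset (nb v)"

definition adj :: "vtx \<Rightarrow> vtx \<Rightarrow> bool" where
  "adj u v \<longleftrightarrow> u \<in> nbs v \<or> v \<in> nbs u"

lemma not_in_nbs: "v \<notin> nbs v"
proof (induction v)
  case (Vtx C i)
  then show ?case by (metis vtx.sel(1))
qed

lemma adj_sym: "adj u v \<longleftrightarrow> adj v u"
  by (auto simp: adj_def)

lemma adj_irrefl [simp]: "\<not> adj v v"
  by (simp add: adj_def not_in_nbs)

text \<open>Take a vertex whose set of earlier neighbours is \<open>C\<close>. Among the uncountably
  many indices one avoids both \<open>K\<close> and the countable neighbour sets of members of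
  \<open>D\<close>.\<close>

lemma adj_extension:
  assumes C: "countable C" and D: "countable D" "C \<inter> D = {}" and K: "countable K"
  shows "\<exists>v. v \<notin> K \<and> (\<forall>c\<in>C. adj v c) \<and> (\<forall>d\<in>D. \<not> adj v d)"
proof -
  define B where "B = K \<union> (\<Union>d\<in>D. nbs d)"
  have "countable B" using D K by (auto simp: B_def)
  have "inj (Vtx (acset C))" by (auto intro: injI)
  then have "uncountable (range (Vtx (acset C)))"
    using uncountable_nat_sets countable_image_inj_on by blast
  then have "\<not> range (Vtx (acset C)) \<subseteq> B"
    using \<open>countable B\<close> countable_subset by blast
  then obtain v where "v \<in> range (Vtx (acset C))" "v \<notin> B" by blast
  then have "nbs v = C" "v \<notin> B" using C by auto
  then show ?thesis
    using D by (intro exI[of _ v]) (auto simp: adj_def B_def)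
qed

lemma countable_converse:
  assumes "countable h"
  shows "countable (h\<inverse>)"
proof -
  have "h\<inverse> = prod.swap ` h" by force
  then show ?thesis using assms by simp
qed

definition graph_iso :: "(vtx \<times> vtx) set \<Rightarrow> bool" where
  "graph_iso h \<longleftrightarrow> (\<forall>p\<in>h. \<forall>q\<in>h.
     (fst p = fst q \<longleftrightarrow> snd p = snd q) \<and> (adj (fst p) (fst q) \<longleftrightarrow> adj (snd p) (snd q)))"

lemma graph_isoD:
  assumes "graph_iso h" "(x, x') \<in> h" "(y, y') \<in> h"
  shows "x = y \<longleftrightarrow> x' = y'" "adj x y \<longleftrightarrow> adj x' y'"
  using assms unfolding graph_iso_def by fastforce+

lemma graph_iso_converse: "graph_iso (h\<inverse>) \<longleftrightarrow> graph_iso h"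
proof -
  have "graph_iso (h\<inverse>)" if h: "graph_iso h" for h
    unfolding graph_iso_def
  proof (intro ballI)
    fix p q assume "p \<in> h\<inverse>" "q \<in> h\<inverse>"
    then have "(snd p, fst p) \<in> h" "(snd q, fst q) \<in> h" by auto
    then show "(fst p = fst q \<longleftrightarrow> snd p = snd q) \<and> (adj (fst p) (fst q) \<longleftrightarrow> adj (snd p) (snd q))"
      using graph_isoD[OF h] by blast
  qed
  from this[of h] this[of "h\<inverse>"] show ?thesis by auto
qed

lemma graph_iso_extend_dom:
  assumes h: "graph_iso h" "countable h" and D: "countable D"
  shows "\<exists>h'. h \<subseteq> h' \<and> countable h' \<and> graph_iso h' \<and> D \<subseteq> Domain h'"
  unfolding graph_iso_def
proof (rule pairwise_extension[where X = UNIV])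
  fix H :: "(vtx \<times> vtx) set" and x
  assume cH: "countable H"
    and "\<forall>p\<in>H. \<forall>q\<in>H. (fst p = fst q \<longleftrightarrow> snd p = snd q) \<and> (adj (fst p) (fst q) \<longleftrightarrow> adj (snd p) (snd q))"
  then have H: "graph_iso H" by (simp add: graph_iso_def)
  have "\<exists>y. graph_iso (insert (x, y) H)"
  proof (cases "x \<in> Domain H")
    case True
    then obtain y where "(x, y) \<in> H" by blast
    then have "insert (x, y) H = H" by blast
    then show ?thesis using H by metis
  next
    case False
    define C where "C = {b. \<exists>a. (a, b) \<in> H \<and> adj x a}"
    define D where "D = {b. \<exists>a. (a, b) \<in> H \<and> \<not> adj x a}"
    have "C \<subseteq> snd ` H" "D \<subseteq> snd ` H" unfolding C_def D_def by force+
    then have "countable C" "countable D"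
      using countable_subset[OF _ countable_image[OF cH, of snd]] by simp_all
    moreover have "C \<inter> D = {}"
      unfolding C_def D_def using graph_isoD(1)[OF H] by blast
    ultimately obtain y where y: "y \<notin> snd ` H" "\<And>c. c \<in> C \<Longrightarrow> adj y c" "\<And>d. d \<in> D \<Longrightarrow> \<not> adj y d"
      using adj_extension[of C D "snd ` H"] cH by blast
    have "(x, b) \<notin> H" "(a, y) \<notin> H" for a b
      using y(1) False by force+
    moreover have "adj x a \<longleftrightarrow> adj y b" "adj a x \<longleftrightarrow> adj b y" if "(a, b) \<in> H" for a b
      using y(2,3) that adj_sym unfolding C_def D_def by blast+
    ultimately have "graph_iso (insert (x, y) H)"
      using H unfolding graph_iso_def by auto
    then show ?thesis ..
  qed
  then show "\<exists>y. \<forall>p\<in>insert (x, y) H. \<forall>q\<in>insert (x, y) H.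
      (fst p = fst q \<longleftrightarrow> snd p = snd q) \<and> (adj (fst p) (fst q) \<longleftrightarrow> adj (snd p) (snd q))"
    unfolding graph_iso_def .
qed (use assms in \<open>auto simp: graph_iso_def\<close>)

text \<open>Closing domain and range alternately under neighbour sets, in countably many rounds. On
  closed sets the recursive structure of the remaining vertices is the same on both sides.\<close>

lemma graph_iso_extend_closed:
  assumes h: "graph_iso h" "countable h"
  shows "\<exists>h'. h \<subseteq> h' \<and> countable h' \<and> graph_iso h' \<and>
     (\<forall>x\<in>Domain h'. nbs x \<subseteq> Domain h') \<and> (\<forall>y\<in>Range h'. nbs y \<subseteq> Range h')"
proof -
  define good where "good h \<longleftrightarrow> countable h \<and> graph_iso h" for h
  have step: "\<exists>h'. good h' \<and> h \<subseteq> h' \<and> \<Union> (nbs ` Domain h) \<subseteq> Domain h' \<and>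
      \<Union> (nbs ` Range h) \<subseteq> Range h'" if "good h" for h
  proof -
    have cD: "countable (Domain h)" "countable (Range h)"
      using that countable_image[of h fst] countable_image[of h snd]
      by (simp_all add: Domain_fst Range_snd good_def)
    then obtain h1 where h1: "h \<subseteq> h1" "countable h1" "graph_iso h1" "\<Union> (nbs ` Domain h) \<subseteq> Domain h1"
      using graph_iso_extend_dom[of h "\<Union> (nbs ` Domain h)"] \<open>good h\<close> by (auto simp: good_def)
    have "countable (h1\<inverse>)" using h1(2) by (rule countable_converse)
    then obtain h2 where h2: "h1\<inverse> \<subseteq> h2" "countable h2" "graph_iso h2" "\<Union> (nbs ` Range h) \<subseteq> Domain h2"
      using graph_iso_extend_dom[of "h1\<inverse>" "\<Union> (nbs ` Range h)"] h1(3) cD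
      by (auto simp: graph_iso_converse)
    have "countable (h2\<inverse>)" using h2(2) by (rule countable_converse)
    then have "good (h2\<inverse>)" using h2 by (simp add: good_def graph_iso_converse)
    moreover have "h1 \<subseteq> h2\<inverse>" using h2 by auto
    moreover have "h \<subseteq> h2\<inverse>" "\<Union> (nbs ` Domain h) \<subseteq> Domain (h2\<inverse>)"
      using h1 \<open>h1 \<subseteq> h2\<inverse>\<close> by blast+
    moreover have "\<Union> (nbs ` Range h) \<subseteq> Range (h2\<inverse>)" using h2(4) by simp
    ultimately show ?thesis by blast
  qed
  obtain H where H0: "H 0 = h" and H: "\<And>n. good (H n)"
    and HS: "\<And>n. H n \<subseteq> H (Suc n) \<and> \<Union> (nbs ` Domain (H n)) \<subseteq> Domain (H (Suc n)) \<and>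
      \<Union> (nbs ` Range (H n)) \<subseteq> Range (H (Suc n))"
    using dependent_nat_choice[of "\<lambda>n h'. good h' \<and> (n = 0 \<longrightarrow> h' = h)"
        "\<lambda>_ h h'. h \<subseteq> h' \<and> \<Union> (nbs ` Domain h) \<subseteq> Domain h' \<and> \<Union> (nbs ` Range h) \<subseteq> Range h'"]
      step h by (auto simp: good_def) metis
  have mono: "mono H" using HS by (simp add: mono_iff_le_Suc)
  define U where "U = (\<Union>n. H n)"
  have "graph_iso U"
    unfolding graph_iso_def U_def
  proof (intro ballI)
    fix p q assume "p \<in> (\<Union>n. H n)" "q \<in> (\<Union>n. H n)"
    then obtain m n where "p \<in> H m" "q \<in> H n" by blast
    then have "p \<in> H (max m n)" "q \<in> H (max m n)"
      using monoD[OF mono, of m "max m n"] monoD[OF mono, of n "max m n"] by auto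
    then show "(fst p = fst q \<longleftrightarrow> snd p = snd q) \<and> (adj (fst p) (fst q) \<longleftrightarrow> adj (snd p) (snd q))"
      using H[of "max m n"] unfolding good_def graph_iso_def by blast
  qed
  moreover have "nbs x \<subseteq> Domain U" if mem: "x \<in> Domain U" for x
  proof -
    obtain n where "x \<in> Domain (H n)" using mem by (auto simp: U_def)
    then have "nbs x \<subseteq> \<Union> (nbs ` Domain (H n))" by blast
    also have "\<dots> \<subseteq> Domain (H (Suc n))" using HS by blast
    also have "\<dots> \<subseteq> Domain U" by (auto simp: U_def)
    finally show ?thesis .
  qed
  moreover have "nbs y \<subseteq> Range U" if mem: "y \<in> Range U" for y
  proof -
    obtain n where "y \<in> Range (H n)" using mem by (auto simp: U_def)
    then have "nbs y \<subseteq> \<Union> (nbs ` Range (H n))" by blast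
    also have "\<dots> \<subseteq> Range (H (Suc n))" using HS by blast
    also have "\<dots> \<subseteq> Range U" by (auto simp: U_def)
    finally show ?thesis .
  qed
  moreover have "countable U" "h \<subseteq> U"
    using H H0 by (auto simp: good_def U_def)
  ultimately show ?thesis by blast
qed

text \<open>The recursive extension of a partial map \<open>k\<close>: neighbour sets are mapped
  along, and \<open>\<beta>\<close> adjusts the index so that vertices outside the domain of
  \<open>k\<close> avoid its range.\<close>

primrec vmap :: "(vtx \<Rightarrow> vtx option) \<Rightarrow> (vtx cset \<Rightarrow> vtx cset \<Rightarrow> nat set \<Rightarrow> nat set) \<Rightarrow> vtx \<Rightarrow> vtx"
  where
  "vmap k \<beta> (Vtx C i) =
    (case k (Vtx C i) of Some y \<Rightarrow> y
     | None \<Rightarrow> Vtx (cimage (vmap k \<beta>) C) (\<beta> C (cimage (vmap k \<beta>) C) i))"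

lemma vmap_eq:
  "vmap k \<beta> v = (case k v of Some y \<Rightarrow> y
     | None \<Rightarrow> Vtx (cimage (vmap k \<beta>) (nb v)) (\<beta> (nb v) (cimage (vmap k \<beta>) (nb v)) (ix v)))"
  by (cases v) (simp only: vmap.simps vtx.sel)

lemma vmap_inverse:
  assumes k: "\<And>x y. k x = Some y \<Longrightarrow> k' y = Some x"
    and \<beta>: "\<And>C C' i. k (Vtx C i) = None \<Longrightarrow> k' (Vtx C' (\<beta> C C' i)) = None \<and> \<beta>' C' C (\<beta> C C' i) = i"
  shows "vmap k' \<beta>' (vmap k \<beta> v) = v"
proof (induction v)
  case (Vtx C i)
  show ?case
  proof (cases "k (Vtx C i)")
    case (Some y)
    then show ?thesis using k[OF Some] vmap_eq[of k' \<beta>' y] by simp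
  next
    case None
    let ?C' = "cimage (vmap k \<beta>) C"
    have "cimage (vmap k' \<beta>') ?C' = cimage id C"
      unfolding cset.map_comp using Vtx by (intro cset.map_cong0) simp
    then show ?thesis using None \<beta>[OF None, of ?C'] by (simp add: cset.map_id)
  qed
qed

text \<open>Over a closed isomorphism, for each neighbour set only countably many indices are taken
  by the domain, and likewise for the range. The free indices are matched by bijections
  \<open>\<beta>\<close>; their inverses give the inverse map.\<close>

theorem graph_homogeneous:
  assumes h0: "graph_iso h0" "countable h0"
  shows "\<exists>\<pi>. bij \<pi> \<and> (\<forall>x y. adj x y \<longleftrightarrow> adj (\<pi> x) (\<pi> y)) \<and> (\<forall>(x, y)\<in>h0. \<pi> x = y)"
proof -
  obtain h where h: "h0 \<subseteq> h" "countable h" "graph_iso h"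
    and closed: "\<And>x. x \<in> Domain h \<Longrightarrow> nbs x \<subseteq> Domain h" "\<And>x. x \<in> Range h \<Longrightarrow> nbs x \<subseteq> Range h"
    using graph_iso_extend_closed[OF h0] by blast
  have cD: "countable (Domain h)" "countable (Range h)"
    using h countable_image[of h fst] countable_image[of h snd]
    by (simp_all add: Domain_fst Range_snd)
  define code where "code h x = (if x \<in> Domain h then Some (SOME y. (x, y) \<in> h) else None)"
    for h :: "(vtx \<times> vtx) set" and x
  have code: "code f x = Some y \<longleftrightarrow> (x, y) \<in> f" if "graph_iso f" for f x y
  proof -
    have "(SOME y. (x, y) \<in> f) = y" if "(x, y) \<in> f" for y
      using that graph_isoD(1)[OF \<open>graph_iso f\<close> that] by (intro some_equality) auto
    then show ?thesis by (auto simp: code_def)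
  qed
  define k where "k = code h"
  define k' where "k' = code (h\<inverse>)"
  have k: "k x = Some y \<longleftrightarrow> (x, y) \<in> h" for x y unfolding k_def by (rule code[OF h(3)])
  have k': "k' y = Some x \<longleftrightarrow> (x, y) \<in> h" for x y
    unfolding k'_def using code[of "h\<inverse>" y x] h(3) by (simp add: graph_iso_converse)
  have kN: "k x = None \<longleftrightarrow> x \<notin> Domain h" for x by (simp add: k_def code_def)
  have kN': "k' x = None \<longleftrightarrow> x \<notin> Range h" for x by (simp add: k'_def code_def)
  have fib: "countable {i. Vtx C i \<in> X}" if "countable X" for C X
  proof -
    have "Vtx C ` {i. Vtx C i \<in> X} \<subseteq> X" by blast
    moreover have "inj_on (Vtx C) {i. Vtx C i \<in> X}" by (auto intro: inj_onI)
    ultimately show ?thesis using that countable_subset countable_image_inj_on by metis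
  qed
  have "\<exists>f. bij_betw f (- {i. Vtx C i \<in> Domain h}) (- {i. Vtx C' i \<in> Range h})" for C C'
    by (rule cocountable_bij_betw[OF uncountable_nat_sets fib[OF cD(1)] fib[OF cD(2)]])
  then obtain \<beta> where \<beta>: "\<And>C C'. bij_betw (\<beta> C C') (- {i. Vtx C i \<in> Domain h}) (- {i. Vtx C' i \<in> Range h})"
    by metis
  define \<beta>' where "\<beta>' C' C = inv_into (- {i. Vtx C i \<in> Domain h}) (\<beta> C C')" for C' C
  have \<beta>': "bij_betw (\<beta>' C' C) (- {i. Vtx C' i \<in> Range h}) (- {i. Vtx C i \<in> Domain h})" for C C'
    unfolding \<beta>'_def using \<beta> by (rule bij_betw_inv_into)
  define g where "g = vmap k \<beta>"
  define g' where "g' = vmap k' \<beta>'"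
  have g'g: "g' (g v) = v" for v
    unfolding g_def g'_def
  proof (rule vmap_inverse)
    fix C C' i assume "k (Vtx C i) = None"
    then have i: "i \<in> - {i. Vtx C i \<in> Domain h}" by (simp add: kN)
    then have "\<beta> C C' i \<in> - {i. Vtx C' i \<in> Range h}" using bij_betwE[OF \<beta>] by blast
    moreover have "\<beta>' C' C (\<beta> C C' i) = i"
      unfolding \<beta>'_def using bij_betw_inv_into_left[OF \<beta> i] .
    ultimately show "k' (Vtx C' (\<beta> C C' i)) = None \<and> \<beta>' C' C (\<beta> C C' i) = i"
      by (simp add: kN')
  qed (simp add: k k')
  have gg': "g (g' v) = v" for v
    unfolding g_def g'_def
  proof (rule vmap_inverse)
    fix C' C i assume "k' (Vtx C' i) = None"
    then have i: "i \<in> - {i. Vtx C' i \<in> Range h}" by (simp add: kN')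
    then have "\<beta>' C' C i \<in> - {i. Vtx C i \<in> Domain h}" using bij_betwE[OF \<beta>'] by blast
    moreover have "\<beta> C C' (\<beta>' C' C i) = i"
      unfolding \<beta>'_def using bij_betw_inv_into_right[OF \<beta> i] .
    ultimately show "k (Vtx C (\<beta>' C' C i)) = None \<and> \<beta> C C' (\<beta>' C' C i) = i"
      by (simp add: kN)
  qed (simp add: k k')
  have gh: "g x = y" if "(x, y) \<in> h" for x y
    using that k[of x y] vmap_eq[of k \<beta> x] by (simp add: g_def)
  have gh': "g' y = x" if "(x, y) \<in> h" for x y
    using gh[OF that] g'g by metis
  have nb_g: "nbs (g x) = g ` nbs x" if "x \<notin> Domain h" for x
    using that kN[of x] vmap_eq[of k \<beta> x] by (simp add: g_def cimage.rep_eq)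
  have nb_g': "nbs (g' x) = g' ` nbs x" if "x \<notin> Range h" for x
    using that kN'[of x] vmap_eq[of k' \<beta>' x] by (simp add: g'_def cimage.rep_eq)
  have pres: "adj (g x) (g y)" if "x \<in> nbs y" for x y
  proof (cases "y \<in> Domain h")
    case True
    then have "x \<in> Domain h" using closed(1) that by blast
    then obtain x' y' where "(x, x') \<in> h" "(y, y') \<in> h" using True by blast
    then show ?thesis
      using graph_isoD(2)[OF h(3), of x x' y y'] gh that by (simp add: adj_def)
  next
    case False
    then show ?thesis using nb_g that by (auto simp: adj_def)
  qed
  have pres': "adj (g' x) (g' y)" if "x \<in> nbs y" for x y
  proof (cases "y \<in> Range h")
    case True
    then have "x \<in> Range h" using closed(2) that by blast
    then obtain x' y' where "(x', x) \<in> h" "(y', y) \<in> h" using True by blast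
    then show ?thesis
      using graph_isoD(2)[OF h(3), of x' x y' y] gh' that by (simp add: adj_def)
  next
    case False
    then show ?thesis using nb_g' that by (auto simp: adj_def)
  qed
  have "adj x y \<longleftrightarrow> adj (g x) (g y)" for x y
    using pres[of x y] pres[of y x] pres'[of "g x" "g y"] pres'[of "g y" "g x"]
    by (auto simp: g'g adj_def)
  moreover have "bij g" using g'g gg' by (metis bijI')
  ultimately show ?thesis using gh h(1) by (intro exI[of _ g]) auto
qed

section \<open>The tree of graphs\<close>

definition well_ordered_set :: "gam set \<Rightarrow> bool" where
  "well_ordered_set S \<longleftrightarrow> (\<forall>T\<subseteq>S. T \<noteq> {} \<longrightarrow> (\<exists>m\<in>T. \<forall>t\<in>T. m \<le> t))"

lemma well_ordered_setD: "well_ordered_set S \<Longrightarrow> T \<subseteq> S \<Longrightarrow> T \<noteq> {} \<Longrightarrow> \<exists>m\<in>T. \<forall>t\<in>T. m \<le> t"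
  by (auto simp: well_ordered_set_def)

lemma well_ordered_set_empty [simp]: "well_ordered_set {}"
  by (simp add: well_ordered_set_def)

lemma well_ordered_set_subset: "well_ordered_set S \<Longrightarrow> S' \<subseteq> S \<Longrightarrow> well_ordered_set S'"
  by (auto simp: well_ordered_set_def)

lemma well_ordered_set_Un:
  assumes "well_ordered_set S" "well_ordered_set S'"
  shows "well_ordered_set (S \<union> S')"
  unfolding well_ordered_set_def
proof (intro allI impI)
  fix T assume T: "T \<subseteq> S \<union> S'" "T \<noteq> {}"
  show "\<exists>m\<in>T. \<forall>t\<in>T. m \<le> t"
  proof (cases "T \<inter> S = {} \<or> T \<inter> S' = {}")
    case True
    then have "T \<subseteq> S \<or> T \<subseteq> S'" using T by blast
    then show ?thesis using T assms well_ordered_setD by blast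
  next
    case False
    then obtain m m' where m: "m \<in> T \<inter> S" "\<forall>t\<in>T \<inter> S. m \<le> t"
      and m': "m' \<in> T \<inter> S'" "\<forall>t\<in>T \<inter> S'. m' \<le> t"
      using well_ordered_setD[OF assms(1), of "T \<inter> S"] well_ordered_setD[OF assms(2), of "T \<inter> S'"] by auto
    have "min m m' \<in> T" using m m' by (simp add: min_def)
    moreover have "\<forall>t\<in>T. min m m' \<le> t"
      using m(2) m'(2) T(1) by (auto simp: min_le_iff_disj)
    ultimately show ?thesis by blast
  qed
qed

text \<open>The label outside the support of a labelling. It is an ordinary vertex and may also be
  the label of a cone at a branching node.\<close>

definition default_vtx :: vtx where "default_vtx = Vtx bot {}"

text \<open>A well-ordered support guarantees that two different labellings have a first difference,
  even though the order of levels is far from well-founded.\<close>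

definition ok_lab :: "gam \<Rightarrow> (gam \<Rightarrow> vtx) \<Rightarrow> bool" where
  "ok_lab l f \<longleftrightarrow> (\<forall>\<beta>\<ge>l. f \<beta> = default_vtx) \<and> well_ordered_set {\<beta>. f \<beta> \<noteq> default_vtx}"

typedef elt = "{(l, f, w :: nat set). ok_lab l f}"
  by (rule exI[of _ "(undefined, \<lambda>_. default_vtx, {})"]) (simp add: ok_lab_def)

definition lev :: "elt \<Rightarrow> gam" where "lev x = fst (Rep_elt x)"
definition lab :: "elt \<Rightarrow> gam \<Rightarrow> vtx" where "lab x = fst (snd (Rep_elt x))"
definition tag :: "elt \<Rightarrow> nat set" where "tag x = snd (snd (Rep_elt x))"
definition mk_elt :: "gam \<Rightarrow> (gam \<Rightarrow> vtx) \<Rightarrow> nat set \<Rightarrow> elt" where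
  "mk_elt l f w = Abs_elt (l, f, w)"

lemma mk_elt [simp]:
  assumes "ok_lab l f"
  shows "lev (mk_elt l f w) = l" "lab (mk_elt l f w) = f" "tag (mk_elt l f w) = w"
  using assms by (simp_all add: lev_def lab_def tag_def mk_elt_def Abs_elt_inverse)

lemma ok_lab_lab [simp]: "ok_lab (lev x) (lab x)"
  using Rep_elt[of x] by (auto simp: lev_def lab_def)

lemma elt_eq_iff: "x = y \<longleftrightarrow> lev x = lev y \<and> lab x = lab y \<and> tag x = tag y"
  by (auto simp: lev_def lab_def tag_def prod_eq_iff simp flip: Rep_elt_inject)

lemma lab_beyond: "lev x \<le> \<beta> \<Longrightarrow> lab x \<beta> = default_vtx"
  using ok_lab_lab[of x] by (auto simp: ok_lab_def)

lemma well_ordered_support: "well_ordered_set {\<beta>. lab x \<beta> \<noteq> default_vtx}"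
  using ok_lab_lab[of x] by (auto simp: ok_lab_def)

lemma first_label_difference:
  assumes "lab x \<alpha> \<noteq> lab y \<alpha>"
  obtains m where "lab x m \<noteq> lab y m" "\<And>\<beta>. \<beta> < m \<Longrightarrow> lab x \<beta> = lab y \<beta>" "m \<le> \<alpha>"
proof -
  have "well_ordered_set ({\<beta>. lab x \<beta> \<noteq> default_vtx} \<union> {\<beta>. lab y \<beta> \<noteq> default_vtx})"
    by (rule well_ordered_set_Un[OF well_ordered_support well_ordered_support])
  moreover have "{\<beta>. lab x \<beta> \<noteq> lab y \<beta>} \<subseteq> {\<beta>. lab x \<beta> \<noteq> default_vtx} \<union> {\<beta>. lab y \<beta> \<noteq> default_vtx}"
    by auto
  ultimately obtain m where m: "m \<in> {\<beta>. lab x \<beta> \<noteq> lab y \<beta>}" "\<forall>t\<in>{\<beta>. lab x \<beta> \<noteq> lab y \<beta>}. m \<le> t"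
    using well_ordered_setD assms by blast
  then have "lab x \<beta> = lab y \<beta>" if "\<beta> < m" for \<beta> using that not_less by blast
  then show ?thesis using that[of m] m assms by blast
qed

definition delta :: "elt \<Rightarrow> elt \<Rightarrow> gam" where
  "delta x y = (THE d. d \<le> lev x \<and> d \<le> lev y \<and> (\<forall>\<alpha><d. lab x \<alpha> = lab y \<alpha>) \<and>
     (d < lev x \<longrightarrow> d < lev y \<longrightarrow> lab x d \<noteq> lab y d))"

lemma delta_eqI:
  assumes d: "d \<le> lev x" "d \<le> lev y" "\<And>\<alpha>. \<alpha> < d \<Longrightarrow> lab x \<alpha> = lab y \<alpha>"
    "d < lev x \<Longrightarrow> d < lev y \<Longrightarrow> lab x d \<noteq> lab y d"
  shows "delta x y = d"
  unfolding delta_def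
proof (rule the_equality)
  fix e assume e: "e \<le> lev x \<and> e \<le> lev y \<and> (\<forall>\<alpha><e. lab x \<alpha> = lab y \<alpha>) \<and>
     (e < lev x \<longrightarrow> e < lev y \<longrightarrow> lab x e \<noteq> lab y e)"
  show "e = d"
  proof (rule linorder_cases[of e d])
    assume "e < d"
    then show ?thesis using d(1-3) e by force
  next
    assume "d < e"
    then show ?thesis using d(4) e by force
  qed
qed (use d in auto)

lemma delta_props:
  shows delta_le: "delta x y \<le> lev x" "delta x y \<le> lev y"
    and delta_agree: "\<alpha> < delta x y \<Longrightarrow> lab x \<alpha> = lab y \<alpha>"
    and delta_differ: "delta x y < lev x \<Longrightarrow> delta x y < lev y \<Longrightarrow> lab x (delta x y) \<noteq> lab y (delta x y)"
proof -
  let ?good = "\<lambda>d. d \<le> lev x \<and> d \<le> lev y \<and> (\<forall>\<alpha><d. lab x \<alpha> = lab y \<alpha>) \<and>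
     (d < lev x \<longrightarrow> d < lev y \<longrightarrow> lab x d \<noteq> lab y d)"
  have "\<exists>d. ?good d"
  proof (cases "\<exists>\<alpha><min (lev x) (lev y). lab x \<alpha> \<noteq> lab y \<alpha>")
    case True
    then obtain \<alpha> where \<alpha>: "\<alpha> < min (lev x) (lev y)" "lab x \<alpha> \<noteq> lab y \<alpha>" by blast
    obtain m where "lab x m \<noteq> lab y m" "\<And>\<beta>. \<beta> < m \<Longrightarrow> lab x \<beta> = lab y \<beta>" "m \<le> \<alpha>"
      using first_label_difference[OF \<alpha>(2)] by metis
    then show ?thesis using \<alpha> by (intro exI[of _ m]) auto
  next
    case False
    then show ?thesis by (intro exI[of _ "min (lev x) (lev y)"]) (auto simp: min_def)
  qed
  then obtain d where d: "?good d" by blast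
  then have "delta x y = d" by (intro delta_eqI) auto
  with d show "delta x y \<le> lev x" "delta x y \<le> lev y"
    "\<alpha> < delta x y \<Longrightarrow> lab x \<alpha> = lab y \<alpha>"
    "delta x y < lev x \<Longrightarrow> delta x y < lev y \<Longrightarrow> lab x (delta x y) \<noteq> lab y (delta x y)"
    by auto
qed

text \<open>The characterization from which all ultrametric properties of \<open>delta\<close>
  follow.\<close>

lemma le_delta_iff:
  "\<beta> \<le> delta x y \<longleftrightarrow> \<beta> \<le> lev x \<and> \<beta> \<le> lev y \<and> (\<forall>\<alpha><\<beta>. lab x \<alpha> = lab y \<alpha>)"
proof
  assume "\<beta> \<le> delta x y"
  then show "\<beta> \<le> lev x \<and> \<beta> \<le> lev y \<and> (\<forall>\<alpha><\<beta>. lab x \<alpha> = lab y \<alpha>)"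
    using delta_le[of x y] delta_agree[of _ x y] by fastforce
next
  assume R: "\<beta> \<le> lev x \<and> \<beta> \<le> lev y \<and> (\<forall>\<alpha><\<beta>. lab x \<alpha> = lab y \<alpha>)"
  show "\<beta> \<le> delta x y"
  proof (rule ccontr)
    assume "\<not> \<beta> \<le> delta x y"
    then have "delta x y < \<beta>" by simp
    then show False using R delta_differ[of x y] by force
  qed
qed

lemma less_delta_iff:
  "\<beta> < delta x y \<longleftrightarrow> \<beta> < lev x \<and> \<beta> < lev y \<and> (\<forall>\<alpha><\<beta>. lab x \<alpha> = lab y \<alpha>) \<and> lab x \<beta> = lab y \<beta>"
proof
  assume "\<beta> < delta x y"
  then show "\<beta> < lev x \<and> \<beta> < lev y \<and> (\<forall>\<alpha><\<beta>. lab x \<alpha> = lab y \<alpha>) \<and> lab x \<beta> = lab y \<beta>"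
    using delta_le[of x y] delta_agree[of _ x y] by (auto intro: less_le_trans less_trans)
next
  assume R: "\<beta> < lev x \<and> \<beta> < lev y \<and> (\<forall>\<alpha><\<beta>. lab x \<alpha> = lab y \<alpha>) \<and> lab x \<beta> = lab y \<beta>"
  then have "\<beta> \<le> delta x y" by (auto simp: le_delta_iff)
  moreover have "\<beta> \<noteq> delta x y" using R delta_differ[of x y] by auto
  ultimately show "\<beta> < delta x y" by simp
qed

lemma delta_self [simp]: "delta x x = lev x"
  by (rule delta_eqI) auto

lemma delta_sym: "delta x y = delta y x"
  by (rule order_antisym; subst le_delta_iff; use delta_le delta_agree in auto)

lemma delta_ultra: "d \<le> delta x y \<Longrightarrow> d \<le> delta y z \<Longrightarrow> d \<le> delta x z"
  by (auto simp: le_delta_iff)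

text \<open>In an ultrametric tree the least of three meeting levels occurs at least twice.\<close>

lemma delta_eq_of_less:
  assumes "delta x y < delta y z"
  shows "delta x z = delta x y"
proof (rule order_antisym)
  show "delta x y \<le> delta x z"
    using assms by (intro delta_ultra[of _ x y z]) auto
  show "delta x z \<le> delta x y"
  proof (rule ccontr)
    assume "\<not> ?thesis"
    moreover have "min (delta x z) (delta y z) \<le> delta x y"
      by (rule delta_ultra[of _ x z y]) (auto simp: delta_sym[of z y])
    ultimately show False using assms by (simp add: min_def split: if_splits)
  qed
qed

text \<open>Adjacency is read off at the level where two branches part, so it depends only on the
  two cones at the branching node.\<close>

definition rel :: "elt \<Rightarrow> elt \<Rightarrow> bool" where
  "rel x y \<longleftrightarrow> delta x y < lev x \<and> delta x y < lev y \<and> adj (lab x (delta x y)) (lab y (delta x y))"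

lemma rel_sym: "rel x y \<longleftrightarrow> rel y x"
  by (auto simp: rel_def delta_sym[of y x] adj_sym)

lemma rel_less: "rel x y \<Longrightarrow> delta x y < lev x" "rel x y \<Longrightarrow> delta x y < lev y"
  by (auto simp: rel_def)

lemma rel_irrefl [simp]: "\<not> rel x x"
  by (simp add: rel_def)

text \<open>The points \<open>y\<close> and \<open>z\<close> still share a branch where
  \<open>x\<close> leaves it.\<close>

lemma rel_transfer:
  assumes "delta x y < delta y z"
  shows "rel x y \<longleftrightarrow> rel x z"
  using delta_eq_of_less[OF assms] delta_agree[OF assms] delta_le[of y z] assms
  by (auto simp: rel_def)

lemma rel_same_node:
  assumes "lev x = lev x'" "lab x = lab x'"
  shows "delta x y = delta x' y" "rel x y \<longleftrightarrow> rel x' y"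
proof -
  show "delta x y = delta x' y" by (simp add: delta_def assms)
  then show "rel x y \<longleftrightarrow> rel x' y" by (simp add: rel_def assms)
qed

text \<open>Partial isomorphisms as sets of pairs. Since \<open>delta x x = lev x\<close>, the
  comparison of \<open>delta\<close>-values covers the order of levels and the tree order, and it
  compares meeting points that are not themselves in the domain.\<close>

definition elt_iso :: "(elt \<times> elt) set \<Rightarrow> bool" where
  "elt_iso h \<longleftrightarrow>
     (\<forall>p\<in>h. \<forall>q\<in>h. (fst p = fst q \<longleftrightarrow> snd p = snd q) \<and> (rel (fst p) (fst q) \<longleftrightarrow> rel (snd p) (snd q))) \<and>
     (\<forall>p\<in>h. \<forall>q\<in>h. \<forall>r\<in>h. \<forall>s\<in>h.
        delta (fst p) (fst q) \<le> delta (fst r) (fst s) \<longleftrightarrow> delta (snd p) (snd q) \<le> delta (snd r) (snd s))"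

definition elt_aut :: "(elt \<Rightarrow> elt) \<Rightarrow> bool" where
  "elt_aut g \<longleftrightarrow> bij g \<and> (\<forall>x y. rel x y \<longleftrightarrow> rel (g x) (g y)) \<and>
     (\<forall>x y u v. delta x y \<le> delta u v \<longleftrightarrow> delta (g x) (g y) \<le> delta (g u) (g v))"

lemma elt_aut_comp: "elt_aut f \<Longrightarrow> elt_aut g \<Longrightarrow> elt_aut (f \<circ> g)"
  unfolding elt_aut_def by (auto intro: bij_comp)

subsection \<open>Shifting levels\<close>

text \<open>An automorphism of the order of levels carries labellings along.\<close>

lemma shift_levels:
  assumes "bij \<sigma>" and mono: "\<And>x y. x < y \<longleftrightarrow> \<sigma> x < \<sigma> y"
  shows "\<exists>g. elt_aut g \<and> (\<forall>x y. delta (g x) (g y) = \<sigma> (delta x y))"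
proof -
  have shiftI: "\<exists>g. (\<forall>x y. delta (g x) (g y) = \<sigma> (delta x y) \<and> (rel x y \<longleftrightarrow> rel (g x) (g y))) \<and>
      (\<forall>x. lev (g x) = \<sigma> (lev x) \<and> lab (g x) = lab x \<circ> inv \<sigma> \<and> tag (g x) = tag x)"
    if bij: "bij \<sigma>" and mono: "\<And>x y. x < y \<longleftrightarrow> \<sigma> x < \<sigma> y" for \<sigma>
  proof -
    define g where "g x = mk_elt (\<sigma> (lev x)) (lab x \<circ> inv \<sigma>) (tag x)" for x
    have [simp]: "inv \<sigma> (\<sigma> a) = a" "\<sigma> (inv \<sigma> a) = a" for a
      using bij by (simp_all add: bij_is_inj bij_is_surj surj_f_inv_f)
    have le: "\<sigma> a \<le> \<sigma> b \<longleftrightarrow> a \<le> b" for a b using mono[of b a] by (metis not_less)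
    have "ok_lab (\<sigma> (lev x)) (lab x \<circ> inv \<sigma>)" for x
      unfolding ok_lab_def
    proof (intro conjI allI impI)
      fix b assume "\<sigma> (lev x) \<le> b"
      then have "lev x \<le> inv \<sigma> b" using le[of "lev x" "inv \<sigma> b"] by simp
      then show "(lab x \<circ> inv \<sigma>) b = default_vtx" by (simp add: lab_beyond)
    next
      show "well_ordered_set {\<beta>. (lab x \<circ> inv \<sigma>) \<beta> \<noteq> default_vtx}"
        unfolding well_ordered_set_def
      proof (intro allI impI)
        fix T assume T: "T \<subseteq> {\<beta>. (lab x \<circ> inv \<sigma>) \<beta> \<noteq> default_vtx}" "T \<noteq> {}"
        then have "inv \<sigma> ` T \<subseteq> {\<beta>. lab x \<beta> \<noteq> default_vtx}" "inv \<sigma> ` T \<noteq> {}" by auto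
        then obtain m where m: "m \<in> inv \<sigma> ` T" "\<forall>t\<in>inv \<sigma> ` T. m \<le> t"
          using well_ordered_setD[OF well_ordered_support] by blast
        then obtain t where "t \<in> T" "m = inv \<sigma> t" by blast
        moreover have "t \<le> s" if "s \<in> T" for s
          using m(2) that \<open>m = inv \<sigma> t\<close> le[of "inv \<sigma> t" "inv \<sigma> s"] by simp
        ultimately show "\<exists>m\<in>T. \<forall>t\<in>T. m \<le> t" by blast
      qed
    qed
    then have g: "lev (g x) = \<sigma> (lev x)" "lab (g x) = lab x \<circ> inv \<sigma>" "tag (g x) = tag x" for x
      by (simp_all add: g_def)
    have d: "delta (g x) (g y) = \<sigma> (delta x y)" for x y
    proof (rule delta_eqI)
      fix a assume "a < \<sigma> (delta x y)"
      then have "inv \<sigma> a < delta x y" using mono[of "inv \<sigma> a" "delta x y"] by simp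
      then show "lab (g x) a = lab (g y) a" by (simp add: g delta_agree)
    next
      assume "\<sigma> (delta x y) < lev (g x)" "\<sigma> (delta x y) < lev (g y)"
      then show "lab (g x) (\<sigma> (delta x y)) \<noteq> lab (g y) (\<sigma> (delta x y))"
        using delta_differ[of x y] mono by (simp add: g)
    qed (simp_all add: g le delta_le)
    then have "rel x y \<longleftrightarrow> rel (g x) (g y)" for x y
      using mono by (simp add: rel_def g)
    then show ?thesis using d g by (intro exI[of _ g]) auto
  qed
  obtain g where g: "\<And>x y. delta (g x) (g y) = \<sigma> (delta x y)" "\<And>x y. rel x y \<longleftrightarrow> rel (g x) (g y)"
     "\<And>x. lev (g x) = \<sigma> (lev x) \<and> lab (g x) = lab x \<circ> inv \<sigma> \<and> tag (g x) = tag x"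
    using shiftI[OF assms] by blast
  have b': "bij (inv \<sigma>)" using assms(1) by (rule bij_imp_bij_inv)
  have [simp]: "inv \<sigma> (\<sigma> a) = a" "\<sigma> (inv \<sigma> a) = a" for a
    using assms(1) by (simp_all add: bij_is_inj bij_is_surj surj_f_inv_f)
  have "x < y \<longleftrightarrow> inv \<sigma> x < inv \<sigma> y" for x y using mono[of "inv \<sigma> x" "inv \<sigma> y"] by simp
  then obtain g' where g': "\<And>x. lev (g' x) = inv \<sigma> (lev x) \<and> lab (g' x) = lab x \<circ> inv (inv \<sigma>) \<and> tag (g' x) = tag x"
    using shiftI[OF b'] by blast
  have "g (g' x) = x" "g' (g x) = x" for x
    using g(3) g' assms(1) by (auto simp: elt_eq_iff inv_inv_eq fun_eq_iff)
  then have "bij g" by (metis bijI')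
  moreover have "\<sigma> a \<le> \<sigma> b \<longleftrightarrow> a \<le> b" for a b using mono[of b a] by (metis not_less)
  ultimately show ?thesis using g(1,2) by (intro exI[of _ g]) (auto simp: elt_aut_def)
qed

subsection \<open>Permuting labels\<close>

text \<open>Relabelling: \<open>P \<beta> f\<close> permutes the labels on the cones at the node
  with level \<open>\<beta>\<close> and labelling \<open>f\<close> below \<open>\<beta>\<close>. The
  node is computed in the original labelling, so no recursion over levels is involved.\<close>

definition twist :: "(gam \<Rightarrow> (gam \<Rightarrow> vtx) \<Rightarrow> vtx \<Rightarrow> vtx) \<Rightarrow> elt \<Rightarrow> gam \<Rightarrow> vtx" where
  "twist P x \<beta> = (if \<beta> < lev x then P \<beta> (lab x) (lab x \<beta>) else default_vtx)"

text \<open>A family \<open>P\<close> of graph automorphisms, one for each node, that moves the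
  branch of \<open>u p\<close> to the branch of \<open>v p\<close> for all \<open>p\<close> and is the
  identity at nodes off the branches \<open>u p\<close>. The locale is instantiated with
  \<open>u\<close> and \<open>v\<close> in both roles, which yields a map and its inverse.\<close>

locale relabelling =
  fixes h :: "'p set" and u v :: "'p \<Rightarrow> elt" and P :: "gam \<Rightarrow> (gam \<Rightarrow> vtx) \<Rightarrow> vtx \<Rightarrow> vtx"
  assumes lev_uv: "p \<in> h \<Longrightarrow> lev (u p) = lev (v p)"
    and bij_P: "bij (P \<beta> f)"
    and adj_P: "adj (P \<beta> f a) (P \<beta> f b) \<longleftrightarrow> adj a b"
    and local_P: "(\<And>\<alpha>. \<alpha> < \<beta> \<Longrightarrow> f \<alpha> = f' \<alpha>) \<Longrightarrow> P \<beta> f = P \<beta> f'"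
    and idle_P: "(\<And>p. p \<in> h \<Longrightarrow> \<beta> < lev (u p) \<Longrightarrow> \<exists>\<alpha><\<beta>. f \<alpha> \<noteq> lab (u p) \<alpha>) \<Longrightarrow> P \<beta> f = id"
    and move_P: "p \<in> h \<Longrightarrow> \<beta> < lev (u p) \<Longrightarrow> (\<And>\<alpha>. \<alpha> < \<beta> \<Longrightarrow> f \<alpha> = lab (u p) \<alpha>) \<Longrightarrow>
      P \<beta> f (lab (u p) \<beta>) = lab (v p) \<beta>"
begin

lemma twist_agree_iff:
  assumes p: "p \<in> h" and \<beta>: "\<beta> \<le> lev x" "\<beta> \<le> lev (u p)"
  shows "(\<forall>\<alpha><\<beta>. twist P x \<alpha> = lab (v p) \<alpha>) \<longleftrightarrow> (\<forall>\<alpha><\<beta>. lab x \<alpha> = lab (u p) \<alpha>)"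
proof
  assume R: "\<forall>\<alpha><\<beta>. lab x \<alpha> = lab (u p) \<alpha>"
  show "\<forall>\<alpha><\<beta>. twist P x \<alpha> = lab (v p) \<alpha>"
  proof (intro allI impI)
    fix \<alpha> assume \<alpha>: "\<alpha> < \<beta>"
    then have "P \<alpha> (lab x) (lab (u p) \<alpha>) = lab (v p) \<alpha>"
      using R \<beta> by (intro move_P[OF p]) auto
    then show "twist P x \<alpha> = lab (v p) \<alpha>"
      using R \<alpha> less_le_trans[OF \<alpha> \<beta>(1)] by (simp add: twist_def)
  qed
next
  assume L: "\<forall>\<alpha><\<beta>. twist P x \<alpha> = lab (v p) \<alpha>"
  show "\<forall>\<alpha><\<beta>. lab x \<alpha> = lab (u p) \<alpha>"
  proof (rule ccontr)
    assume "\<not> ?thesis"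
    then obtain \<alpha> where \<alpha>: "\<alpha> < \<beta>" "lab x \<alpha> \<noteq> lab (u p) \<alpha>" by blast
    obtain m where m: "lab x m \<noteq> lab (u p) m" "\<And>\<beta>. \<beta> < m \<Longrightarrow> lab x \<beta> = lab (u p) \<beta>" "m \<le> \<alpha>"
      using first_label_difference[OF \<alpha>(2)] by metis
    have "m < \<beta>" using m(3) \<alpha>(1) by simp
    then have "P m (lab x) (lab (u p) m) = lab (v p) m"
      using m(2) \<beta> by (intro move_P[OF p]) auto
    moreover have "P m (lab x) (lab x m) = lab (v p) m"
      using L \<open>m < \<beta>\<close> less_le_trans[OF \<open>m < \<beta>\<close> \<beta>(1)] by (auto simp: twist_def)
    ultimately show False using m(1) bij_P by (metis bij_pointE)
  qed
qed

lemma ok_lab_twist: "ok_lab (lev x) (twist P x)"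
  unfolding ok_lab_def
proof (intro conjI allI impI)
  show "well_ordered_set {\<beta>. twist P x \<beta> \<noteq> default_vtx}"
    unfolding well_ordered_set_def
  proof (intro allI impI)
    fix T assume T: "T \<subseteq> {\<beta>. twist P x \<beta> \<noteq> default_vtx}" "T \<noteq> {}"
    have lev_T: "t < lev x" if "t \<in> T" for t
      using T(1) that by (auto simp: twist_def split: if_splits)
    show "\<exists>m\<in>T. \<forall>t\<in>T. m \<le> t"
    \<comment> \<open>As long as \<open>x\<close> runs along some \<open>u p\<close>, the new labels are those of
      \<open>v p\<close>; afterwards they are the old labels of \<open>x\<close>. Both kinds of
      labelling have well-ordered support.\<close>
    proof (cases "\<exists>t\<in>T. \<exists>p\<in>h. t < lev (u p) \<and> (\<forall>\<alpha><t. lab x \<alpha> = lab (u p) \<alpha>)")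
      case True
      then obtain t p where t: "t \<in> T" "p \<in> h" "t < lev (u p)" "\<forall>\<alpha><t. lab x \<alpha> = lab (u p) \<alpha>"
        by blast
      then have eq: "\<forall>\<alpha><t. twist P x \<alpha> = lab (v p) \<alpha>"
        using twist_agree_iff[OF t(2), of t x] lev_T[OF t(1)] by auto
      show ?thesis
      proof (cases "T \<inter> {..<t} = {}")
        case True
        then show ?thesis using t(1) by (intro bexI[of _ t]) (auto simp: not_less)
      next
        case False
        moreover have "T \<inter> {..<t} \<subseteq> {\<beta>. lab (v p) \<beta> \<noteq> default_vtx}" using T eq by auto
        ultimately obtain m where "m \<in> T \<inter> {..<t}" "\<forall>s\<in>T \<inter> {..<t}. m \<le> s"
          using well_ordered_setD[OF well_ordered_support] by blast
        then have m: "m \<in> T" "m < t" "\<And>s. s \<in> T \<Longrightarrow> s < t \<Longrightarrow> m \<le> s" by auto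
        have "m \<le> s" if "s \<in> T" for s
          using m(2) m(3)[OF that] by (cases "s < t") auto
        then show ?thesis using m(1) by blast
      qed
    next
      case False
      have "twist P x t = lab x t" if "t \<in> T" for t
      proof -
        have "P t (lab x) = id" using False that by (intro idle_P) blast
        then show ?thesis using lev_T[OF that] by (simp add: twist_def)
      qed
      then have "T \<subseteq> {\<beta>. lab x \<beta> \<noteq> default_vtx}" using T by auto
      then show ?thesis using well_ordered_setD[OF well_ordered_support] T by blast
    qed
  qed
qed (auto simp: twist_def)

definition act :: "elt \<Rightarrow> elt" where
  "act x = mk_elt (lev x) (twist P x) (tag x)"

lemma act [simp]: "lev (act x) = lev x" "lab (act x) = twist P x" "tag (act x) = tag x"
  by (simp_all add: act_def ok_lab_twist)

lemma P_agree: "\<beta> \<le> delta x y \<Longrightarrow> P \<beta> (lab x) = P \<beta> (lab y)"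
  by (rule local_P) (simp add: delta_agree)

lemma delta_act: "delta (act x) (act y) = delta x y"
proof (rule delta_eqI)
  fix \<alpha> assume a: "\<alpha> < delta x y"
  then have "\<alpha> < lev x" "\<alpha> < lev y" using delta_le[of x y] by auto
  then show "lab (act x) \<alpha> = lab (act y) \<alpha>"
    using a P_agree[of \<alpha> x y] by (simp add: twist_def delta_agree)
next
  assume "delta x y < lev (act x)" "delta x y < lev (act y)"
  then show "lab (act x) (delta x y) \<noteq> lab (act y) (delta x y)"
    using delta_differ[of x y] P_agree[of "delta x y" x y] bij_P
    by (simp add: twist_def) (metis bij_pointE)
qed (simp_all add: delta_le)

lemma rel_act: "rel (act x) (act y) \<longleftrightarrow> rel x y"
  using P_agree[of "delta x y" x y] adj_P by (auto simp: rel_def delta_act twist_def)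

lemma act_u: "p \<in> h \<Longrightarrow> twist P (u p) = lab (v p)"
proof (rule ext)
  fix \<beta> assume p: "p \<in> h"
  show "twist P (u p) \<beta> = lab (v p) \<beta>"
    using move_P[OF p, of \<beta> "lab (u p)"] lev_uv[OF p] lab_beyond[of "v p" \<beta>]
    by (auto simp: twist_def)
qed

end


lemma elt_isoD:
  assumes "elt_iso h" "p \<in> h" "q \<in> h"
  shows "fst p = fst q \<longleftrightarrow> snd p = snd q" "rel (fst p) (fst q) \<longleftrightarrow> rel (snd p) (snd q)"
    "r \<in> h \<Longrightarrow> s \<in> h \<Longrightarrow>
      delta (fst p) (fst q) \<le> delta (fst r) (fst s) \<longleftrightarrow> delta (snd p) (snd q) \<le> delta (snd r) (snd s)"
  using assms unfolding elt_iso_def by blast+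

text \<open>At a node on some branch of the domain, the labels with which the branches continue are
  matched by a countable partial isomorphism of the graph: equality of labels is equality of branches
  one step further, and adjacency is \<open>rel\<close>. It extends to an automorphism of the graph by
  \<open>graph_homogeneous\<close>. The choice depends on the set of pairs passing through the node,
  which is the same set on the image side, so the inverse relabelling uses the inverse
  permutations.\<close>

lemma relabel_extends:
  assumes cnt: "countable h"
    and d: "\<And>p q. p \<in> h \<Longrightarrow> q \<in> h \<Longrightarrow> delta (fst p) (fst q) = delta (snd p) (snd q)"
    and r: "\<And>p q. p \<in> h \<Longrightarrow> q \<in> h \<Longrightarrow> rel (fst p) (fst q) \<longleftrightarrow> rel (snd p) (snd q)"
  shows "\<exists>g. elt_aut g \<and> (\<forall>x y. delta (g x) (g y) = delta x y) \<and>
     (\<forall>p\<in>h. lev (g (fst p)) = lev (snd p) \<and> lab (g (fst p)) = lab (snd p))"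
proof -
  have lev_eq: "lev (fst p) = lev (snd p)" if "p \<in> h" for p
    using d[OF that that] by simp
  define X where "X \<beta> f = {p \<in> h. \<beta> < lev (fst p) \<and> (\<forall>\<alpha><\<beta>. f \<alpha> = lab (fst p) \<alpha>)}" for \<beta> f
  define Y where "Y \<beta> f = {p \<in> h. \<beta> < lev (snd p) \<and> (\<forall>\<alpha><\<beta>. f \<alpha> = lab (snd p) \<alpha>)}" for \<beta> f
  define good where "good \<beta> S \<pi> \<longleftrightarrow> bij \<pi> \<and> (\<forall>a b. adj a b \<longleftrightarrow> adj (\<pi> a) (\<pi> b)) \<and>
      (\<forall>p\<in>S. \<pi> (lab (fst p) \<beta>) = lab (snd p) \<beta>) \<and> (S = {} \<longrightarrow> \<pi> = id)" for \<beta> S \<pi>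
  have ex: "\<exists>\<pi>. good \<beta> S \<pi>"
    if S: "S \<subseteq> h" "\<And>p q. p \<in> S \<Longrightarrow> q \<in> S \<Longrightarrow> \<beta> \<le> delta (fst p) (fst q) \<and> \<beta> < lev (fst p)" for \<beta> S
  proof (cases "S = {}")
    case True
    then show ?thesis by (intro exI[of _ id]) (simp add: good_def)
  next
    case False
    have "(lab (fst p) \<beta> = lab (fst q) \<beta> \<longleftrightarrow> lab (snd p) \<beta> = lab (snd q) \<beta>) \<and>
        (adj (lab (fst p) \<beta>) (lab (fst q) \<beta>) \<longleftrightarrow> adj (lab (snd p) \<beta>) (lab (snd q) \<beta>))"
      if pq: "p \<in> S" "q \<in> S" for p q
    proof -
      have ph: "p \<in> h" "q \<in> h" using pq S(1) by auto
      have lt: "\<beta> < lev (fst p)" "\<beta> < lev (fst q)" "\<beta> < lev (snd p)" "\<beta> < lev (snd q)"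
        using S(2)[OF pq] S(2)[OF pq(2,1)] lev_eq[OF ph(1)] lev_eq[OF ph(2)] by auto
      show ?thesis
      proof (cases "\<beta> < delta (fst p) (fst q)")
        case True
        then have "\<beta> < delta (snd p) (snd q)" using d[OF ph] by simp
        then show ?thesis using True by (simp add: delta_agree)
      next
        case False
        then have e: "delta (fst p) (fst q) = \<beta>" "delta (snd p) (snd q) = \<beta>"
          using S(2)[OF pq] d[OF ph] by auto
        then show ?thesis
          using lt r[OF ph] delta_differ[of "fst p" "fst q"] delta_differ[of "snd p" "snd q"]
          by (auto simp: rel_def)
      qed
    qed
    then have gi: "graph_iso ((\<lambda>p. (lab (fst p) \<beta>, lab (snd p) \<beta>)) ` S)"
      unfolding graph_iso_def by simp
    have "countable S" using S(1) cnt countable_subset by blast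
    then obtain \<pi> where \<pi>: "bij \<pi>" "\<forall>a b. adj a b \<longleftrightarrow> adj (\<pi> a) (\<pi> b)"
      "\<forall>(a, b)\<in>(\<lambda>p. (lab (fst p) \<beta>, lab (snd p) \<beta>)) ` S. \<pi> a = b"
      using graph_homogeneous[OF gi countable_image] by metis
    from \<pi>(3) have "\<forall>p\<in>S. \<pi> (lab (fst p) \<beta>) = lab (snd p) \<beta>" by simp
    then show ?thesis using \<pi>(1,2) False unfolding good_def by blast
  qed
  define pm where "pm \<beta> S = (if \<exists>\<pi>. good \<beta> S \<pi> then SOME \<pi>. good \<beta> S \<pi> else id)" for \<beta> S
  have pm: "good \<beta> S (pm \<beta> S)" if "\<exists>\<pi>. good \<beta> S \<pi>" for \<beta> S
    using someI_ex[OF that] that by (simp add: pm_def)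
  have pm_aut: "bij (pm \<beta> S)" "adj (pm \<beta> S a) (pm \<beta> S b) \<longleftrightarrow> adj a b" for \<beta> S a b
  proof -
    have "bij (pm \<beta> S) \<and> (\<forall>a b. adj a b \<longleftrightarrow> adj (pm \<beta> S a) (pm \<beta> S b))"
    proof (cases "\<exists>\<pi>. good \<beta> S \<pi>")
      case True
      then show ?thesis using pm[OF True] unfolding good_def by blast
    next
      case False
      then show ?thesis by (simp add: pm_def)
    qed
    then show "bij (pm \<beta> S)" "adj (pm \<beta> S a) (pm \<beta> S b) \<longleftrightarrow> adj a b" by auto
  qed
  have pmX: "good \<beta> (X \<beta> f) (pm \<beta> (X \<beta> f))" for \<beta> f
  proof (rule pm, rule ex)
    fix p q assume "p \<in> X \<beta> f" "q \<in> X \<beta> f"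
    then show "\<beta> \<le> delta (fst p) (fst q) \<and> \<beta> < lev (fst p)"
      by (auto simp: X_def le_delta_iff)
  qed (auto simp: X_def)
  have pmY: "good \<beta> (Y \<beta> f) (pm \<beta> (Y \<beta> f))" for \<beta> f
  proof (rule pm, rule ex)
    fix p q assume pq: "p \<in> Y \<beta> f" "q \<in> Y \<beta> f"
    then have "\<beta> \<le> delta (snd p) (snd q) \<and> \<beta> < lev (snd p)"
      by (auto simp: Y_def le_delta_iff)
    then show "\<beta> \<le> delta (fst p) (fst q) \<and> \<beta> < lev (fst p)"
      using pq d[of p q] lev_eq[of p] by (simp add: Y_def)
  qed (auto simp: Y_def)
  define P where "P \<beta> f = pm \<beta> (X \<beta> f)" for \<beta> f
  define Q where "Q \<beta> f = inv (pm \<beta> (Y \<beta> f))" for \<beta> f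
  have inv_pm: "inv (pm \<beta> S) (pm \<beta> S a) = a" "pm \<beta> S (inv (pm \<beta> S) a) = a" for \<beta> S a
    using pm_aut(1)[of \<beta> S] by (simp_all add: bij_is_inj bij_is_surj surj_f_inv_f)
  interpret fwd: relabelling h fst snd P
  proof
    fix \<beta> and f f' :: "gam \<Rightarrow> vtx" assume "\<And>\<alpha>. \<alpha> < \<beta> \<Longrightarrow> f \<alpha> = f' \<alpha>"
    then have "X \<beta> f = X \<beta> f'" by (auto simp: X_def)
    then show "P \<beta> f = P \<beta> f'" by (simp add: P_def)
  next
    fix \<beta> f assume "\<And>p. p \<in> h \<Longrightarrow> \<beta> < lev (fst p) \<Longrightarrow> \<exists>\<alpha><\<beta>. f \<alpha> \<noteq> lab (fst p) \<alpha>"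
    then have "X \<beta> f = {}" unfolding X_def by blast
    then show "P \<beta> f = id" using pmX[of \<beta> f] by (simp add: good_def P_def)
  next
    fix p \<beta> f assume "p \<in> h" "\<beta> < lev (fst p)" "\<And>\<alpha>. \<alpha> < \<beta> \<Longrightarrow> f \<alpha> = lab (fst p) \<alpha>"
    then have "p \<in> X \<beta> f" by (simp add: X_def)
    then show "P \<beta> f (lab (fst p) \<beta>) = lab (snd p) \<beta>"
      using pmX[of \<beta> f] by (simp add: good_def P_def)
  qed (simp_all add: lev_eq P_def pm_aut)
  interpret bwd: relabelling h snd fst Q
  proof
    fix \<beta> and f f' :: "gam \<Rightarrow> vtx" assume "\<And>\<alpha>. \<alpha> < \<beta> \<Longrightarrow> f \<alpha> = f' \<alpha>"
    then have "Y \<beta> f = Y \<beta> f'" by (auto simp: Y_def)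
    then show "Q \<beta> f = Q \<beta> f'" by (simp add: Q_def)
  next
    fix \<beta> f assume "\<And>p. p \<in> h \<Longrightarrow> \<beta> < lev (snd p) \<Longrightarrow> \<exists>\<alpha><\<beta>. f \<alpha> \<noteq> lab (snd p) \<alpha>"
    then have "Y \<beta> f = {}" unfolding Y_def by blast
    then show "Q \<beta> f = id" using pmY[of \<beta> f] by (simp add: good_def Q_def)
  next
    fix p \<beta> f assume "p \<in> h" "\<beta> < lev (snd p)" "\<And>\<alpha>. \<alpha> < \<beta> \<Longrightarrow> f \<alpha> = lab (snd p) \<alpha>"
    then have "p \<in> Y \<beta> f" by (simp add: Y_def)
    then have "pm \<beta> (Y \<beta> f) (lab (fst p) \<beta>) = lab (snd p) \<beta>"
      using pmY[of \<beta> f] by (simp add: good_def)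
    then show "Q \<beta> f (lab (snd p) \<beta>) = lab (fst p) \<beta>"
      unfolding Q_def using inv_pm(1) by metis
  next
    fix \<beta> f a b
    show "adj (Q \<beta> f a) (Q \<beta> f b) \<longleftrightarrow> adj a b"
      unfolding Q_def using pm_aut(2)[of \<beta> "Y \<beta> f" "inv (pm \<beta> (Y \<beta> f)) a" "inv (pm \<beta> (Y \<beta> f)) b"]
      by (simp add: inv_pm)
  qed (simp_all add: lev_eq Q_def pm_aut bij_imp_bij_inv)
  have "X \<beta> (lab (bwd.act y)) = Y \<beta> (lab y)" if "\<beta> < lev y" for \<beta> y
    using bwd.twist_agree_iff[of _ \<beta> y] that lev_eq unfolding X_def Y_def by fastforce
  then have "fwd.act (bwd.act y) = y" for y
    by (auto simp: elt_eq_iff fun_eq_iff twist_def P_def Q_def inv_pm lab_beyond)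
  then have "surj fwd.act" by (metis surjI)
  moreover have "inj fwd.act"
  proof (rule injI)
    fix x y assume eq: "fwd.act x = fwd.act y"
    then have lt: "lev x = lev y" "tag x = tag y" using fwd.act by metis+
    have "delta x y = lev x"
      using fwd.delta_act[of x y] fwd.delta_act[of x x] eq by simp
    then have "lab x \<beta> = lab y \<beta>" for \<beta>
      using delta_agree[of \<beta> x y] lab_beyond[of x \<beta>] lab_beyond[of y \<beta>] lt
      by (cases "\<beta> < lev x") auto
    then show "x = y" using lt by (auto simp: elt_eq_iff)
  qed
  ultimately have "elt_aut fwd.act"
    by (simp add: elt_aut_def bij_def fwd.delta_act fwd.rel_act)
  then show ?thesis
    using fwd.delta_act fwd.act_u lev_eq by (intro exI[of _ fwd.act]) auto
qed

text \<open>Points on one node are distinguished only by their tags, which no relation sees.\<close>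

lemma retag_extends:
  assumes cnt: "countable h"
    and node: "\<And>p. p \<in> h \<Longrightarrow> lev (fst p) = lev (snd p) \<and> lab (fst p) = lab (snd p)"
    and eq: "\<And>p q. p \<in> h \<Longrightarrow> q \<in> h \<Longrightarrow> fst p = fst q \<longleftrightarrow> snd p = snd q"
  shows "\<exists>g. elt_aut g \<and> (\<forall>p\<in>h. g (fst p) = snd p)"
proof -
  define N where "N l f = {p \<in> h. lev (fst p) = l \<and> lab (fst p) = f}" for l f
  have "\<exists>\<tau>. bij \<tau> \<and> (\<forall>p\<in>N l f. \<tau> (tag (fst p)) = tag (snd p))" for l f
  proof -
    have "countable ((\<lambda>p. (tag (fst p), tag (snd p))) ` N l f)"
      using countable_subset[OF _ cnt, of "N l f"] by (auto simp: N_def)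
    moreover have "tag (fst p) = tag (fst q) \<longleftrightarrow> tag (snd p) = tag (snd q)"
      if "p \<in> N l f" "q \<in> N l f" for p q
      using eq[of p q] node[of p] node[of q] that by (auto simp: N_def elt_eq_iff)
    ultimately obtain \<tau> where "bij \<tau>"
        "\<forall>(x, y)\<in>(\<lambda>p. (tag (fst p), tag (snd p))) ` N l f. \<tau> x = y"
      using countable_partial_bijection_extends[OF uncountable_nat_sets,
          of "(\<lambda>p. (tag (fst p), tag (snd p))) ` N l f"] by blast
    then show ?thesis by (intro exI[of _ \<tau>]) auto
  qed
  then obtain \<tau> where \<tau>: "\<And>l f. bij (\<tau> l f)"
    "\<And>l f p. p \<in> N l f \<Longrightarrow> \<tau> l f (tag (fst p)) = tag (snd p)"
    by metis
  define g where "g x = mk_elt (lev x) (lab x) (\<tau> (lev x) (lab x) (tag x))" for x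
  define g' where "g' x = mk_elt (lev x) (lab x) (inv (\<tau> (lev x) (lab x)) (tag x))" for x
  have "g (g' x) = x" "g' (g x) = x" for x
    using \<tau>(1) by (simp_all add: g_def g'_def elt_eq_iff bij_is_inj bij_is_surj surj_f_inv_f)
  then have "bij g" by (metis bijI')
  moreover have d: "delta (g x) (g y) = delta x y" "rel (g x) (g y) \<longleftrightarrow> rel x y" for x y
    using rel_same_node[of "g x" x "g y"] rel_same_node[of "g y" y x]
    by (simp_all add: g_def delta_sym[of x] rel_sym[of x])
  moreover have "g (fst p) = snd p" if "p \<in> h" for p
    using \<tau>(2)[of p "lev (fst p)" "lab (fst p)"] node[OF that] that
    by (simp add: g_def elt_eq_iff N_def)
  ultimately show ?thesis by (intro exI[of _ g]) (auto simp: elt_aut_def)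
qed

text \<open>Three successive corrections: after shifting levels the remaining correspondence
  preserves \<open>delta\<close> exactly, after relabelling it preserves nodes, and retagging turns it
  into the identity.\<close>

theorem elt_homogeneous:
  assumes iso: "elt_iso h" and cnt: "countable h"
  shows "\<exists>g. elt_aut g \<and> (\<forall>p\<in>h. g (fst p) = snd p)"
proof -
  define hg where "hg = (\<lambda>(p, q). (delta (fst p) (fst q), delta (snd p) (snd q))) ` (h \<times> h)"
  have "countable hg" using cnt by (simp add: hg_def)
  moreover have "a < a' \<longleftrightarrow> b < b'" if "(a, b) \<in> hg" "(a', b') \<in> hg" for a b a' b'
    using that elt_isoD(3)[OF iso] by (auto simp: hg_def simp flip: not_le)
  ultimately obtain \<sigma> where \<sigma>: "bij \<sigma>" "\<And>x y. x < y \<longleftrightarrow> \<sigma> x < \<sigma> y" "\<forall>(a, b)\<in>hg. \<sigma> a = b"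
    using gam_homogeneous[of hg] by blast
  obtain g1 where g1: "elt_aut g1" "\<And>x y. delta (g1 x) (g1 y) = \<sigma> (delta x y)"
    using shift_levels[OF \<sigma>(1,2)] by blast
  have rel1: "rel (g1 x) (g1 y) \<longleftrightarrow> rel x y" for x y using g1(1) by (simp add: elt_aut_def)
  have inj1: "g1 x = g1 y \<longleftrightarrow> x = y" for x y
    using g1(1) by (auto simp: elt_aut_def bij_def inj_eq)
  define h1 where "h1 = (\<lambda>p. (g1 (fst p), snd p)) ` h"
  have "\<exists>g. elt_aut g \<and> (\<forall>x y. delta (g x) (g y) = delta x y) \<and>
     (\<forall>p\<in>h1. lev (g (fst p)) = lev (snd p) \<and> lab (g (fst p)) = lab (snd p))"
  proof (rule relabel_extends)
    show "countable h1" using cnt by (simp add: h1_def)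
  next
    fix p q assume "p \<in> h1" "q \<in> h1"
    then obtain p' q' where pq: "p' \<in> h" "p = (g1 (fst p'), snd p')" "q' \<in> h" "q = (g1 (fst q'), snd q')"
      by (auto simp: h1_def)
    then have "(delta (fst p') (fst q'), delta (snd p') (snd q')) \<in> hg" by (force simp: hg_def)
    then show "delta (fst p) (fst q) = delta (snd p) (snd q)" using \<sigma>(3) pq g1(2) by auto
    show "rel (fst p) (fst q) \<longleftrightarrow> rel (snd p) (snd q)"
      using elt_isoD(2)[OF iso, of p' q'] pq by (simp add: rel1)
  qed
  then obtain g2 where g2: "elt_aut g2"
      "\<And>p. p \<in> h1 \<Longrightarrow> lev (g2 (fst p)) = lev (snd p) \<and> lab (g2 (fst p)) = lab (snd p)"
    by blast
  have inj2: "g2 x = g2 y \<longleftrightarrow> x = y" for x y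
    using g2(1) by (auto simp: elt_aut_def bij_def inj_eq)
  define h2 where "h2 = (\<lambda>p. (g2 (g1 (fst p)), snd p)) ` h"
  have "\<exists>g. elt_aut g \<and> (\<forall>p\<in>h2. g (fst p) = snd p)"
  proof (rule retag_extends)
    show "countable h2" using cnt by (simp add: h2_def)
    show "lev (fst p) = lev (snd p) \<and> lab (fst p) = lab (snd p)" if "p \<in> h2" for p
      using that g2(2) by (force simp: h2_def h1_def)
    show "fst p = fst q \<longleftrightarrow> snd p = snd q" if "p \<in> h2" "q \<in> h2" for p q
      using that elt_isoD(1)[OF iso] by (auto simp: h2_def inj1 inj2)
  qed
  then obtain g3 where g3: "elt_aut g3" "\<And>p. p \<in> h2 \<Longrightarrow> g3 (fst p) = snd p" by blast
  have "(g3 \<circ> g2 \<circ> g1) (fst p) = snd p" if "p \<in> h" for p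
    using g3(2)[of "(g2 (g1 (fst p)), snd p)"] that by (simp add: h2_def)
  moreover have "elt_aut (g3 \<circ> g2 \<circ> g1)" using g1(1) g2(1) g3(1) by (intro elt_aut_comp)
  ultimately show ?thesis by blast
qed

subsection \<open>Limits of sequences\<close>

abbreviation decided :: "(nat \<Rightarrow> bool) \<Rightarrow> bool" where
  "decided P \<equiv> eventually P sequentially \<or> eventually (\<lambda>n. \<not> P n) sequentially"

lemma subsequence_decides:
  fixes a :: "nat \<Rightarrow> 'a" and \<P> :: "('a \<Rightarrow> bool) set"
  assumes "countable \<P>"
  shows "\<exists>r. strict_mono r \<and> (\<forall>P\<in>\<P>. decided (\<lambda>n. P (a (r n))))"
proof (cases "\<P> = {}")
  case True
  then show ?thesis by (intro exI[of _ id]) (auto simp: strict_mono_def)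
next
  case False
  define p where "p = from_nat_into \<P>"
  interpret subseqs "\<lambda>n s. \<forall>i j. p n (a (s i)) = p n (a (s j))"
  proof
    fix n and s :: "nat \<Rightarrow> nat" assume "strict_mono s"
    have "\<exists>S b. infinite S \<and> (\<forall>i\<in>S. p n (a (s i)) = b)"
    proof (cases "finite {i. p n (a (s i))}")
      case True
      then have "infinite {i. \<not> p n (a (s i))}"
        by (metis Collect_neg_eq finite_Collect_not infinite_UNIV_nat)
      then show ?thesis by blast
    next
      case False
      then show ?thesis by blast
    qed
    then obtain S b where S: "infinite S" "\<And>i. i \<in> S \<Longrightarrow> p n (a (s i)) = b" by blast
    then obtain r :: "nat \<Rightarrow> nat" where "strict_mono r" "\<And>i. r i \<in> S"
      using infinite_enumerate by blast
    then show "\<exists>r' :: nat \<Rightarrow> nat. strict_mono r' \<and> (\<forall>i j. p n (a ((s \<circ> r') i)) = p n (a ((s \<circ> r') j)))"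
      using S by (intro exI[of _ r]) auto
  qed
  have "decided (\<lambda>n. P (a (diagseq n)))" if P: "P \<in> \<P>" for P
  proof -
    obtain k where k: "P = p k"
      using from_nat_into_surj[OF assms P] by (auto simp: p_def)
    have const: "P (a (diagseq (Suc k + i))) = P (a (diagseq (Suc k + j)))" for i j
      using diagseq_holds[of k] by (simp add: k o_def)
    have "P (a (diagseq n)) = P (a (diagseq (Suc k)))" if "n \<ge> Suc k" for n
      using const[of "n - Suc k" 0] that by simp
    then show ?thesis
      by (cases "P (a (diagseq (Suc k)))")
        (auto intro: eventually_sequentiallyI[of "Suc k"])
  qed
  then show ?thesis using subseq_diagseq by blast
qed

lemma decided_iff:
  assumes "decided P"
  shows "\<not> eventually P sequentially \<longleftrightarrow> eventually (\<lambda>n. \<not> P n) sequentially"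
proof -
  have False if "eventually P sequentially" "eventually (\<lambda>n. \<not> P n) sequentially"
  proof -
    have "eventually (\<lambda>n. False) sequentially" using that by eventually_elim simp
    then show False by simp
  qed
  then show ?thesis using assms by blast
qed

text \<open>The limit point is assembled from its atomic relations to \<open>A\<close>. Its level
  \<open>gs\<close> and the parting levels \<open>g c\<close> exist by saturation of the order. Its
  labels copy those of \<open>c\<close> below \<open>g c\<close>; at a largest parting level smaller
  than \<open>gs\<close>, where nothing is left to copy, a new label with the prescribed adjacencies
  is taken from the graph. The ultrametric laws, inherited from the sequence, make these requirements
  consistent.\<close>

lemma limit_element:
  fixes a :: "nat \<Rightarrow> elt" and A :: "elt set"
  defines "u \<equiv> \<lambda>n k. case k of None \<Rightarrow> a n | Some c \<Rightarrow> c"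
  defines "I \<equiv> insert None (Some ` A)"
  assumes A: "countable A"
    and dec: "\<And>i j k l. i \<in> I \<Longrightarrow> j \<in> I \<Longrightarrow> k \<in> I \<Longrightarrow> l \<in> I \<Longrightarrow>
      decided (\<lambda>n. delta (u n i) (u n j) \<le> delta (u n k) (u n l))"
    and dec_rel: "\<And>c. c \<in> A \<Longrightarrow> decided (\<lambda>n. rel (a n) c)"
    and fresh: "\<And>c. c \<in> A \<Longrightarrow> eventually (\<lambda>n. a n \<noteq> c) sequentially"
  shows "\<exists>x. x \<notin> A \<and> (\<forall>c\<in>A. rel x c \<longleftrightarrow> eventually (\<lambda>n. rel (a n) c) sequentially) \<and>
    (let U = (\<lambda>k. case k of None \<Rightarrow> x | Some c \<Rightarrow> c) in
      \<forall>i\<in>I. \<forall>j\<in>I. \<forall>k\<in>I. \<forall>l\<in>I. delta (U i) (U j) \<le> delta (U k) (U l) \<longleftrightarrow>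
        eventually (\<lambda>n. delta (u n i) (u n j) \<le> delta (u n k) (u n l)) sequentially)"
proof -
  let ?E = "\<lambda>P. eventually P sequentially"
  define dn where "dn n p = delta (u n (fst p)) (u n (snd p))" for n and p :: "elt option \<times> elt option"
  define D where "D = I \<times> I"
  define C where "C = Some ` A \<times> Some ` A"
  \<comment> \<open>Only keys in \<open>D\<close> are decided by hypothesis; redirecting the others to one fixed
    key makes the preorder total.\<close>
  define nrm where "nrm p = (if p \<in> D then p else (None, None))" for p
  define t where "t p q \<longleftrightarrow> ?E (\<lambda>n. dn n (nrm p) \<le> dn n (nrm q))" for p q
  have nrm: "nrm p \<in> D" for p by (simp add: nrm_def D_def I_def)
  have decD: "decided (\<lambda>n. dn n p \<le> dn n q)" if "p \<in> D" "q \<in> D" for p q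
    using dec[of "fst p" "snd p" "fst q" "snd q"] that by (auto simp: D_def dn_def)
  have "\<exists>e'. (\<forall>k\<in>C. e' k = dn 0 k) \<and> (\<forall>k\<in>D. \<forall>l\<in>D. e' k \<le> e' l \<longleftrightarrow> t k l)"
  proof (rule gam_realizes_order)
    show "t p p" for p by (simp add: t_def)
    show "t p r" if "t p q" "t q r" for p q r
      using that unfolding t_def by eventually_elim auto
    show "t p q \<or> t q p" for p q
      using decD[OF nrm nrm, of p q] unfolding t_def
    proof
      assume "?E (\<lambda>n. \<not> dn n (nrm p) \<le> dn n (nrm q))"
      then have "?E (\<lambda>n. dn n (nrm q) \<le> dn n (nrm p))" by eventually_elim simp
      then show "?E (\<lambda>n. dn n (nrm p) \<le> dn n (nrm q)) \<or> ?E (\<lambda>n. dn n (nrm q) \<le> dn n (nrm p))" ..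
    qed (rule disjI1)
    show "C \<subseteq> D" by (auto simp: C_def D_def I_def)
    then show "dn 0 p \<le> dn 0 q \<longleftrightarrow> t p q" if "p \<in> C" "q \<in> C" for p q
    proof -
      have "(\<lambda>n. dn n p \<le> dn n q) = (\<lambda>_. dn 0 p \<le> dn 0 q)"
        using that by (auto simp: C_def dn_def u_def)
      moreover have "nrm p = p" "nrm q = q" using that \<open>C \<subseteq> D\<close> by (auto simp: nrm_def)
      ultimately show ?thesis by (simp add: t_def)
    qed
  qed (use A in \<open>auto simp: C_def D_def I_def\<close>)
  then obtain e where eC: "\<And>k. k \<in> C \<Longrightarrow> e k = dn 0 k"
    and eD: "\<And>k l. k \<in> D \<Longrightarrow> l \<in> D \<Longrightarrow> e k \<le> e l \<longleftrightarrow> t k l"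
    by blast
  have le: "e p \<le> e q \<longleftrightarrow> ?E (\<lambda>n. dn n p \<le> dn n q)" if "p \<in> D" "q \<in> D" for p q
    using eD[OF that] that by (simp add: t_def nrm_def)
  have less: "e p < e q \<longleftrightarrow> ?E (\<lambda>n. dn n p < dn n q)" if "p \<in> D" "q \<in> D" for p q
    using le[OF that(2,1)] decided_iff[OF decD[OF that(2,1)]] by (simp add: not_le flip: not_le[of "e q"])
  define g where "g c = e (None, Some c)" for c
  define gs where "gs = e (None, None)"
  define r where "r c \<longleftrightarrow> ?E (\<lambda>n. rel (a n) c)" for c
  have inD [simp]: "(None, None) \<in> D" "c \<in> A \<Longrightarrow> (None, Some c) \<in> D"
    "c \<in> A \<Longrightarrow> (Some c, None) \<in> D" "c \<in> A \<Longrightarrow> c' \<in> A \<Longrightarrow> (Some c, Some c') \<in> D" for c c'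
    by (auto simp: D_def I_def)
  have dn [simp]: "dn n (None, None) = lev (a n)" "dn n (None, Some c) = delta (a n) c"
    "dn n (Some c, None) = delta c (a n)" "dn n (Some c, Some c') = delta c c'" for n c c'
    by (simp_all add: dn_def u_def)
  have e_const: "e (Some c, Some c') = delta c c'" if "c \<in> A" "c' \<in> A" for c c'
    using eC[of "(Some c, Some c')"] that by (simp add: C_def)
  have g_gs: "g c \<le> gs" if "c \<in> A" for c
    using le[of "(None, Some c)" "(None, None)"] that by (simp add: g_def gs_def delta_le)
  have g_lev: "g c \<le> lev c" if "c \<in> A" for c
    using le[of "(None, Some c)" "(Some c, Some c)"] that
    by (simp add: g_def delta_le e_const)
  have g_sym: "e (Some c, None) = g c" if "c \<in> A" for c
    using le[of "(Some c, None)" "(None, Some c)"] le[of "(None, Some c)" "(Some c, None)"] that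
    by (simp add: g_def delta_sym[of c])
  have g_le: "g c \<le> delta c c'" if c: "c \<in> A" "c' \<in> A" and gg: "g c \<le> g c'" for c c'
  proof -
    have "?E (\<lambda>n. delta (a n) c \<le> delta (a n) c')"
      using le[of "(None, Some c)" "(None, Some c')"] c gg by (simp add: g_def)
    then have "?E (\<lambda>n. delta (a n) c \<le> delta c c')"
      by eventually_elim (rule delta_ultra[of _ c "a n" c' for n], auto simp: delta_sym)
    then show ?thesis
      using le[of "(None, Some c)" "(Some c, Some c')"] c by (simp add: g_def e_const)
  qed
  have g_eq: "delta c c' = g c \<and> (r c \<longleftrightarrow> rel c' c)" if c: "c \<in> A" "c' \<in> A" and gg: "g c < g c'" for c c'
  proof -
    have E: "?E (\<lambda>n. delta (a n) c < delta (a n) c')"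
      using less[of "(None, Some c)" "(None, Some c')"] c gg by (simp add: g_def)
    then have "?E (\<lambda>n. delta c c' \<le> delta (a n) c)"
    proof eventually_elim
      case (elim n)
      then show ?case using delta_eq_of_less[of c "a n" c'] by (simp add: delta_sym[of c "a n"])
    qed
    then have "delta c c' \<le> g c"
      using le[of "(Some c, Some c')" "(None, Some c)"] c by (simp add: g_def e_const)
    moreover have "?E (\<lambda>n. rel (a n) c = rel c' c)"
      using E
    proof eventually_elim
      case (elim n)
      then show ?case
        using rel_transfer[of c "a n" c'] by (simp add: delta_sym[of c "a n"] rel_sym[of _ c])
    qed
    then have "r c \<longleftrightarrow> rel c' c"
      unfolding r_def by (cases "rel c' c") (auto simp: decided_iff[OF dec_rel[OF c(1)]])
    ultimately show ?thesis using g_le[OF c] gg by simp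
  qed
  have r_eq: "r c \<longleftrightarrow> r c'" if c: "c \<in> A" "c' \<in> A" and gg: "g c < delta c c'" for c c'
  proof -
    have "?E (\<lambda>n. delta (a n) c < delta c c')"
      using less[of "(None, Some c)" "(Some c, Some c')"] c gg by (simp add: g_def e_const)
    then have E: "?E (\<lambda>n. rel (a n) c = rel (a n) c')"
      by eventually_elim (rule rel_transfer)
    show ?thesis
      unfolding r_def
    proof
      assume "?E (\<lambda>n. rel (a n) c)" with E show "?E (\<lambda>n. rel (a n) c')" by eventually_elim simp
    next
      assume "?E (\<lambda>n. rel (a n) c')" with E show "?E (\<lambda>n. rel (a n) c)" by eventually_elim simp
    qed
  qed
  have r_less: "g c < gs \<and> g c < lev c" if c: "c \<in> A" and "r c" for c
  proof
    have E: "?E (\<lambda>n. rel (a n) c)" using that by (simp add: r_def)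
    then have "?E (\<lambda>n. delta (a n) c < lev (a n))" by eventually_elim (rule rel_less)
    then show "g c < gs" using less[of "(None, Some c)" "(None, None)"] c by (simp add: g_def gs_def)
    from E have "?E (\<lambda>n. delta (a n) c < lev c)" by eventually_elim (rule rel_less)
    then show "g c < lev c"
      using less[of "(None, Some c)" "(Some c, Some c)"] c by (simp add: g_def e_const)
  qed
  have "\<exists>v. \<forall>c\<in>A. g c = \<beta> \<and> \<beta> < lev c \<longrightarrow> v \<noteq> lab c \<beta> \<and> (adj v (lab c \<beta>) \<longleftrightarrow> r c)" for \<beta>
  proof -
    define V where "V b = (\<lambda>c. lab c \<beta>) ` {c \<in> A. g c = \<beta> \<and> \<beta> < lev c \<and> (r c \<longleftrightarrow> b)}" for b
    have V: "countable (V b)" for b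
      unfolding V_def using A by (intro countable_image countable_subset[OF _ A]) auto
    have "V True \<inter> V False = {}"
    proof (rule ccontr)
      assume "V True \<inter> V False \<noteq> {}"
      then obtain c c' where c: "c \<in> A" "g c = \<beta>" "\<beta> < lev c" "r c"
        and c': "c' \<in> A" "g c' = \<beta>" "\<beta> < lev c'" "\<not> r c'" "lab c \<beta> = lab c' \<beta>"
        by (auto simp: V_def)
      have "\<beta> \<le> delta c c'" using g_le[of c c'] c c' by simp
      then have "\<beta> < delta c c'" using c c' by (auto simp: less_delta_iff le_delta_iff)
      then show False using r_eq[of c c'] c c' by simp
    qed
    then have "\<exists>v. v \<notin> V True \<union> V False \<and> (\<forall>c\<in>V True. adj v c) \<and> (\<forall>d\<in>V False. \<not> adj v d)"
      by (intro adj_extension V) (simp_all add: V)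
    then obtain v where v: "v \<notin> V True \<union> V False" "\<forall>c\<in>V True. adj v c" "\<forall>d\<in>V False. \<not> adj v d"
      by blast
    have "v \<noteq> lab c \<beta> \<and> (adj v (lab c \<beta>) \<longleftrightarrow> r c)" if "c \<in> A" "g c = \<beta> \<and> \<beta> < lev c" for c
      using that v by (cases "r c") (auto simp: V_def)
    then show ?thesis by blast
  qed
  then obtain s where s: "\<And>\<beta> c. c \<in> A \<Longrightarrow> g c = \<beta> \<Longrightarrow> \<beta> < lev c \<Longrightarrow>
      s \<beta> \<noteq> lab c \<beta> \<and> (adj (s \<beta>) (lab c \<beta>) \<longleftrightarrow> r c)"
    by metis
  define f where "f \<beta> = (if \<exists>c\<in>A. \<beta> < g c then lab (SOME c. c \<in> A \<and> \<beta> < g c) \<beta>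
     else if (\<exists>c\<in>A. \<beta> = g c) \<and> \<beta> < gs then s \<beta> else default_vtx)" for \<beta>
  have f_below: "f \<beta> = lab c \<beta>" if "c \<in> A" "\<beta> < g c" for \<beta> c
  proof -
    define c0 where "c0 = (SOME c. c \<in> A \<and> \<beta> < g c)"
    have c0: "c0 \<in> A" "\<beta> < g c0"
      unfolding c0_def using someI[of "\<lambda>c. c \<in> A \<and> \<beta> < g c" c] that by auto
    have "\<beta> < delta c0 c"
    proof (cases "g c0 \<le> g c")
      case True
      then show ?thesis using g_le[OF c0(1) that(1)] c0(2) by simp
    next
      case False
      then have "g c \<le> delta c0 c" using g_le[OF that(1) c0(1)] by (simp add: delta_sym[of c0])
      with that(2) show ?thesis by (rule less_le_trans)
    qed
    then have "lab c0 \<beta> = lab c \<beta>" by (rule delta_agree)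
    then show ?thesis using that unfolding f_def c0_def by auto
  qed
  have f_at: "f \<beta> = s \<beta>" if "c \<in> A" "g c = \<beta>" "\<beta> < gs" "\<not> (\<exists>c\<in>A. \<beta> < g c)" for \<beta> c
    using that by (auto simp: f_def)
  have ok: "ok_lab gs f"
    unfolding ok_lab_def
  proof (intro conjI allI impI)
    fix \<beta> assume "gs \<le> \<beta>"
    then have "\<not> (\<exists>c\<in>A. \<beta> < g c)" using g_gs by (meson leD le_less_trans)
    then show "f \<beta> = default_vtx" using \<open>gs \<le> \<beta>\<close> by (auto simp: f_def)
  next
    show "well_ordered_set {\<beta>. f \<beta> \<noteq> default_vtx}"
      unfolding well_ordered_set_def
    proof (intro allI impI)
      fix T assume T: "T \<subseteq> {\<beta>. f \<beta> \<noteq> default_vtx}" "T \<noteq> {}"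
      show "\<exists>m\<in>T. \<forall>t\<in>T. m \<le> t"
      proof (cases "\<exists>c\<in>A. T \<inter> {..<g c} \<noteq> {}")
        case True
        then obtain c where c: "c \<in> A" "T \<inter> {..<g c} \<noteq> {}" by blast
        then have "T \<inter> {..<g c} \<subseteq> {\<beta>. lab c \<beta> \<noteq> default_vtx}" using T f_below by auto
        then obtain m where m: "m \<in> T" "m < g c" "\<And>t. t \<in> T \<Longrightarrow> t < g c \<Longrightarrow> m \<le> t"
          using well_ordered_setD[OF well_ordered_support _ c(2)] by blast
        have "m \<le> t" if "t \<in> T" for t using m(2) m(3)[OF that] by (cases "t < g c") auto
        then show ?thesis using m(1) by blast
      next
        case False
        then have none: "\<not> t < g c" if "t \<in> T" "c \<in> A" for t c using that by auto
        have ex: "\<exists>c\<in>A. t = g c" if "t \<in> T" for t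
        proof -
          have "f t \<noteq> default_vtx" using T that by auto
          then show ?thesis using none[OF that] unfolding f_def by metis
        qed
        obtain m where "m \<in> T" using T by blast
        moreover have "m \<le> t" if "t \<in> T" for t
          using ex[OF \<open>m \<in> T\<close>] none[OF that] by (auto simp: not_less)
        ultimately show ?thesis by blast
      qed
    qed
  qed
  have "countable (tag ` A)" using A by simp
  then have "tag ` A \<noteq> UNIV" using uncountable_nat_sets by metis
  then obtain w where w: "w \<notin> tag ` A" by blast
  define x where "x = mk_elt gs f w"
  have x: "lev x = gs" "lab x = f" "tag x = w" using ok by (simp_all add: x_def)
  have xA: "x \<notin> A" using w x by auto
  have dx: "delta x c = g c" if c: "c \<in> A" for c
  proof (rule delta_eqI)
    show "g c \<le> lev x" "g c \<le> lev c" using g_gs g_lev c by (auto simp: x)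
    show "lab x \<alpha> = lab c \<alpha>" if "\<alpha> < g c" for \<alpha> using f_below c that by (simp add: x)
    assume lt: "g c < lev x" "g c < lev c"
    show "lab x (g c) \<noteq> lab c (g c)"
    proof (cases "\<exists>c'\<in>A. g c < g c'")
      case True
      then obtain c' where c': "c' \<in> A" "g c < g c'" by blast
      then have "delta c c' = g c" "g c < lev c'" using g_eq[OF c] g_lev[of c'] by auto
      then show ?thesis using delta_differ[of c c'] lt f_below[OF c'] by (simp add: x)
    next
      case False
      then show ?thesis using f_at[OF c refl] s[OF c refl] lt by (simp add: x)
    qed
  qed
  have rx: "rel x c \<longleftrightarrow> r c" if c: "c \<in> A" for c
  proof (cases "g c < gs \<and> g c < lev c")
    case False
    then show ?thesis using r_less[OF c] by (auto simp: rel_def dx[OF c] x)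
  next
    case lt: True
    show ?thesis
    proof (cases "\<exists>c'\<in>A. g c < g c'")
      case True
      then obtain c' where c': "c' \<in> A" "g c < g c'" by blast
      then have "delta c c' = g c" "g c < lev c'" "r c \<longleftrightarrow> rel c' c"
        using g_eq[OF c] g_lev[of c'] by auto
      then show ?thesis
        using lt f_below[OF c'] by (simp add: rel_def dx[OF c] x delta_sym[of c' c])
    next
      case False
      then show ?thesis using f_at[OF c refl] s[OF c refl] lt by (simp add: rel_def dx[OF c] x)
    qed
  qed
  define U where "U k = (case k of None \<Rightarrow> x | Some c \<Rightarrow> c)" for k
  have dU: "delta (U i) (U j) = e (i, j)" if "i \<in> I" "j \<in> I" for i j
    using that by (auto simp: I_def U_def x gs_def dx g_def e_const delta_sym[of _ x] g_sym[unfolded g_def])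
  have "delta (U i) (U j) \<le> delta (U k) (U l) \<longleftrightarrow>
        ?E (\<lambda>n. delta (u n i) (u n j) \<le> delta (u n k) (u n l))"
    if "i \<in> I" "j \<in> I" "k \<in> I" "l \<in> I" for i j k l
    using le[of "(i, j)" "(k, l)"] that by (simp add: dU dn_def D_def)
  then show ?thesis
    using xA rx unfolding r_def Let_def U_def by (intro exI[of _ x]) auto
qed


text \<open>Sequential compactness over countably many parameters: pass to a subsequence along which
  all atomic relations to \<open>A\<close> are eventually constant. Either it is eventually equal to a
  parameter, or \<open>limit_element\<close> applies.\<close>

theorem elt_compact:
  assumes A: "countable A"
  shows "\<exists>r x. strict_mono (r :: nat \<Rightarrow> nat) \<and> (\<forall>B. finite B \<longrightarrow> B \<subseteq> A \<longrightarrow>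
    eventually (\<lambda>n. elt_iso (insert (a (r n), x) (Id_on B))) sequentially)"
proof -
  define I where "I = insert None (Some ` A)"
  define v where "v y k = (case k of None \<Rightarrow> y | Some c \<Rightarrow> c)" for y :: elt and k
  define Ds where "Ds = (\<lambda>(i, j, k, l) y. delta (v y i) (v y j) \<le> delta (v y k) (v y l)) ` (I \<times> I \<times> I \<times> I)"
  define Rs where "Rs = (\<lambda>c y. rel y c) ` A"
  define Es where "Es = (\<lambda>c y. y = c) ` A"
  have "countable (Ds \<union> Rs \<union> Es)" using A by (simp add: Ds_def Rs_def Es_def I_def)
  from subsequence_decides[OF this] obtain r :: "nat \<Rightarrow> nat" where r: "strict_mono r"
    "\<And>P. P \<in> Ds \<union> Rs \<union> Es \<Longrightarrow> decided (\<lambda>n. P (a (r n)))"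
    by metis
  define b where "b n = a (r n)" for n
  have dec: "decided (\<lambda>n. delta (v (b n) i) (v (b n) j) \<le> delta (v (b n) k) (v (b n) l))"
    if "i \<in> I" "j \<in> I" "k \<in> I" "l \<in> I" for i j k l
  proof -
    have "(\<lambda>y. delta (v y i) (v y j) \<le> delta (v y k) (v y l)) \<in> Ds"
      unfolding Ds_def using that by force
    then show ?thesis using r(2) by (fastforce simp: b_def)
  qed
  have dec_rel: "decided (\<lambda>n. rel (b n) c)" if "c \<in> A" for c
    using r(2)[of "\<lambda>y. rel y c"] that by (simp add: b_def Rs_def)
  have dec_eq: "decided (\<lambda>n. b n = c)" if "c \<in> A" for c
    using r(2)[of "\<lambda>y. y = c"] that by (simp add: b_def Es_def)
  have "\<exists>x. \<forall>B. finite B \<longrightarrow> B \<subseteq> A \<longrightarrow>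
    eventually (\<lambda>n. elt_iso (insert (b n, x) (Id_on B))) sequentially"
  proof (cases "\<exists>c\<in>A. eventually (\<lambda>n. b n = c) sequentially")
    case True
    then obtain c where c: "eventually (\<lambda>n. b n = c) sequentially" by blast
    show ?thesis
    proof (intro exI[of _ c] allI impI)
      fix B
      show "eventually (\<lambda>n. elt_iso (insert (b n, c) (Id_on B))) sequentially"
        using c by eventually_elim (auto simp: elt_iso_def)
    qed
  next
    case False
    then have fresh: "eventually (\<lambda>n. b n \<noteq> c) sequentially" if "c \<in> A" for c
      using dec_eq[OF that] that by blast
    have "\<exists>x. x \<notin> A \<and> (\<forall>c\<in>A. rel x c \<longleftrightarrow> eventually (\<lambda>n. rel (b n) c) sequentially) \<and>
      (\<forall>i\<in>I. \<forall>j\<in>I. \<forall>k\<in>I. \<forall>l\<in>I. delta (v x i) (v x j) \<le> delta (v x k) (v x l) \<longleftrightarrow>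
        eventually (\<lambda>n. delta (v (b n) i) (v (b n) j) \<le> delta (v (b n) k) (v (b n) l)) sequentially)"
    proof (rule limit_element[OF A, of b, folded I_def v_def, unfolded Let_def])
      show "decided (\<lambda>n. delta (v (b n) i) (v (b n) j) \<le> delta (v (b n) k) (v (b n) l))"
        if "i \<in> I" "j \<in> I" "k \<in> I" "l \<in> I" for i j k l using that by (rule dec)
    qed (fact dec_rel fresh)+
    then obtain x where xA: "x \<notin> A"
      and xr: "\<And>c. c \<in> A \<Longrightarrow> rel x c \<longleftrightarrow> eventually (\<lambda>n. rel (b n) c) sequentially"
      and xd: "\<And>i j k l. i \<in> I \<Longrightarrow> j \<in> I \<Longrightarrow> k \<in> I \<Longrightarrow> l \<in> I \<Longrightarrow>
        delta (v x i) (v x j) \<le> delta (v x k) (v x l) \<longleftrightarrow>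
        eventually (\<lambda>n. delta (v (b n) i) (v (b n) j) \<le> delta (v (b n) k) (v (b n) l)) sequentially"
      by blast
    have same: "eventually (\<lambda>n. P n = b) sequentially" if "decided P" "b \<longleftrightarrow> eventually P sequentially" for P b
      using that decided_iff[OF that(1)] by (cases b) auto
    show ?thesis
    proof (intro exI[of _ x] allI impI)
      fix B assume B: "finite B" "B \<subseteq> A"
      define J where "J = insert None (Some ` B)"
      have J: "finite J" "J \<subseteq> I" using B by (auto simp: J_def I_def)
      have "eventually (\<lambda>n. \<forall>q\<in>J \<times> J \<times> J \<times> J. case q of (i, j, k, l) \<Rightarrow>
          (delta (v (b n) i) (v (b n) j) \<le> delta (v (b n) k) (v (b n) l)) =
          (delta (v x i) (v x j) \<le> delta (v x k) (v x l))) sequentially"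
      proof (rule eventually_ball_finite)
        show "finite (J \<times> J \<times> J \<times> J)" using J by simp
        show "\<forall>q\<in>J \<times> J \<times> J \<times> J. eventually (\<lambda>n. case q of (i, j, k, l) \<Rightarrow>
          (delta (v (b n) i) (v (b n) j) \<le> delta (v (b n) k) (v (b n) l)) =
          (delta (v x i) (v x j) \<le> delta (v x k) (v x l))) sequentially"
        proof clarify
          fix i j k l assume "i \<in> J" "j \<in> J" "k \<in> J" "l \<in> J"
          then have "i \<in> I" "j \<in> I" "k \<in> I" "l \<in> I" using J(2) by auto
          then show "eventually (\<lambda>n. (delta (v (b n) i) (v (b n) j) \<le> delta (v (b n) k) (v (b n) l)) =
            (delta (v x i) (v x j) \<le> delta (v x k) (v x l))) sequentially"
            by (intro same dec xd)
        qed
      qed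
      moreover have "eventually (\<lambda>n. \<forall>c\<in>B. rel (b n) c = rel x c) sequentially"
        using B by (intro eventually_ball_finite) (auto intro!: same dec_rel xr)
      moreover have "eventually (\<lambda>n. \<forall>c\<in>B. b n \<noteq> c) sequentially"
        using B by (intro eventually_ball_finite) (auto intro!: fresh)
      ultimately show "eventually (\<lambda>n. elt_iso (insert (b n, x) (Id_on B))) sequentially"
      proof eventually_elim
        case (elim n)
        define H where "H = insert (b n, x) (Id_on B)"
        have rep: "\<exists>k\<in>J. fst p = v (b n) k \<and> snd p = v x k" if "p \<in> H" for p
          using that by (auto simp: H_def J_def v_def)
        have "x \<notin> B" using xA B(2) by blast
        then have eB: "rel (b n) c = rel x c \<and> rel c (b n) = rel c x \<and> b n \<noteq> c \<and> c \<noteq> b n \<and> x \<noteq> c \<and> c \<noteq> x"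
          if "c \<in> B" for c
          using elim(2,3) that rel_sym[of c] by auto
        show ?case
          unfolding elt_iso_def H_def[symmetric]
        proof (intro conjI ballI)
          fix p q assume "p \<in> H" "q \<in> H"
          then show "fst p = fst q \<longleftrightarrow> snd p = snd q" "rel (fst p) (fst q) \<longleftrightarrow> rel (snd p) (snd q)"
            using eB by (auto simp: H_def)
        next
          fix p q s t assume "p \<in> H" "q \<in> H" "s \<in> H" "t \<in> H"
          then obtain i j k l where ijkl: "i \<in> J" "j \<in> J" "k \<in> J" "l \<in> J"
            and e: "fst p = v (b n) i" "snd p = v x i" "fst q = v (b n) j" "snd q = v x j"
              "fst s = v (b n) k" "snd s = v x k" "fst t = v (b n) l" "snd t = v x l"
            using rep by metis
          show "delta (fst p) (fst q) \<le> delta (fst s) (fst t) \<longleftrightarrow> delta (snd p) (snd q) \<le> delta (snd s) (snd t)"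
            using elim(1) ijkl unfolding e by blast
        qed
      qed
    qed
  qed
  then show ?thesis using r(1) unfolding b_def by blast
qed

subsection \<open>Special configurations\<close>

definition below :: "elt \<Rightarrow> elt \<Rightarrow> bool" where
  "below x y \<longleftrightarrow> delta x y = lev x \<and> lev x < lev y"

text \<open>Follow the common branch of \<open>C\<close> down to a level smaller than all parting
  levels.\<close>

lemma exists_below:
  assumes C: "countable C" "C \<noteq> {}"
  shows "\<exists>x. \<forall>c\<in>C. delta x c = lev x \<and> (\<forall>c'\<in>C. lev x < delta c c')"
proof -
  have "countable ((\<lambda>(c, c'). delta c c') ` (C \<times> C))" using C by simp
  then obtain \<gamma> where \<gamma>: "\<gamma> \<in> cut_fillers {} ((\<lambda>(c, c'). delta c c') ` (C \<times> C))"
    using cut_filler_exists[of "{}"] by blast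
  then have less: "\<gamma> < delta c c'" if "c \<in> C" "c' \<in> C" for c c'
    using that by (auto simp: cut_fillers_def)
  obtain c0 where c0: "c0 \<in> C" using C by blast
  have "ok_lab \<gamma> (\<lambda>\<beta>. if \<beta> < \<gamma> then lab c0 \<beta> else default_vtx)"
    unfolding ok_lab_def by (auto intro: well_ordered_set_subset[OF well_ordered_support[of c0]])
  then obtain x where x: "lev x = \<gamma>" "lab x = (\<lambda>\<beta>. if \<beta> < \<gamma> then lab c0 \<beta> else default_vtx)"
    using mk_elt by blast
  have "delta x c = \<gamma>" if "c \<in> C" for c
  proof (rule delta_eqI)
    show "\<gamma> \<le> lev c" using less[OF that that] by simp
    show "lab x \<alpha> = lab c \<alpha>" if "\<alpha> < \<gamma>" for \<alpha>
    proof -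
      have "\<alpha> < delta c0 c" using less[OF c0 \<open>c \<in> C\<close>] that by (rule less_trans[rotated])
      then show ?thesis using that by (simp add: x delta_agree)
    qed
  qed (simp_all add: x)
  then show ?thesis using less by (intro exI[of _ x]) (auto simp: x)
qed

text \<open>Points that leave a common node through distinct vertices: the extension property of the
  graph provides, for every set of indices, one further cone with that set of neighbours.\<close>

lemma independent_antichain:
  "\<exists>a :: nat \<Rightarrow> elt. \<forall>s. \<exists>y. \<forall>i. rel (a i) y \<longleftrightarrow> i \<in> s"
proof -
  have "inj (\<lambda>i. Vtx bot i)" by (auto intro: injI)
  then have "infinite (range (\<lambda>i. Vtx bot i))"
    using uncountable_infinite[OF uncountable_nat_sets] finite_imageD by blast
  then have "infinite (UNIV :: vtx set)" by (rule infinite_super[OF subset_UNIV])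
  then obtain v :: "nat \<Rightarrow> vtx" where v: "inj v" using infinite_countable_subset by blast
  obtain \<gamma>0 \<gamma>1 :: gam where lt: "\<gamma>0 < \<gamma>1"
    using cut_filler_exists[of "{undefined}" "{}"] by (auto simp: cut_fillers_def)
  have ok: "ok_lab \<gamma>1 (\<lambda>\<beta>. if \<beta> = \<gamma>0 then t else default_vtx)" for t
    unfolding ok_lab_def using lt by (auto simp: well_ordered_set_def)
  define el where "el t = mk_elt \<gamma>1 (\<lambda>\<beta>. if \<beta> = \<gamma>0 then t else default_vtx) {}" for t
  have el: "lev (el t) = \<gamma>1" "lab (el t) = (\<lambda>\<beta>. if \<beta> = \<gamma>0 then t else default_vtx)" for t
    unfolding el_def using ok by simp_all
  have rel: "rel (el t) (el t') \<longleftrightarrow> adj t t'" if "t \<noteq> t'" for t t'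
  proof -
    have "delta (el t) (el t') = \<gamma>0"
      by (rule delta_eqI) (use that lt in \<open>auto simp: el\<close>)
    then show ?thesis using lt by (simp add: rel_def el)
  qed
  have "\<exists>y. \<forall>i. rel (el (v i)) y \<longleftrightarrow> i \<in> s" for s
  proof -
    have "v ` s \<inter> v ` (- s) = {}" using v by (auto simp: inj_def)
    then obtain t where t: "t \<notin> range v" "\<forall>c\<in>v ` s. adj t c" "\<forall>d\<in>v ` (- s). \<not> adj t d"
      using adj_extension[of "v ` s" "v ` (- s)" "range v"] by auto
    have "rel (el (v i)) (el t) \<longleftrightarrow> i \<in> s" for i
      using t rel[of "v i" t] by (cases "i \<in> s") (auto simp: adj_sym)
    then show ?thesis by blast
  qed
  then show ?thesis by (intro exI[of _ "\<lambda>i. el (v i)"]) blast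
qed

section \<open>Coding by sets of sets of natural numbers\<close>

definition interleave :: "nat set \<Rightarrow> nat set \<Rightarrow> nat set" where
  "interleave a b = (\<lambda>n. 2 * n) ` a \<union> (\<lambda>n. Suc (2 * n)) ` b"

lemma interleave_eq_iff [simp]: "interleave a b = interleave a' b' \<longleftrightarrow> a = a' \<and> b = b'"
proof -
  have "{n. 2 * n \<in> interleave a b} = a" "{n. Suc (2 * n) \<in> interleave a b} = b" for a b
    by (auto simp: interleave_def) presburger+
  then show ?thesis by metis
qed

text \<open>A countable length is itself a set of natural numbers, and an enumeration of the
  positions below it turns the set of plus positions into another one.\<close>

lemma gam_codes: "\<exists>f :: gam \<Rightarrow> nat set. inj f"
proof -
  define f where "f x = interleave (Rep_omega1 (len x)) (to_nat_on {..<len x} ` {\<beta>. dig x \<beta> = 1})" for x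
  have "x = y" if "f x = f y" for x y
  proof -
    have len: "len x = len y" using that by (simp add: f_def Rep_omega1_inject)
    have im: "to_nat_on {..<len x} ` {\<beta>. dig x \<beta> = 1} = to_nat_on {..<len x} ` {\<beta>. dig y \<beta> = 1}"
      using that len by (simp add: f_def)
    have sub: "{\<beta>. dig z \<beta> = 1} \<subseteq> {..<len z}" for z
      by (auto simp: dig_def split: if_splits)
    have ones: "{\<beta>. dig x \<beta> = 1} = {\<beta>. dig y \<beta> = 1}"
      using inj_on_image_eq_iff[OF inj_on_to_nat_on[OF countable_below_omega1], of _ "len x"]
        im sub[of x] sub[of y] len by metis
    show ?thesis
    proof (rule gam_eqI)
      fix \<beta>
      have "dig x \<beta> = 1 \<longleftrightarrow> dig y \<beta> = 1" using ones by blast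
      then show "dig x \<beta> = dig y \<beta>"
        using dig_cases[of \<beta> x] dig_cases[of \<beta> y] len by (cases "\<beta> < len x") auto
    qed
  qed
  then show ?thesis by (auto intro!: exI[of _ f] injI)
qed

text \<open>The set of pairs records a chosen enumeration of the countable set; the flag separates
  the empty set from the singleton of the empty set.\<close>

definition code_cset :: "nat set cset \<Rightarrow> nat set" where
  "code_cset K = interleave (if rcset K = {} then {0} else {})
     {prod_encode (n, m) | n m. m \<in> from_nat_into (rcset K) n}"

lemma code_cset_inject: "code_cset K = code_cset K' \<Longrightarrow> K = K'"
proof -
  assume eq: "code_cset K = code_cset K'"
  then have E: "rcset K = {} \<longleftrightarrow> rcset K' = {}"
    by (simp add: code_cset_def split: if_splits)
  define A where "A K = {prod_encode (n, m) | n m. m \<in> from_nat_into (rcset K) n}" for K :: "nat set cset"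
  have "A K = A K'" using eq by (simp add: code_cset_def A_def)
  moreover have mem: "prod_encode (n, m) \<in> A K \<longleftrightarrow> m \<in> from_nat_into (rcset K) n" for n m K
    by (auto simp: A_def)
  ultimately have "m \<in> from_nat_into (rcset K) n \<longleftrightarrow> m \<in> from_nat_into (rcset K') n" for n m
    using mem[of n m K] mem[of n m K'] by simp
  then have "from_nat_into (rcset K) = from_nat_into (rcset K')" by (intro ext) blast
  then have fn: "from_nat_into (rcset K) = from_nat_into (rcset K')" .
  have "rcset K = rcset K'"
  proof (cases "rcset K = {}")
    case True
    then show ?thesis using E by simp
  next
    case False
    have "rcset K = range (from_nat_into (rcset K))"
      using range_from_nat_into[OF False] by simp
    also have "\<dots> = rcset K'"
      unfolding fn using False E by (intro range_from_nat_into) simp_all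
    finally show ?thesis .
  qed
  then show "K = K'" by (simp add: rcset_inject)
qed

primrec vtx_code :: "vtx \<Rightarrow> nat set" where
  "vtx_code (Vtx C i) = interleave i (code_cset (cimage vtx_code C))"

lemma vtx_code_inject: "vtx_code v = vtx_code v' \<Longrightarrow> v = v'"
proof (induction v arbitrary: v')
  case (Vtx C i)
  obtain C' i' where v': "v' = Vtx C' i'" by (cases v')
  have i: "i = i'" and "cimage vtx_code C = cimage vtx_code C'"
    using Vtx.prems v' code_cset_inject by auto
  then have im: "vtx_code ` rcset C = vtx_code ` rcset C'" by (metis cimage.rep_eq)
  have "rcset C = rcset C'"
  proof (intro equalityI subsetI)
    fix c assume c: "c \<in> rcset C"
    then obtain c' where "c' \<in> rcset C'" "vtx_code c = vtx_code c'" using im by blast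
    then show "c \<in> rcset C'" using Vtx.IH[OF c] by blast
  next
    fix c' assume "c' \<in> rcset C'"
    then obtain c where c: "c \<in> rcset C" "vtx_code c = vtx_code c'" using im by (metis imageE imageI)
    then show "c' \<in> rcset C" using Vtx.IH[OF c(1)] by blast
  qed
  then show ?case using i v' by (simp add: rcset_inject)
qed

text \<open>A labelling is a set of pairs of codes, hence a set of sets of natural numbers.\<close>

lemma elt_codes: "\<exists>f :: elt \<Rightarrow> nat set set. inj f"
proof -
  obtain eg :: "gam \<Rightarrow> nat set" where eg: "inj eg" using gam_codes by blast
  define f where "f x = insert (interleave {0} (interleave (eg (lev x)) (tag x)))
     (range (\<lambda>\<beta>. interleave {1} (interleave (eg \<beta>) (vtx_code (lab x \<beta>)))))" for x
  have "x = y" if eq: "f x = f y" for x y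
  proof -
    have "interleave {0} b \<in> f x \<longleftrightarrow> b = interleave (eg (lev x)) (tag x)" for b x by (auto simp: f_def)
    then have "interleave (eg (lev x)) (tag x) = interleave (eg (lev y)) (tag y)" using eq by metis
    then have 1: "lev x = lev y" "tag x = tag y" using eg by (auto simp: inj_eq)
    have "interleave {1} (interleave (eg \<beta>) d) \<in> f x \<longleftrightarrow> d = vtx_code (lab x \<beta>)" for \<beta> d x
      using eg by (auto simp: f_def inj_eq)
    then have "vtx_code (lab x \<beta>) = vtx_code (lab y \<beta>)" for \<beta> using eq by metis
    then have "lab x = lab y" using vtx_code_inject by blast
    then show ?thesis using 1 by (simp add: elt_eq_iff)
  qed
  then show ?thesis by (auto intro!: exI[of _ f] injI)
qed

definition code :: "elt \<Rightarrow> nat set set" where "code = (SOME f. inj f)"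

abbreviation decode :: "nat set set \<Rightarrow> elt" where "decode \<equiv> inv code"

lemma inj_code: "inj code"
  unfolding code_def using elt_codes by (rule someI_ex)

lemma decode_code [simp]: "decode (code x) = x"
  by (simp add: inj_code)

lemma code_decode [simp]: "a \<in> range code \<Longrightarrow> code (decode a) = a"
  by (rule f_inv_into_f)

section \<open>The tree as a monster model\<close>

text \<open>Relation \<open>0\<close> compares two values of \<open>delta\<close>, relation
  \<open>1\<close> is \<open>rel\<close>. With a comparison of arity four, meeting points need not be
  elements, and partial isomorphisms need not be closed under meets.\<close>

definition tree_lang :: "(nat, nat) language" where
  "tree_lang = \<lparr>Funs = {}, Rels = {0, 1}, farity = (\<lambda>_. 0), rarity = (\<lambda>R. if R = 0 then 4 else 2)\<rparr>"

definition tree_model :: "(nat, nat, nat set set) struct" where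
  "tree_model = \<lparr>carrier = range code, finterp = (\<lambda>_ _. undefined),
     rinterp = (\<lambda>R as. if R = 0
        then delta (decode (as ! 0)) (decode (as ! 1)) \<le> delta (decode (as ! 2)) (decode (as ! 3))
        else rel (decode (as ! 0)) (decode (as ! 1)))\<rparr>"

lemma tree_lang [simp]: "Funs tree_lang = {}" "Rels tree_lang = {0, 1}" "rarity tree_lang R = (if R = 0 then 4 else 2)"
  by (simp_all add: tree_lang_def)

lemma carrier_tree_model [simp]: "carrier tree_model = range code"
  by (simp add: tree_model_def)

lemma wf_trm_tree_lang: "wf_trm tree_lang t \<Longrightarrow> \<exists>v. t = Var v"
  by (cases t) auto

lemma val_cong: "(\<And>v. v \<in> fv_trm t \<Longrightarrow> e v = e' v) \<Longrightarrow> val M e t = val M e' t"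
proof (induction t)
  case (Fn f ts)
  then have "map (val M e) ts = map (val M e') ts" by auto
  then show ?case by (simp only: val.simps)
qed simp

lemma sat_cong: "(\<And>v. v \<in> fv \<phi> \<Longrightarrow> e v = e' v) \<Longrightarrow> sat M e \<phi> \<longleftrightarrow> sat M e' \<phi>"
proof (induction \<phi> arbitrary: e e')
  case (Eq s t)
  then show ?case using val_cong[of s e e' M] val_cong[of t e e' M] by simp
next
  case (Rel R ts)
  then have "map (val M e) ts = map (val M e') ts" by (auto intro!: val_cong)
  then show ?case by (simp only: sat.simps)
next
  case (Imp \<phi> \<psi>)
  from Imp.IH(1)[of e e'] Imp.IH(2)[of e e'] Imp.prems show ?case by simp
next
  case (All v \<phi>)
  have "sat M (e(v := a)) \<phi> \<longleftrightarrow> sat M (e'(v := a)) \<phi>" for a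
    using All.prems by (intro All.IH) auto
  then show ?case by simp
qed simp

lemma sat_aut:
  assumes g: "automorphism tree_lang M g"
  shows "wf_fm tree_lang \<phi> \<Longrightarrow> (\<And>v. v \<in> fv \<phi> \<Longrightarrow> e v \<in> carrier M) \<Longrightarrow>
    sat M (g \<circ> e) \<phi> \<longleftrightarrow> sat M e \<phi>"
proof (induction \<phi> arbitrary: e)
  case (Eq s t)
  from Eq.prems(1) have "wf_trm tree_lang s" "wf_trm tree_lang t" by simp_all
  then obtain v w where "s = Var v" "t = Var w" using wf_trm_tree_lang by meson
  moreover have "inj_on g (carrier M)" using g by (simp add: automorphism_def bij_betw_def)
  ultimately show ?case using Eq.prems(2) by (auto simp: inj_on_eq_iff)
next
  case (Rel R ts)
  have "\<exists>v. t = Var v" if "t \<in> set ts" for t using that Rel.prems(1) wf_trm_tree_lang by simp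
  then have v: "val M (g \<circ> e) t = g (val M e t)" "val M e t \<in> carrier M" if "t \<in> set ts" for t
    using that Rel.prems(2) by fastforce+
  then have m: "map (val M (g \<circ> e)) ts = map g (map (val M e) ts)" by simp
  have "map (val M e) ts \<in> tuples M (rarity tree_lang R)"
    using Rel.prems(1) v(2) unfolding tuples_def by (auto simp del: tree_lang(3))
  moreover have "R \<in> Rels tree_lang" using Rel.prems(1) by simp
  ultimately have "rinterp M R (map (val M e) ts) \<longleftrightarrow> rinterp M R (map g (map (val M e) ts))"
    using g unfolding automorphism_def by blast
  then show ?case by (simp only: sat.simps m)
next
  case (Imp \<phi> \<psi>)
  from Imp.IH(1)[of e] Imp.IH(2)[of e] Imp.prems show ?case by simp
next
  case (All v \<phi>)
  have bij: "bij_betw g (carrier M) (carrier M)" using g by (simp add: automorphism_def)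
  have "sat M ((g \<circ> e)(v := g a)) \<phi> \<longleftrightarrow> sat M (e(v := a)) \<phi>" if "a \<in> carrier M" for a
  proof -
    have eq: "(g \<circ> e)(v := g a) = g \<circ> e(v := a)" by auto
    show ?thesis
      unfolding eq by (rule All.IH) (use All.prems that in auto)
  qed
  then have "(\<forall>a\<in>carrier M. sat M ((g \<circ> e)(v := g a)) \<phi>) \<longleftrightarrow> (\<forall>a\<in>carrier M. sat M (e(v := a)) \<phi>)"
    by blast
  moreover have "(\<forall>a\<in>carrier M. sat M ((g \<circ> e)(v := g a)) \<phi>) \<longleftrightarrow>
      (\<forall>a\<in>g ` carrier M. sat M ((g \<circ> e)(v := a)) \<phi>)" by blast
  moreover have "g ` carrier M = carrier M" using bij by (simp add: bij_betw_def)
  ultimately show ?case by (simp only: sat.simps)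
qed simp

lemma holds_aut:
  assumes "automorphism tree_lang M g" "wf_fm tree_lang \<phi>" "fv \<phi> \<subseteq> {..<length a}" "set a \<subseteq> carrier M"
  shows "holds M \<phi> (map g a) \<longleftrightarrow> holds M \<phi> a"
proof -
  have "holds M \<phi> (map g a) \<longleftrightarrow> sat M (g \<circ> (!) a) \<phi>"
    unfolding holds_def using assms(3) by (intro sat_cong) auto
  also have "\<dots> \<longleftrightarrow> sat M ((!) a) \<phi>"
  proof (rule sat_aut[OF assms(1,2)])
    fix v assume "v \<in> fv \<phi>"
    then have "v < length a" using assms(3) by auto
    then show "a ! v \<in> carrier M" using assms(4) nth_mem by blast
  qed
  finally show ?thesis by (simp add: holds_def)
qed

lemma automorphism_tree_model:
  assumes g: "elt_aut g"
  shows "automorphism tree_lang tree_model (code \<circ> g \<circ> decode)"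
proof -
  have bij: "bij g" using g by (simp add: elt_aut_def)
  have "bij_betw (code \<circ> g \<circ> decode) (range code) (range code)"
  proof (rule bij_betw_byWitness[where f' = "code \<circ> inv g \<circ> decode"])
  qed (use bij in \<open>auto simp: bij_is_inj bij_is_surj surj_f_inv_f\<close>)
  moreover have "rinterp tree_model R a \<longleftrightarrow> rinterp tree_model R (map (code \<circ> g \<circ> decode) a)"
    if "a \<in> tuples tree_model (rarity tree_lang R)" for R a
  proof -
    have len: "length a = (if R = 0 then 4 else 2)" using that by (simp add: tuples_def)
    show ?thesis using g len by (auto simp: tree_model_def elt_aut_def)
  qed
  ultimately show ?thesis by (simp add: automorphism_def)
qed

text \<open>Homogeneity replaces quantifier elimination: corresponding tuples are conjugate.\<close>

lemma holds_iso:
  assumes h: "elt_iso h" "countable h"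
    and len: "length xs = length ys" and xy: "set (zip xs ys) \<subseteq> h"
    and \<phi>: "wf_fm tree_lang \<phi>" "fv \<phi> \<subseteq> {..<length xs}"
  shows "holds tree_model \<phi> (map code xs) \<longleftrightarrow> holds tree_model \<phi> (map code ys)"
proof -
  obtain g where g: "elt_aut g" "\<And>p. p \<in> h \<Longrightarrow> g (fst p) = snd p"
    using elt_homogeneous[OF h] by blast
  have "g (xs ! i) = ys ! i" if "i < length xs" for i
    using g(2)[of "(xs ! i, ys ! i)"] that len xy by (force simp: set_zip)
  then have "map g xs = ys" using len by (intro nth_equalityI) auto
  then have "map (code \<circ> g \<circ> decode) (map code xs) = map code ys" by (auto simp: comp_def)
  then show ?thesis
    using holds_aut[OF automorphism_tree_model[OF g(1)] \<phi>(1), of "map code xs"] \<phi>(2) by auto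
qed

lemma pholds_iso:
  assumes h: "elt_iso h" "countable h"
    and len: "length xs = length ys" and xy: "set (zip xs ys) \<subseteq> h"
    and cs: "length cs = length ds" and cd: "set (zip cs ds) \<subseteq> h"
    and \<phi>: "wf_fm tree_lang \<phi>" "fv \<phi> \<subseteq> {..<length xs + length cs}"
  shows "pholds tree_model (map code xs) (\<phi>, map code cs) \<longleftrightarrow> pholds tree_model (map code ys) (\<phi>, map code ds)"
  using holds_iso[OF h, of "xs @ cs" "ys @ ds" \<phi>] assms by (simp add: pholds_def)

lemma same_typeI:
  assumes h: "elt_iso h" "countable h"
    and len: "length xs = length ys" and xy: "set (zip xs ys) \<subseteq> h" and C: "Id_on C \<subseteq> h"
  shows "same_type tree_lang tree_model (code ` C) (map code xs) (map code ys)"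
  unfolding same_type_def
proof (intro conjI ballI)
  fix \<psi> :: "(nat, nat, nat set set) pfm"
  assume "\<psi> \<in> forms_over tree_lang (length (map code xs)) (code ` C)"
  then obtain \<phi> c where \<psi>: "\<psi> = (\<phi>, c)" "wf_fm tree_lang \<phi>" "fv \<phi> \<subseteq> {..<length xs + length c}" "set c \<subseteq> code ` C"
    by (auto simp: forms_over_def)
  then have c: "c = map code (map decode c)" "set (map decode c) \<subseteq> C"
    by (auto simp: map_idI intro!: nth_equalityI[of c] dest: nth_mem)
  have "set (zip (map decode c) (map decode c)) \<subseteq> h"
    using C c(2) by (auto simp: zip_same_conv_map)
  then show "pholds tree_model (map code xs) \<psi> \<longleftrightarrow> pholds tree_model (map code ys) \<psi>"
    using pholds_iso[OF h len xy refl, of "map decode c" \<phi>] \<psi> c(1) by simp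
qed (simp add: len)

text \<open>Atomic formulas express everything that a partial isomorphism has to preserve.\<close>

lemma iso_of_same_type:
  assumes st: "same_type tree_lang tree_model A (map code xs) (map code ys)"
  shows "length xs = length ys" "elt_iso (set (zip xs ys))"
proof -
  show len: "length xs = length ys" using st by (simp add: same_type_def)
  have eq: "holds tree_model \<phi> (map code xs) \<longleftrightarrow> holds tree_model \<phi> (map code ys)"
    if "wf_fm tree_lang \<phi>" "fv \<phi> \<subseteq> {..<length xs}" for \<phi>
  proof -
    have "(\<phi>, []) \<in> forms_over tree_lang (length (map code xs)) A" using that by (simp add: forms_over_def)
    then show ?thesis using st unfolding same_type_def by (force simp: pholds_def)
  qed
  have nth: "\<exists>i<length xs. fst p = xs ! i \<and> snd p = ys ! i" if "p \<in> set (zip xs ys)" for p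
    using that by (auto simp: set_zip)
  show "elt_iso (set (zip xs ys))"
    unfolding elt_iso_def
  proof (intro conjI ballI)
    fix p q assume "p \<in> set (zip xs ys)" "q \<in> set (zip xs ys)"
    then obtain i j where ij: "i < length xs" "j < length xs"
      and e: "fst p = xs ! i" "snd p = ys ! i" "fst q = xs ! j" "snd q = ys ! j"
      using nth by metis
    show "fst p = fst q \<longleftrightarrow> snd p = snd q"
      using eq[of "Eq (Var i) (Var j)"] ij len inj_code by (simp add: holds_def e inj_eq)
    show "rel (fst p) (fst q) \<longleftrightarrow> rel (snd p) (snd q)"
      using eq[of "Rel 1 [Var i, Var j]"] ij len by (simp add: holds_def e tree_model_def)
  next
    fix p q r s
    assume "p \<in> set (zip xs ys)" "q \<in> set (zip xs ys)" "r \<in> set (zip xs ys)" "s \<in> set (zip xs ys)"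
    then obtain i j k l where ij: "i < length xs" "j < length xs" "k < length xs" "l < length xs"
      and e: "fst p = xs ! i" "snd p = ys ! i" "fst q = xs ! j" "snd q = ys ! j"
        "fst r = xs ! k" "snd r = ys ! k" "fst s = xs ! l" "snd s = ys ! l"
      using nth by metis
    show "delta (fst p) (fst q) \<le> delta (fst r) (fst s) \<longleftrightarrow> delta (snd p) (snd q) \<le> delta (snd r) (snd s)"
      using eq[of "Rel 0 [Var i, Var j, Var k, Var l]"] ij len
      by (simp add: holds_def e tree_model_def numeral_eq_Suc)
  qed
qed

lemma code_list: "set a \<subseteq> range code \<Longrightarrow> \<exists>xs. a = map code xs"
  by (rule exI[of _ "map decode a"]) (auto simp: map_idI subset_iff)

instance trm :: (countable) countable by countable_datatype
instance fm :: (countable, countable) countable by countable_datatype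

text \<open>The first uncountable cardinal, transported along singletons to the type of the
  universe.\<close>

definition aleph1 :: "nat set set rel" where
  "aleph1 = dir_image (cardSuc natLeq) (\<lambda>x. {x})"

lemma aleph1_ordIso: "cardSuc natLeq =o aleph1"
  unfolding aleph1_def
  by (rule dir_image_ordIso) (auto simp: cardSuc_Well_order natLeq_Card_order inj_on_def)

lemma Card_order_aleph1: "Card_order aleph1"
  using Card_order_ordIso[OF cardSuc_Card_order[OF natLeq_Card_order] ordIso_symmetric[OF aleph1_ordIso]] .

lemma less_aleph1_iff: "|A| <o aleph1 \<longleftrightarrow> countable A"
proof -
  have "|A| <o aleph1 \<longleftrightarrow> |A| <o cardSuc natLeq"
    using ordLess_ordIso_trans[OF _ aleph1_ordIso] ordLess_ordIso_trans[OF _ ordIso_symmetric[OF aleph1_ordIso]]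
    by blast
  also have "\<dots> \<longleftrightarrow> |A| \<le>o natLeq"
    by (rule cardSuc_ordLeq_ordLess[OF natLeq_Card_order card_of_Card_order])
  finally show ?thesis by (simp add: countable_card_le_natLeq)
qed

lemma small_aleph1 [simp]: "small aleph1 A \<longleftrightarrow> countable A"
  by (simp add: small_def less_aleph1_iff)

lemma countable_Id_on [simp]: "countable C \<Longrightarrow> countable (Id_on C)"
  by (simp add: Id_on_def)

text \<open>A consistent type over a countable set is countable, so it is approximated by a sequence
  realizing ever larger finite parts. A limit point of the sequence is conjugate, over any finite set
  of the parameters, to late members of a subsequence, and therefore realizes the type.\<close>

lemma saturated_tree_model: "saturated aleph1 tree_lang tree_model"
  unfolding saturated_def
proof (intro allI impI)
  fix A \<Sigma>
  assume "A \<subseteq> carrier tree_model \<and> small aleph1 A \<and> partial_type tree_lang tree_model 1 A \<Sigma>"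
  then have A: "A \<subseteq> range code" "countable A" and \<Sigma>: "\<Sigma> \<subseteq> forms_over tree_lang 1 A" "consistent tree_model 1 \<Sigma>"
    by (auto simp: partial_type_def)
  have "\<Sigma> \<subseteq> UNIV \<times> lists A" using \<Sigma>(1) by (auto simp: forms_over_def)
  moreover have "countable (UNIV \<times> lists A :: (nat, nat, nat set set) pfm set)"
    using A(2) by (intro countable_SIGMA countable_lists) auto
  ultimately have c\<Sigma>: "countable \<Sigma>" by (rule countable_subset)
  show "\<exists>a. realizes tree_model 1 \<Sigma> a"
  proof (cases "\<Sigma> = {}")
    case True
    then show ?thesis
      by (intro exI[of _ "[code undefined]"]) (simp add: realizes_def tuples_def)
  next
    case False
    define \<psi> where "\<psi> = from_nat_into \<Sigma>"
    have r\<psi>: "range \<psi> = \<Sigma>" unfolding \<psi>_def by (rule range_from_nat_into[OF False c\<Sigma>])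
    have "\<exists>x. \<forall>k\<le>n. pholds tree_model [code x] (\<psi> k)" for n
    proof -
      have "\<psi> ` {..n} \<subseteq> \<Sigma>" using r\<psi> by blast
      then obtain a where a: "realizes tree_model 1 (\<psi> ` {..n}) a"
        using \<Sigma>(2) unfolding consistent_def by blast
      then obtain x where "a = [code x]"
        by (auto simp: realizes_def tuples_def length_Suc_conv)
      then show ?thesis using a by (auto simp: realizes_def)
    qed
    then obtain \<alpha> where \<alpha>: "\<And>n k. k \<le> n \<Longrightarrow> pholds tree_model [code (\<alpha> n)] (\<psi> k)" by metis
    obtain r x where r: "strict_mono (r :: nat \<Rightarrow> nat)"
      and x: "\<And>B. finite B \<Longrightarrow> B \<subseteq> decode ` A \<Longrightarrow>
        eventually (\<lambda>n. elt_iso (insert (\<alpha> (r n), x) (Id_on B))) sequentially"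
      using elt_compact[of "decode ` A" \<alpha>] A(2) by auto
    have "pholds tree_model [code x] (\<psi> k)" for k
    proof -
      have "\<psi> k \<in> forms_over tree_lang 1 A" using r\<psi> \<Sigma>(1) by blast
      then obtain \<phi> c where \<psi>k: "\<psi> k = (\<phi>, c)" "wf_fm tree_lang \<phi>" "fv \<phi> \<subseteq> {..<1 + length c}" "set c \<subseteq> A"
        by (auto simp: forms_over_def)
      then obtain xs where xs: "c = map code xs" using A(1) code_list by (meson order_trans)
      then have xsA: "set xs \<subseteq> decode ` A" using \<psi>k(4) by (force simp: image_iff)
      have "eventually (\<lambda>n. elt_iso (insert (\<alpha> (r n), x) (Id_on (set xs))) \<and> k \<le> n) sequentially"
        by (intro eventually_conj x xsA eventually_ge_at_top) simp
      then obtain n where n: "elt_iso (insert (\<alpha> (r n), x) (Id_on (set xs)))" "k \<le> n"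
        by (metis (mono_tags, lifting) eventually_happens' sequentially_bot)
      have "k \<le> r n" using n(2) seq_suble[OF r, of n] by simp
      moreover have "pholds tree_model (map code [\<alpha> (r n)]) (\<phi>, map code xs) \<longleftrightarrow>
          pholds tree_model (map code [x]) (\<phi>, map code xs)"
        by (rule pholds_iso[OF n(1)]) (use \<psi>k xs in \<open>auto simp: zip_same_conv_map simp: countable_finite\<close>)
      ultimately show ?thesis using \<alpha>[of k "r n"] \<psi>k(1) xs by simp
    qed
    then have "pholds tree_model [code x] \<psi>" if "\<psi> \<in> \<Sigma>" for \<psi> using that r\<psi> by auto
    then show ?thesis by (intro exI[of _ "[code x]"]) (simp add: realizes_def tuples_def)
  qed
qed

lemma strongly_homogeneous_tree_model: "strongly_homogeneous aleph1 tree_lang tree_model"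
  unfolding strongly_homogeneous_def
proof (intro allI impI)
  fix A h assume "small aleph1 A \<and> partial_elementary tree_lang tree_model A h"
  then have cA: "countable A" and A: "A \<subseteq> range code" "h ` A \<subseteq> range code"
    and el: "\<And>a. set a \<subseteq> A \<Longrightarrow> same_type tree_lang tree_model {} a (map h a)"
    by (auto simp: partial_elementary_def)
  define H where "H = (\<lambda>a. (decode a, decode (h a))) ` A"
  have zip_iso: "elt_iso (set (zip (map decode a) (map (decode \<circ> h) a)))" if "set a \<subseteq> A" for a
  proof (rule iso_of_same_type)
    have m: "map code (map decode a) = a" "map code (map (decode \<circ> h) a) = map h a"
      using that A by (auto simp: map_idI subset_iff image_subset_iff)
    show "same_type tree_lang tree_model {} (map code (map decode a)) (map code (map (decode \<circ> h) a))"
      unfolding m using el[OF that] .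
  qed
  have iso: "elt_iso ((\<lambda>a. (decode a, decode (h a))) ` S)" if S: "finite S" "S \<subseteq> A" for S
  proof -
    obtain a where a: "S = set a" using finite_list[OF S(1)] by blast
    have "set (zip (map decode a) (map (decode \<circ> h) a)) = (\<lambda>a. (decode a, decode (h a))) ` set a"
      by (auto simp: zip_map_map zip_same_conv_map)
    then show ?thesis using zip_iso[of a] S(2) a by simp
  qed
  have "elt_iso H"
    unfolding elt_iso_def
  proof (intro conjI ballI)
    fix p q assume "p \<in> H" "q \<in> H"
    then obtain a b where "a \<in> A" "b \<in> A" "p = (decode a, decode (h a))" "q = (decode b, decode (h b))"
      by (auto simp: H_def)
    then show "fst p = fst q \<longleftrightarrow> snd p = snd q" "rel (fst p) (fst q) \<longleftrightarrow> rel (snd p) (snd q)"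
      using elt_isoD(1,2)[OF iso[of "{a, b}"], of p q] by auto
  next
    fix p q r s assume "p \<in> H" "q \<in> H" "r \<in> H" "s \<in> H"
    then obtain a b c d where "a \<in> A" "b \<in> A" "c \<in> A" "d \<in> A"
      "p = (decode a, decode (h a))" "q = (decode b, decode (h b))"
      "r = (decode c, decode (h c))" "s = (decode d, decode (h d))"
      by (auto simp: H_def)
    then show "delta (fst p) (fst q) \<le> delta (fst r) (fst s) \<longleftrightarrow> delta (snd p) (snd q) \<le> delta (snd r) (snd s)"
      using elt_isoD(3)[OF iso[of "{a, b, c, d}"], of p q r s] by auto
  qed
  moreover have "countable H" using cA by (simp add: H_def)
  ultimately obtain g where g: "elt_aut g" "\<And>p. p \<in> H \<Longrightarrow> g (fst p) = snd p"
    using elt_homogeneous by metis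
  have "(code \<circ> g \<circ> decode) a = h a" if "a \<in> A" for a
    using g(2)[of "(decode a, decode (h a))"] that A by (auto simp: H_def image_subset_iff)
  then show "\<exists>g. automorphism tree_lang tree_model g \<and> (\<forall>a\<in>A. g a = h a)"
    using automorphism_tree_model[OF g(1)] by blast
qed

definition tree_theory :: "(nat, nat) fm set" where
  "tree_theory = {\<sigma> \<in> sentences tree_lang. holds tree_model \<sigma> []}"

lemma models_tree_model: "models tree_lang tree_model tree_theory"
  by (simp add: models_def is_struct_def tree_theory_def)

lemma complete_tree_theory: "complete_theory TYPE(nat set set) tree_lang tree_theory"
  unfolding complete_theory_def
proof (intro conjI ballI)
  fix \<sigma> assume \<sigma>: "\<sigma> \<in> sentences tree_lang"
  have "holds tree_model \<sigma> [] \<or> holds tree_model (Neg \<sigma>) []" by (auto simp: holds_def)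
  moreover have "Neg \<sigma> \<in> sentences tree_lang" using \<sigma> by (simp add: sentences_def)
  ultimately have "\<sigma> \<in> tree_theory \<or> Neg \<sigma> \<in> tree_theory" using \<sigma> by (auto simp: tree_theory_def)
  then show "(\<forall>M :: (nat, nat, nat set set) struct. models tree_lang M tree_theory \<longrightarrow> holds M \<sigma> []) \<or>
      (\<forall>M :: (nat, nat, nat set set) struct. models tree_lang M tree_theory \<longrightarrow> holds M (Neg \<sigma>) [])"
    unfolding models_def by blast
qed (use models_tree_model in \<open>auto simp: tree_theory_def\<close>)

lemma monster_tree_model: "monster_model aleph1 tree_lang tree_theory tree_model"
  by (simp add: monster_model_def models_tree_model Card_order_aleph1 less_aleph1_iff saturated_tree_model
      strongly_homogeneous_tree_model)

section \<open>The type of a node below a point\<close>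

lemma elt_iso_single: "elt_iso {(x, y)}"
  by (simp add: elt_iso_def)

text \<open>A point below all parting levels of \<open>h\<close> stands in a fixed atomic relation
  to \<open>h\<close>.\<close>

lemma elt_iso_insert_under:
  assumes h: "elt_iso h"
    and a: "\<And>p. p \<in> h \<Longrightarrow> delta a (fst p) = lev a" "\<And>p q. p \<in> h \<Longrightarrow> q \<in> h \<Longrightarrow> lev a < delta (fst p) (fst q)"
    and a': "\<And>p. p \<in> h \<Longrightarrow> delta a' (snd p) = lev a'" "\<And>p q. p \<in> h \<Longrightarrow> q \<in> h \<Longrightarrow> lev a' < delta (snd p) (snd q)"
  shows "elt_iso (insert (a, a') h)"
proof -
  have d [simp]: "delta a (fst p) = lev a" "delta (fst p) a = lev a"
    "delta a' (snd p) = lev a'" "delta (snd p) a' = lev a'" if "p \<in> h" for p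
    using a(1) a'(1) that delta_sym by metis+
  have lt [simp]: "lev a \<le> delta (fst p) (fst q)" "\<not> delta (fst p) (fst q) \<le> lev a"
    "lev a' \<le> delta (snd p) (snd q)" "\<not> delta (snd p) (snd q) \<le> lev a'" if "p \<in> h" "q \<in> h" for p q
    using a(2)[OF that] a'(2)[OF that] by auto
  have ne [simp]: "a \<noteq> fst p" "fst p \<noteq> a" "a' \<noteq> snd p" "snd p \<noteq> a'" if "p \<in> h" for p
    using a(2)[OF that that] a'(2)[OF that that] by auto
  have nr [simp]: "\<not> rel a (fst p)" "\<not> rel (fst p) a" "\<not> rel a' (snd p)" "\<not> rel (snd p) a'" if "p \<in> h" for p
    using that by (auto simp: rel_def)
  show ?thesis
    unfolding elt_iso_def
  proof (intro conjI ballI)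
    fix p q assume "p \<in> insert (a, a') h" "q \<in> insert (a, a') h"
    then show "fst p = fst q \<longleftrightarrow> snd p = snd q" "rel (fst p) (fst q) \<longleftrightarrow> rel (snd p) (snd q)"
      using elt_isoD(1,2)[OF h, of p q] by auto
  next
    fix p q r s
    assume "p \<in> insert (a, a') h" "q \<in> insert (a, a') h" "r \<in> insert (a, a') h" "s \<in> insert (a, a') h"
    then show "delta (fst p) (fst q) \<le> delta (fst r) (fst s) \<longleftrightarrow> delta (snd p) (snd q) \<le> delta (snd r) (snd s)"
      using elt_isoD(3)[OF h, of p q r s]
      by (elim insertE; simp)
  qed
qed

lemma elt_iso_same_node:
  assumes node: "\<And>p. p \<in> h \<Longrightarrow> lev (fst p) = lev (snd p) \<and> lab (fst p) = lab (snd p)"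
    and eq: "\<And>p q. p \<in> h \<Longrightarrow> q \<in> h \<Longrightarrow> fst p = fst q \<longleftrightarrow> snd p = snd q"
  shows "elt_iso h"
proof -
  have "delta (fst p) (fst q) = delta (snd p) (snd q) \<and> (rel (fst p) (fst q) \<longleftrightarrow> rel (snd p) (snd q))"
    if "p \<in> h" "q \<in> h" for p q
    using rel_same_node[of "fst p" "snd p" "fst q"] rel_same_node[of "fst q" "snd q" "snd p"]
      node[OF that(1)] node[OF that(2)] delta_sym rel_sym by metis
  then show ?thesis using eq by (auto simp: elt_iso_def)
qed

text \<open>For a point \<open>x\<close> below \<open>b\<close>, \<open>delta x y\<close> is the
  smaller of \<open>lev x\<close> and \<open>delta b y\<close>, and \<open>rel x y\<close> is
  \<open>rel b y\<close> restricted to \<open>delta b y < lev x\<close>. So only the position of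
  \<open>lev x\<close> relative to the parting levels of \<open>Y\<close> matters.\<close>

lemma elt_iso_below_interval:
  assumes b: "b \<in> Y" and a: "below a b" "below a' b" and aY: "a \<notin> Y" "a' \<notin> Y"
    and sep: "\<And>u v. u \<in> Y \<Longrightarrow> v \<in> Y \<Longrightarrow> (lev a < delta u v \<longleftrightarrow> lev a' < delta u v) \<and>
      (lev a \<le> delta u v \<longleftrightarrow> lev a' \<le> delta u v)"
  shows "elt_iso (insert (a, a') (Id_on Y))"
proof -
  define \<Theta> where "\<Theta> = {delta u v | u v. u \<in> Y \<and> v \<in> Y}"
  define F where "F \<alpha> f l = (if f then min \<alpha> l else l)" for \<alpha> :: gam and f l
  have sep': "(lev a < l \<longleftrightarrow> lev a' < l) \<and> (lev a \<le> l \<longleftrightarrow> lev a' \<le> l)" if "l \<in> \<Theta>" for l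
    using sep that by (auto simp: \<Theta>_def)
  have F: "F (lev a) f l \<le> F (lev a) f' l' \<longleftrightarrow> F (lev a') f l \<le> F (lev a') f' l'"
    if "l \<in> \<Theta>" "l' \<in> \<Theta>" for f f' l l'
    using sep'[OF that(1)] sep'[OF that(2)]
    by (cases f; cases f') (auto simp: F_def min_def not_le not_less split: if_splits)
  have dmin: "delta x y = min (lev x) (delta b y)" if x: "below x b" for x y
  proof (rule order_antisym)
    have "delta x b = lev x" using x by (simp add: below_def)
    then show "delta x y \<le> min (lev x) (delta b y)"
      using delta_ultra[of "delta x y" b x y] delta_le[of x y] by (simp add: delta_sym[of b x])
    show "min (lev x) (delta b y) \<le> delta x y"
      using \<open>delta x b = lev x\<close> by (intro delta_ultra[of _ x b y]) auto
  qed
  have relb: "rel x y \<longleftrightarrow> delta b y < lev x \<and> rel b y" if x: "below x b" for x y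
  proof (cases "delta b y < lev x")
    case True
    then have "delta y b < delta b x" using x by (simp add: below_def delta_sym[of b x] delta_sym[of y b])
    then show ?thesis using rel_transfer[of y b x] True by (simp add: rel_sym[of _ y])
  next
    case False
    then have "delta x y = lev x" using dmin[OF x, of y] by (simp add: not_less min_absorb1)
    then show ?thesis using False by (simp add: rel_def)
  qed
  \<comment> \<open>Every parting level has the form \<open>min \<alpha> l\<close> or \<open>l\<close>, where
    \<alpha> is the level of the new point. The level of the new point itself is \<open>min
    \<alpha> (lev b)\<close>.\<close>
  have key: "\<exists>f. \<exists>l\<in>\<Theta>. delta (fst p) (fst q) = F (lev a) f l \<and> delta (snd p) (snd q) = F (lev a') f l"
    if pq: "p \<in> insert (a, a') (Id_on Y)" "q \<in> insert (a, a') (Id_on Y)" for p q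
  proof -
    have in_\<Theta>: "delta b y \<in> \<Theta>" if "y \<in> Y" for y using that b by (auto simp: \<Theta>_def)
    have "lev a < lev b" "lev a' < lev b" using a by (auto simp: below_def)
    then have self: "lev a = F (lev a) True (delta b b)" "lev a' = F (lev a') True (delta b b)"
      by (auto simp: F_def min_def)
    have mixed: "delta a y = F (lev a) True (delta b y)" "delta a' y = F (lev a') True (delta b y)"
      "delta y a = F (lev a) True (delta b y)" "delta y a' = F (lev a') True (delta b y)" for y
      using dmin[OF a(1), of y] dmin[OF a(2), of y] delta_sym[of y a] delta_sym[of y a']
      by (simp_all add: F_def)
    from pq consider "p = (a, a')" "q = (a, a')" | y where "y \<in> Y" "p = (a, a')" "q = (y, y)"
      | y where "y \<in> Y" "p = (y, y)" "q = (a, a')" | y z where "y \<in> Y" "z \<in> Y" "p = (y, y)" "q = (z, z)"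
      unfolding Id_on_def by blast
    then show ?thesis
    proof cases
      case 1
      then show ?thesis
        using self in_\<Theta>[OF b] by (intro exI[of _ True] bexI[of _ "delta b b"]) simp_all
    next
      case (2 y)
      then show ?thesis
        using mixed in_\<Theta>[of y] by (intro exI[of _ True] bexI[of _ "delta b y"]) simp_all
    next
      case (3 y)
      then show ?thesis
        using mixed in_\<Theta>[of y] by (intro exI[of _ True] bexI[of _ "delta b y"]) simp_all
    next
      case (4 y z)
      then show ?thesis by (intro exI[of _ False] bexI[of _ "delta y z"]) (auto simp: F_def \<Theta>_def)
    qed
  qed
  have ra: "rel a y \<longleftrightarrow> rel a' y" "rel y a \<longleftrightarrow> rel y a'" if "y \<in> Y" for y
  proof -
    have "delta b y < lev a \<longleftrightarrow> delta b y < lev a'" using sep[OF b that] by (auto simp flip: not_le)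
    then show "rel a y \<longleftrightarrow> rel a' y" using relb[OF a(1)] relb[OF a(2)] by simp
    then show "rel y a \<longleftrightarrow> rel y a'" by (simp add: rel_sym[of y])
  qed
  show ?thesis
    unfolding elt_iso_def
  proof (intro conjI ballI)
    fix p q assume "p \<in> insert (a, a') (Id_on Y)" "q \<in> insert (a, a') (Id_on Y)"
    then show "fst p = fst q \<longleftrightarrow> snd p = snd q" "rel (fst p) (fst q) \<longleftrightarrow> rel (snd p) (snd q)"
      using aY ra by auto
  next
    fix p q r s
    assume pq: "p \<in> insert (a, a') (Id_on Y)" "q \<in> insert (a, a') (Id_on Y)"
      and rs: "r \<in> insert (a, a') (Id_on Y)" "s \<in> insert (a, a') (Id_on Y)"
    from key[OF pq] key[OF rs] obtain f l f' l' where l: "l \<in> \<Theta>" "l' \<in> \<Theta>"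
      and d: "delta (fst p) (fst q) = F (lev a) f l" "delta (snd p) (snd q) = F (lev a') f l"
        "delta (fst r) (fst s) = F (lev a) f' l'" "delta (snd r) (snd s) = F (lev a') f' l'"
      by blast
    show "delta (fst p) (fst q) \<le> delta (fst r) (fst s) \<longleftrightarrow> delta (snd p) (snd q) \<le> delta (snd r) (snd s)"
      unfolding d by (rule F[OF l])
  qed
qed

text \<open>The type over \<open>b\<close> of a point \<open>a\<close>; it is used for
  \<open>a\<close> strictly below \<open>b\<close>.\<close>

definition low_type :: "elt \<Rightarrow> elt \<Rightarrow> (nat, nat, nat set set) pfm set" where
  "low_type b a = {\<psi> \<in> forms_over tree_lang 1 {code b}. pholds tree_model [code a] \<psi>}"

lemma realizes_low_type:
  assumes ab: "below a b"
  shows "realizes tree_model 1 (low_type b a) s \<longleftrightarrow> (\<exists>x. s = [code x] \<and> below x b)"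
proof
  assume s: "realizes tree_model 1 (low_type b a) s"
  then obtain x where x: "s = [code x]"
    by (auto simp: realizes_def tuples_def length_Suc_conv)
  have "(Rel 0 [Var 0, Var 0, Var 0, Var 1], [code b]) \<in> low_type b a"
    "(Neg (Rel 0 [Var 1, Var 1, Var 0, Var 0]), [code b]) \<in> low_type b a"
    using ab by (auto simp: low_type_def forms_over_def pholds_def holds_def tree_model_def below_def numeral_eq_Suc)
  then have "pholds tree_model s (Rel 0 [Var 0, Var 0, Var 0, Var 1], [code b])"
    "pholds tree_model s (Neg (Rel 0 [Var 1, Var 1, Var 0, Var 0]), [code b])"
    using s by (auto simp: realizes_def)
  then have "lev x \<le> delta x b" "lev x < lev b"
    by (auto simp: x pholds_def holds_def tree_model_def numeral_eq_Suc)
  then show "\<exists>x. s = [code x] \<and> below x b"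
    using x delta_le(1)[of x b] by (auto simp: below_def)
next
  assume "\<exists>x. s = [code x] \<and> below x b"
  then obtain x where x: "s = [code x]" "below x b" by blast
  have iso: "elt_iso (insert (a, x) {(b, b)})"
    by (rule elt_iso_insert_under[OF elt_iso_single]) (use ab x(2) in \<open>auto simp: below_def\<close>)
  have "same_type tree_lang tree_model (code ` {b}) (map code [a]) (map code [x])"
    by (rule same_typeI[OF iso]) auto
  then show "realizes tree_model 1 (low_type b a) s"
    by (auto simp: realizes_def tuples_def x(1) low_type_def same_type_def)
qed

lemma low_type_in_type_space: "low_type b a \<in> type_space tree_lang tree_model 1 {code b}"
proof -
  have "realizes tree_model 1 (low_type b a) [code a]"
    by (auto simp: realizes_def tuples_def low_type_def)
  then have "consistent tree_model 1 (low_type b a)"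
    unfolding consistent_def realizes_def by blast
  then show ?thesis
    by (auto simp: type_space_def partial_type_def low_type_def forms_over_def pholds_def holds_def)
qed

text \<open>By homogeneity all points have the same type over the empty set, so any shattered
  sequence is one of realizations.\<close>

lemma IP_low_type_restrict: "IP tree_lang tree_model 1 (restrict_type tree_lang 1 {} (low_type b a))"
proof -
  obtain \<alpha> :: "nat \<Rightarrow> elt" where \<alpha>: "\<And>s. \<exists>y. \<forall>i. rel (\<alpha> i) y \<longleftrightarrow> i \<in> s"
    using independent_antichain by blast
  have real: "realizes tree_model 1 (restrict_type tree_lang 1 {} (low_type b a)) [code x]" for x
  proof -
    have "same_type tree_lang tree_model (code ` {}) (map code [a]) (map code [x])"
      by (rule same_typeI[OF elt_iso_single]) auto
    then show ?thesis
      by (auto simp: realizes_def tuples_def restrict_type_def low_type_def same_type_def)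
  qed
  let ?\<phi> = "Rel 1 [Var 1, Var 0] :: (nat, nat) fm"
  have "consistent tree_model 1 ({(?\<phi>, [code (\<alpha> i)]) | i. i \<in> s} \<union> {(Neg ?\<phi>, [code (\<alpha> i)]) | i. i \<notin> s})" for s
  proof -
    obtain y where y: "\<And>i. rel (\<alpha> i) y \<longleftrightarrow> i \<in> s" using \<alpha> by blast
    have "realizes tree_model 1 ({(?\<phi>, [code (\<alpha> i)]) | i. i \<in> s} \<union> {(Neg ?\<phi>, [code (\<alpha> i)]) | i. i \<notin> s}) [code y]"
      using y by (auto simp: realizes_def tuples_def pholds_def holds_def tree_model_def)
    then show ?thesis unfolding consistent_def realizes_def by blast
  qed
  then show ?thesis
    unfolding IP_def using real
    by (intro exI[of _ ?\<phi>] exI[of _ 1] exI[of _ "\<lambda>i. [code (\<alpha> i)]"]) auto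
qed

text \<open>Given finitely many formulas, a realization \<open>x\<close> below \<open>b\<close> and
  below all their parameters satisfies one of them. If a sequence of conjugates of its parameters is
  given, a point \<open>x'\<close> below all of them relates to each conjugate as \<open>x\<close>
  does to the original, so no subfamily is inconsistent.\<close>

lemma low_type_not_forks:
  assumes ab: "below a b"
  shows "\<not> forks tree_lang tree_model 1 {} (low_type b a)"
proof
  assume "forks tree_lang tree_model 1 {} (low_type b a)"
  then obtain \<Psi> where \<Psi>: "finite \<Psi>" "\<Psi> \<subseteq> forms_over tree_lang 1 (range code)"
    and div: "\<And>\<psi>. \<psi> \<in> \<Psi> \<Longrightarrow> divides tree_lang tree_model 1 {} \<psi>"
    and cover: "\<And>s. realizes tree_model 1 (low_type b a) s \<Longrightarrow> \<exists>\<psi>\<in>\<Psi>. pholds tree_model s \<psi>"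
    unfolding forks_def by auto
  define C where "C = insert b (decode ` (\<Union>\<psi>\<in>\<Psi>. set (snd \<psi>)))"
  have "countable C" "C \<noteq> {}" using \<Psi>(1) by (auto simp: C_def countable_finite)
  then obtain x where x: "\<And>c. c \<in> C \<Longrightarrow> delta x c = lev x" "\<And>c c'. c \<in> C \<Longrightarrow> c' \<in> C \<Longrightarrow> lev x < delta c c'"
    using exists_below by metis
  have "below x b" using x(1)[of b] x(2)[of b b] by (simp add: below_def C_def)
  then obtain \<psi> where \<psi>: "\<psi> \<in> \<Psi>" "pholds tree_model [code x] \<psi>"
    using cover[of "[code x]"] realizes_low_type[OF ab] by blast
  obtain \<phi> cc where \<psi>e: "\<psi> = (\<phi>, cc)" by (cases \<psi>)
  have wf: "wf_fm tree_lang \<phi>" "fv \<phi> \<subseteq> {..<1 + length cc}" "set cc \<subseteq> range code"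
    using \<psi>(1) \<Psi>(2) by (auto simp: \<psi>e forms_over_def)
  then obtain cs where cs: "cc = map code cs" using code_list by blast
  have csC: "set cs \<subseteq> C" using \<psi>(1) unfolding C_def by (force simp: \<psi>e cs image_iff)
  from div[OF \<psi>(1)] obtain B :: "nat \<Rightarrow> nat set set list" and k where
    B: "\<forall>i. set (B i) \<subseteq> carrier tree_model \<and> same_type tree_lang tree_model {} (B i) (snd \<psi>)"
    and inc: "\<forall>S. finite S \<and> card S = k \<longrightarrow>
      \<not> (\<exists>s\<in>tuples tree_model 1. \<forall>i\<in>S. pholds tree_model s (fst \<psi>, B i))"
    unfolding divides_def by (elim exE conjE) (rule that, assumption+)
  have "\<forall>i. \<exists>bs. B i = map code bs" using B code_list by simp
  then obtain bs where bs: "\<And>i. B i = map code (bs i)" by metis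
  define C' where "C' = insert b (\<Union>i. set (bs i))"
  have "countable C'" "C' \<noteq> {}" by (auto simp: C'_def countable_finite)
  then obtain x' where x': "\<And>c. c \<in> C' \<Longrightarrow> delta x' c = lev x'"
      "\<And>c c'. c \<in> C' \<Longrightarrow> c' \<in> C' \<Longrightarrow> lev x' < delta c c'"
    using exists_below by metis
  have "pholds tree_model [code x'] (\<phi>, B i)" for i
  proof -
    have st: "length (bs i) = length cs" "elt_iso (set (zip (bs i) cs))"
      using iso_of_same_type[of "{}" "bs i" cs] B by (simp_all add: bs cs \<psi>e)
    have zip: "fst p \<in> C'" "snd p \<in> C" if "p \<in> set (zip (bs i) cs)" for p
    proof -
      have "(fst p, snd p) \<in> set (zip (bs i) cs)" using that by simp
      then have "fst p \<in> set (bs i)" "snd p \<in> set cs"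
        using set_zip_leftD set_zip_rightD by fast+
      then show "fst p \<in> C'" "snd p \<in> C" using csC unfolding C'_def by blast+
    qed
    have iso: "elt_iso (insert (x', x) (set (zip (bs i) cs)))"
      by (rule elt_iso_insert_under[OF st(2)]) (use zip x x' in auto)
    have "pholds tree_model (map code [x']) (\<phi>, map code (bs i)) \<longleftrightarrow> pholds tree_model (map code [x]) (\<phi>, map code cs)"
      by (rule pholds_iso[OF iso]) (use wf st cs in \<open>auto simp: countable_finite\<close>)
    then show ?thesis using \<psi>(2) by (simp add: \<psi>e bs cs)
  qed
  moreover have "[code x'] \<in> tuples tree_model 1" by (simp add: tuples_def)
  ultimately show False using inc[rule_format, of "{..<k}"] by (auto simp: \<psi>e)
qed

lemma alternation_once:
  fixes P :: "nat \<Rightarrow> bool"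
  assumes "(\<forall>i j. i \<le> j \<longrightarrow> P i \<longrightarrow> P j) \<or> (\<forall>i j. i \<le> j \<longrightarrow> P j \<longrightarrow> P i)"
  shows "card {j. P (2 * j) \<noteq> P (2 * j + 1)} \<le> 1" "finite {j. P (2 * j) \<noteq> P (2 * j + 1)}"
proof -
  have "i = j" if "P (2 * i) \<noteq> P (2 * i + 1)" "P (2 * j) \<noteq> P (2 * j + 1)" for i j
  proof (rule ccontr)
    assume "i \<noteq> j"
    then consider "2 * i + 1 \<le> 2 * j" | "2 * j + 1 \<le> 2 * i" by linarith
    then show False
    proof cases
      case 1
      then show False using assms that by (meson le_add1 order_refl order_trans)
    next
      case 2
      then show False using assms that by (meson le_add1 order_refl order_trans)
    qed
  qed
  then obtain k where "{j. P (2 * j) \<noteq> P (2 * j + 1)} \<subseteq> {k}" by blast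
  then show "card {j. P (2 * j) \<noteq> P (2 * j + 1)} \<le> 1" "finite {j. P (2 * j) \<noteq> P (2 * j + 1)}"
    using card_mono[of "{k}"] finite_subset by fastforce+
qed

text \<open>Along a subsequence with monotone levels, ask for a tuple \<open>ys\<close> that makes
  the formula true exactly at the even members. Every pair of consecutive members must then be told
  apart by \<open>ys\<close>, either by membership or by one of the levels \<open>delta u v\<close>
  with \<open>u\<close> and \<open>v\<close> from \<open>ys\<close> and \<open>b\<close>. Each entry
  and each level serves a bounded number of pairs, by \<open>alternation_once\<close> for the levels,
  and their number depends only on the length of \<open>ys\<close>.\<close>

lemma NIP_low_type:
  assumes ab: "below a b"
  shows "NIP tree_lang tree_model 1 (low_type b a)"
proof
  assume "IP tree_lang tree_model 1 (low_type b a)"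
  then obtain \<phi> m and A :: "nat \<Rightarrow> nat set set list" where
    \<phi>: "wf_fm tree_lang \<phi>" "fv \<phi> \<subseteq> {..<m + 1}"
    and A: "\<forall>i. realizes tree_model 1 (low_type b a) (A i)"
    and cons: "\<forall>s. consistent tree_model m ({(\<phi>, A i) | i. i \<in> s} \<union> {(Neg \<phi>, A i) | i. i \<notin> s})"
    unfolding IP_def by (elim exE conjE) (rule that, assumption+)
  obtain X where X: "\<And>i. A i = [code (X i)]" "\<And>i. below (X i) b"
    using A unfolding realizes_low_type[OF ab] by metis
  have pattern: "\<exists>ys. length ys = m \<and> (\<forall>i\<in>S. pholds tree_model (map code ys) (\<phi>, A i) \<longleftrightarrow> i \<in> s)"
    if "finite S" for S s
  proof -
    define \<Delta> where "\<Delta> = (\<lambda>i. if i \<in> s then (\<phi>, A i) else (Neg \<phi>, A i)) ` S"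
    have "\<Delta> \<subseteq> {(\<phi>, A i) | i. i \<in> s} \<union> {(Neg \<phi>, A i) | i. i \<notin> s}" "finite \<Delta>"
      using that by (auto simp: \<Delta>_def)
    then obtain y where y: "realizes tree_model m \<Delta> y" using cons unfolding consistent_def by blast
    then have "set y \<subseteq> range code" by (simp add: realizes_def tuples_def)
    then obtain ys where ys: "y = map code ys" using code_list by blast
    have "pholds tree_model y (\<phi>, A i) \<longleftrightarrow> i \<in> s" if "i \<in> S" for i
    proof -
      have "(if i \<in> s then (\<phi>, A i) else (Neg \<phi>, A i)) \<in> \<Delta>" using that by (simp add: \<Delta>_def)
      then have "pholds tree_model y (if i \<in> s then (\<phi>, A i) else (Neg \<phi>, A i))"
        using y by (simp add: realizes_def)
      then show ?thesis by (auto simp: pholds_def holds_def split: if_splits)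
    qed
    then show ?thesis using y ys by (intro exI[of _ ys]) (auto simp: realizes_def tuples_def)
  qed
  have inj: "inj X"
  proof (rule injI, rule ccontr)
    fix i j assume "X i = X j" "i \<noteq> j"
    then show False using pattern[of "{i, j}" "{i}"] X(1) by auto
  qed
  obtain f :: "nat \<Rightarrow> nat" where f: "strict_mono f" "monoseq (\<lambda>n. lev (X (f n)))"
    using seq_monosub[of "\<lambda>n. lev (X n)"] by blast
  define z where "z j = X (f j)" for j
  have injf: "inj f" using f(1) by (rule strict_mono_imp_inj_on)
  then have injz: "inj z" using inj by (auto simp: z_def inj_def)
  \<comment> \<open>Each of the at most \<open>m + 1\<close> points of \<open>Y\<close> can occur once in an even
    and once in an odd place, and each of the at most \<open>(m + 1) * (m + 1)\<close> levels can
    separate one pair by a strict inequality and one by a weak one.\<close>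
  define N where "N = 2 * (m + 1) + 2 * (m + 1) * (m + 1)"
  have "finite (f ` {..<2 * (N + 1)})" by simp
  from pattern[OF this, of "f ` {j. even j}"] obtain ys where ys: "length ys = m"
    "\<forall>i\<in>f ` {..<2 * (N + 1)}. pholds tree_model (map code ys) (\<phi>, A i) \<longleftrightarrow> i \<in> f ` {j. even j}"
    by blast
  have alt: "pholds tree_model (map code ys) (\<phi>, [code (z (2 * j))])"
    "\<not> pholds tree_model (map code ys) (\<phi>, [code (z (2 * j + 1))])" if "j < N + 1" for j
  proof -
    have "f (2 * j) \<in> f ` {..<2 * (N + 1)}" "f (2 * j + 1) \<in> f ` {..<2 * (N + 1)}" using that by auto
    moreover have "f (2 * j) \<in> f ` {j. even j}" "f (2 * j + 1) \<notin> f ` {j. even j}"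
      using injf by (auto simp: inj_eq)
    ultimately show "pholds tree_model (map code ys) (\<phi>, [code (z (2 * j))])"
      "\<not> pholds tree_model (map code ys) (\<phi>, [code (z (2 * j + 1))])"
      using ys(2) unfolding z_def X(1)[symmetric] by blast+
  qed
  define Y where "Y = insert b (set ys)"
  have Y: "finite Y" "card Y \<le> m + 1"
    using ys(1) card_length[of ys] card_insert_le_m1[of "m + 1" "set ys" b] by (auto simp: Y_def)
  define J1 where "J1 = {j. z (2 * j) \<in> Y}"
  define J2 where "J2 = {j. z (2 * j + 1) \<in> Y}"
  define J3 where "J3 l = {j. (lev (z (2 * j)) < l) \<noteq> (lev (z (2 * j + 1)) < l)}" for l
  define J4 where "J4 l = {j. (lev (z (2 * j)) \<le> l) \<noteq> (lev (z (2 * j + 1)) \<le> l)}" for l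
  define \<Theta> where "\<Theta> = (\<lambda>(u, v). delta u v) ` (Y \<times> Y)"
  have "{..<N + 1} \<subseteq> J1 \<union> J2 \<union> (\<Union>l\<in>\<Theta>. J3 l) \<union> (\<Union>l\<in>\<Theta>. J4 l)"
  proof
    fix j assume "j \<in> {..<N + 1}"
    then have j: "j < N + 1" by simp
    show "j \<in> J1 \<union> J2 \<union> (\<Union>l\<in>\<Theta>. J3 l) \<union> (\<Union>l\<in>\<Theta>. J4 l)"
    proof (rule ccontr)
      assume no: "\<not> ?thesis"
      have iso: "elt_iso (insert (z (2 * j), z (2 * j + 1)) (Id_on Y))"
      proof (rule elt_iso_below_interval)
        show "b \<in> Y" by (simp add: Y_def)
        show "below (z (2 * j)) b" "below (z (2 * j + 1)) b" by (simp_all add: z_def X)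
        show "z (2 * j) \<notin> Y" "z (2 * j + 1) \<notin> Y" using no by (auto simp: J1_def J2_def)
        show "(lev (z (2 * j)) < delta u v \<longleftrightarrow> lev (z (2 * j + 1)) < delta u v) \<and>
            (lev (z (2 * j)) \<le> delta u v \<longleftrightarrow> lev (z (2 * j + 1)) \<le> delta u v)"
          if "u \<in> Y" "v \<in> Y" for u v
        proof -
          have "delta u v \<in> \<Theta>" using that by (force simp: \<Theta>_def)
          then show ?thesis using no by (auto simp: J3_def J4_def)
        qed
      qed
      have "pholds tree_model (map code ys) (\<phi>, map code [z (2 * j)]) \<longleftrightarrow>
          pholds tree_model (map code ys) (\<phi>, map code [z (2 * j + 1)])"
        by (rule pholds_iso[OF iso])
          (use \<phi> ys(1) Y in \<open>auto simp: Y_def zip_same_conv_map simp: countable_finite\<close>)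
      then show False using alt[OF j] by simp
    qed
  qed
  moreover have J12: "finite J1 \<and> card J1 \<le> m + 1" "finite J2 \<and> card J2 \<le> m + 1"
  proof -
    have "inj_on (\<lambda>j. z (2 * j)) J1" "inj_on (\<lambda>j. z (2 * j + 1)) J2"
      by (rule inj_onI, drule injD[OF injz], simp)+
    moreover have "(\<lambda>j. z (2 * j)) ` J1 \<subseteq> Y" "(\<lambda>j. z (2 * j + 1)) ` J2 \<subseteq> Y"
      by (auto simp: J1_def J2_def)
    ultimately show "finite J1 \<and> card J1 \<le> m + 1" "finite J2 \<and> card J2 \<le> m + 1"
      using Y card_inj_on_le[of _ _ Y] inj_on_finite[of _ _ Y] by (metis order_trans)+
  qed
  moreover have mono: "(\<forall>i j. i \<le> j \<longrightarrow> lev (z i) \<le> lev (z j)) \<or> (\<forall>i j. i \<le> j \<longrightarrow> lev (z j) \<le> lev (z i))"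
    using f(2) by (auto simp: monoseq_def z_def)
  moreover have "finite (J3 l) \<and> card (J3 l) \<le> 1" "finite (J4 l) \<and> card (J4 l) \<le> 1" for l
  proof -
    have "(\<forall>i j. i \<le> j \<longrightarrow> lev (z i) < l \<longrightarrow> lev (z j) < l) \<or> (\<forall>i j. i \<le> j \<longrightarrow> lev (z j) < l \<longrightarrow> lev (z i) < l)"
      using mono by (meson le_less_trans)
    from alternation_once[of "\<lambda>i. lev (z i) < l", OF this]
    show "finite (J3 l) \<and> card (J3 l) \<le> 1" by (simp add: J3_def)
    have "(\<forall>i j. i \<le> j \<longrightarrow> lev (z i) \<le> l \<longrightarrow> lev (z j) \<le> l) \<or> (\<forall>i j. i \<le> j \<longrightarrow> lev (z j) \<le> l \<longrightarrow> lev (z i) \<le> l)"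
      using mono by (meson order_trans)
    from alternation_once[of "\<lambda>i. lev (z i) \<le> l", OF this]
    show "finite (J4 l) \<and> card (J4 l) \<le> 1" by (simp add: J4_def)
  qed
  moreover have \<Theta>: "finite \<Theta>" "card \<Theta> \<le> (m + 1) * (m + 1)"
  proof -
    show "finite \<Theta>" using Y by (simp add: \<Theta>_def)
    have "card \<Theta> \<le> card (Y \<times> Y)" unfolding \<Theta>_def using Y by (intro card_image_le) simp
    also have "\<dots> = card Y * card Y" by (rule card_cartesian_product)
    also have "\<dots> \<le> (m + 1) * (m + 1)" using Y(2) by (intro mult_le_mono)
    finally show "card \<Theta> \<le> (m + 1) * (m + 1)" .
  qed
  ultimately have "N + 1 \<le> card (J1 \<union> J2 \<union> (\<Union>l\<in>\<Theta>. J3 l) \<union> (\<Union>l\<in>\<Theta>. J4 l))"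
    using card_mono[of "J1 \<union> J2 \<union> (\<Union>l\<in>\<Theta>. J3 l) \<union> (\<Union>l\<in>\<Theta>. J4 l)" "{..<N + 1}"] by simp
  also have "\<dots> \<le> card J1 + card J2 + card (\<Union>l\<in>\<Theta>. J3 l) + card (\<Union>l\<in>\<Theta>. J4 l)"
    by (meson add_le_mono card_Un_le order_trans order_refl)
  also have "card (\<Union>l\<in>\<Theta>. J3 l) \<le> (\<Sum>l\<in>\<Theta>. card (J3 l))" using \<Theta>(1) by (rule card_UN_le)
  also have "card (\<Union>l\<in>\<Theta>. J4 l) \<le> (\<Sum>l\<in>\<Theta>. card (J4 l))" using \<Theta>(1) by (rule card_UN_le)
  also have "(\<Sum>l\<in>\<Theta>. card (J3 l)) \<le> card \<Theta>"
    using sum_bounded_above[of \<Theta> "\<lambda>l. card (J3 l)" 1]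
      \<open>\<And>l. finite (J3 l) \<and> card (J3 l) \<le> 1\<close> by simp
  also have "(\<Sum>l\<in>\<Theta>. card (J4 l)) \<le> card \<Theta>"
    using sum_bounded_above[of \<Theta> "\<lambda>l. card (J4 l)" 1]
      \<open>\<And>l. finite (J4 l) \<and> card (J4 l) \<le> 1\<close> by simp
  finally show False using J12 \<Theta>(2) unfolding N_def by simp
qed

section \<open>Totally indiscernible sequences inside one node\<close>

text \<open>Infinitely many points on the node of \<open>a\<close>.\<close>

definition twin :: "elt \<Rightarrow> nat \<Rightarrow> elt" where
  "twin a n = mk_elt (lev a) (lab a) {n}"

lemma twin [simp]: "lev (twin a n) = lev a" "lab (twin a n) = lab a" "tag (twin a n) = {n}"
  by (simp_all add: twin_def)

lemma twin_eq_iff [simp]: "twin a m = twin a n \<longleftrightarrow> m = n"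
  by (auto simp: elt_eq_iff)

lemma below_twin: "below a b \<Longrightarrow> below (twin a n) b"
  using rel_same_node(1)[of "twin a n" a b] by (simp add: below_def)

text \<open>A copy of the rational order, whose cut at \<open>0\<close> has no endpoints on either
  side, inside the universe type, where index sets have to live.\<close>

definition rat_point :: "rat \<Rightarrow> nat set set" where "rat_point q = {{to_nat q}}"

lemma rat_point_eq_iff [simp]: "rat_point x = rat_point y \<longleftrightarrow> x = y"
  by (simp add: rat_point_def)

definition rat_order :: "nat set set rel" where
  "rat_order = {(rat_point x, rat_point y) | x y. x < y}"

lemma rat_order_iff [simp]: "(rat_point x, rat_point y) \<in> rat_order \<longleftrightarrow> x < y"
  by (auto simp: rat_order_def)

definition twin_seq :: "elt \<Rightarrow> nat set set \<Rightarrow> nat set set list" where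
  "twin_seq a j = [code (twin a (to_nat (inv rat_point j)))]"

lemma twin_seq_rat_point [simp]: "twin_seq a (rat_point q) = [code (twin a (to_nat q))]"
  by (simp add: twin_seq_def inj_def)

lemma cut_sequence_twin_seq: "cut_sequence tree_model 1 (range rat_point) rat_order (rat_point 0) (twin_seq a)"
proof -
  have "trans rat_order" by (auto simp: rat_order_def intro!: transI)
  moreover have "irrefl rat_order" by (auto simp: rat_order_def irrefl_def)
  moreover have "total_on (range rat_point) rat_order" by (auto simp: total_on_def)
  ultimately have lin: "strict_linear_order_on (range rat_point) rat_order"
    by (simp add: strict_linear_order_on_def)
  have "{j \<in> range rat_point. (j, rat_point 0) \<in> rat_order} = rat_point ` {..<0}" "{j \<in> range rat_point. (rat_point 0, j) \<in> rat_order} = rat_point ` {0<..}"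
    by auto
  moreover have "infinite (rat_point ` {..<0})" "infinite (rat_point ` {0<..})"
    by (auto simp: finite_image_iff inj_on_def infinite_Iio infinite_Ioi)
  moreover have "(\<exists>i\<in>rat_point ` {..<0}. (i, j) \<in> rat_order) \<and> (\<exists>i\<in>rat_point ` {..<0}. (j, i) \<in> rat_order)"
    if j: "j \<in> rat_point ` {..<0}" for j
  proof -
    obtain x where "j = rat_point x" "x < 0" using j by auto
    moreover obtain y where "x < y" "y < 0" using dense[OF \<open>x < 0\<close>] by blast
    moreover obtain w where "w < x" using lt_ex by blast
    moreover have "w < 0" using \<open>w < x\<close> \<open>x < 0\<close> by (rule less_trans)
    ultimately show ?thesis by auto
  qed
  moreover have "(\<exists>i\<in>rat_point ` {0<..}. (i, j) \<in> rat_order) \<and> (\<exists>i\<in>rat_point ` {0<..}. (j, i) \<in> rat_order)"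
    if j: "j \<in> rat_point ` {0<..}" for j
  proof -
    obtain x where "j = rat_point x" "0 < x" using j by auto
    moreover obtain y where "y < x" "0 < y" using dense[OF \<open>0 < x\<close>] by blast
    moreover obtain w where "x < w" using gt_ex by blast
    moreover have "0 < w" using \<open>0 < x\<close> \<open>x < w\<close> by (rule less_trans)
    ultimately show ?thesis by auto
  qed
  ultimately show ?thesis
    using lin by (simp add: cut_sequence_def infinite_no_endpoints_def tuples_def twin_seq_def)
qed

lemma sorted_rat_order_distinct: "sorted_wrt (\<lambda>i j. (i, j) \<in> rat_order) is \<Longrightarrow> distinct is"
  by (induction "is") (auto simp: rat_order_def)

text \<open>Any injective rearrangement within one node is a partial isomorphism, also jointly with
  fixed points that are not moved.\<close>

lemma indiscernible_twin_seq:
  assumes J: "J \<subseteq> range rat_point" and C: "\<And>q. rat_point q \<in> J \<Longrightarrow> twin a (to_nat q) \<notin> C"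
    and cC: "countable C"
  shows "indiscernible tree_lang tree_model (code ` C) J rat_order (twin_seq a)"
  unfolding indiscernible_def
proof (intro allI impI)
  fix "is" js
  assume H: "set is \<subseteq> J \<and> set js \<subseteq> J \<and> length is = length js \<and>
    sorted_wrt (\<lambda>i j. (i, j) \<in> rat_order) is \<and> sorted_wrt (\<lambda>i j. (i, j) \<in> rat_order) js"
  define t where "t j = twin a (to_nat (inv rat_point j))" for j
  have inv: "inv rat_point (rat_point q) = q" for q by (simp add: inj_def)
  have t_eq: "t i = t j \<longleftrightarrow> i = j" if "i \<in> J" "j \<in> J" for i j
  proof -
    obtain x y where "i = rat_point x" "j = rat_point y" using \<open>i \<in> J\<close> \<open>j \<in> J\<close> J by blast
    then show ?thesis by (simp add: t_def inv)
  qed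
  have tC: "t j \<notin> C" if "j \<in> J" for j
  proof -
    obtain x where "j = rat_point x" using \<open>j \<in> J\<close> J by blast
    then show ?thesis using C \<open>j \<in> J\<close> by (simp add: t_def inv)
  qed
  have concat: "concat (map (twin_seq a) ks) = map code (map t ks)" for ks
    by (induction ks) (simp_all add: twin_seq_def t_def)
  define h where "h = set (zip (map t is) (map t js)) \<union> Id_on C"
  have mem: "(\<exists>k<length is. p = (t (is ! k), t (js ! k))) \<or> (\<exists>c\<in>C. p = (c, c))" if "p \<in> h" for p
    using that H by (auto simp: h_def set_zip)
  have dist: "distinct is" "distinct js" using H sorted_rat_order_distinct by auto
  have inJ: "is ! k \<in> J" "js ! k \<in> J" if "k < length is" for k
    using H that by (auto simp: subset_iff)
  have "elt_iso h"
  proof (rule elt_iso_same_node)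
    show "lev (fst p) = lev (snd p) \<and> lab (fst p) = lab (snd p)" if "p \<in> h" for p
      using mem[OF that] by (auto simp: t_def)
    show "fst p = fst q \<longleftrightarrow> snd p = snd q" if "p \<in> h" "q \<in> h" for p q
    proof -
      have "t (is ! k) = t (is ! l) \<longleftrightarrow> t (js ! k) = t (js ! l)" if "k < length is" "l < length is" for k l
        using that dist H by (simp add: t_eq inJ nth_eq_iff_index_eq)
      moreover have "t (is ! k) \<noteq> c" "t (js ! k) \<noteq> c" "c \<noteq> t (is ! k)" "c \<noteq> t (js ! k)"
        if "k < length is" "c \<in> C" for k c
        using tC[OF inJ(1)[OF that(1)]] tC[OF inJ(2)[OF that(1)]] that(2) by auto
      ultimately show ?thesis using mem[OF that(1)] mem[OF that(2)] by auto
    qed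
  qed
  then have "same_type tree_lang tree_model (code ` C) (map code (map t is)) (map code (map t js))"
    by (rule same_typeI) (use H cC in \<open>auto simp: h_def countable_finite\<close>)
  then show "same_type tree_lang tree_model (code ` C) (concat (map (twin_seq a) is)) (concat (map (twin_seq a) js))"
    by (simp only: concat)
qed

text \<open>Equality with the member at the cut tells it from the others.\<close>

lemma not_indiscernible_twin_seq:
  assumes "code (twin a (to_nat (0 :: rat))) \<in> D"
  shows "\<not> indiscernible tree_lang tree_model D (range rat_point) rat_order (twin_seq a)"
proof
  assume "indiscernible tree_lang tree_model D (range rat_point) rat_order (twin_seq a)"
  then have "same_type tree_lang tree_model D (concat (map (twin_seq a) [rat_point 0])) (concat (map (twin_seq a) [rat_point 1]))"
    unfolding indiscernible_def by (elim allE[of _ "[rat_point 0]"] allE[of _ "[rat_point 1]"]) simp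
  moreover have "(Eq (Var 0) (Var 1), [code (twin a (to_nat (0 :: rat)))]) \<in> forms_over tree_lang 1 D"
    using assms by (simp add: forms_over_def)
  ultimately show False
    unfolding same_type_def using inj_code by (auto simp: pholds_def holds_def inj_eq)
qed

lemma low_type_not_distal:
  assumes "below a b"
  shows "\<not> distal tree_lang tree_model 1 (low_type b a)"
proof
  assume distal: "distal tree_lang tree_model 1 (low_type b a)"
  let ?d = "[code (twin a (to_nat (0 :: rat)))]"
  have "realizes tree_model 1 (low_type b a) (twin_seq a j)" for j
    unfolding realizes_low_type[OF assms] twin_seq_def using below_twin[OF assms] by blast
  moreover have "indiscernible tree_lang tree_model {} (range rat_point) rat_order (twin_seq a)"
    using indiscernible_twin_seq[of "range rat_point" a "{}"] by simp
  moreover have "indiscernible tree_lang tree_model (set ?d) (range rat_point - {rat_point 0}) rat_order (twin_seq a)"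
    using indiscernible_twin_seq[of "range rat_point - {rat_point 0}" a "{twin a (to_nat (0 :: rat))}"] by auto
  moreover have "set ?d \<subseteq> carrier tree_model" by simp
  ultimately have "indiscernible tree_lang tree_model (set ?d) (range rat_point) rat_order (twin_seq a)"
    using distal cut_sequence_twin_seq[of a] unfolding distal_def by blast
  then show False using not_indiscernible_twin_seq[of a "set ?d"] by simp
qed

lemma low_type_not_codistal:
  assumes ab: "below a b"
  shows "\<not> codistal tree_lang tree_model 1 {code b} (low_type b a)"
proof
  assume codistal: "codistal tree_lang tree_model 1 {code b} (low_type b a)"
  let ?d = "[code (twin a (to_nat (0 :: rat)))]"
  have tb: "twin a n \<noteq> b" for n
  proof
    assume "twin a n = b"
    then have "lev b = lev a" by auto
    then show False using ab by (simp add: below_def)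
  qed
  have "realizes tree_model 1 (low_type b a) ?d"
    unfolding realizes_low_type[OF ab] using below_twin[OF ab] by blast
  moreover have "indiscernible tree_lang tree_model {code b} (range rat_point) rat_order (twin_seq a)"
    using indiscernible_twin_seq[of "range rat_point" a "{b}"] tb by simp
  moreover have "indiscernible tree_lang tree_model ({code b} \<union> set ?d) (range rat_point - {rat_point 0}) rat_order (twin_seq a)"
    using indiscernible_twin_seq[of "range rat_point - {rat_point 0}" a "{twin a (to_nat (0 :: rat)), b}"] tb by auto
  ultimately have "indiscernible tree_lang tree_model ({code b} \<union> set ?d) (range rat_point) rat_order (twin_seq a)"
    using codistal cut_sequence_twin_seq[of a] unfolding codistal_def by blast
  then show False using not_indiscernible_twin_seq[of a "{code b} \<union> set ?d"] by simp
qed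

theorem proposition4p32:
  shows "\<exists>(L :: (nat, nat) language) T (\<kappa> :: nat set set rel)
            (M :: (nat, nat, nat set set) struct) A B n p.
      complete_theory TYPE(nat set set) L T \<and>
      monster_model \<kappa> L T M \<and>
      A \<subseteq> B \<and> B \<subseteq> carrier M \<and> small \<kappa> B \<and>
      p \<in> type_space L M n B \<and>
      NIP L M n p \<and>
      \<not> forks L M n A p \<and>
      IP L M n (restrict_type L n A p) \<and>
      \<not> distal L M n p \<and>
      \<not> codistal L M n B p"
proof -
  obtain a where a: "\<forall>c\<in>{undefined}. delta a c = lev a \<and> (\<forall>c'\<in>{undefined}. lev a < delta c c')"
    using exists_below[of "{undefined :: elt}"] by auto
  then have ab: "below a undefined" by (simp add: below_def)
  show ?thesis
    by (rule exI[of _ tree_lang], rule exI[of _ tree_theory], rule exI[of _ aleph1], rule exI[of _ tree_model],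
        rule exI[of _ "{}"], rule exI[of _ "{code undefined}"], rule exI[of _ 1],
        rule exI[of _ "low_type undefined a"])
      (intro conjI complete_tree_theory monster_tree_model low_type_in_type_space NIP_low_type[OF ab]
        low_type_not_forks[OF ab] IP_low_type_restrict low_type_not_distal[OF ab]
        low_type_not_codistal[OF ab]; simp)
qed

end
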